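(* Let $n\ge6$ be an integer. Put $$ \hat t_{1}=-\frac{n-4}{2(2n-3)}-\frac{\sqrt{5(n-4)(2n-5)}}{2(2n-3)(2n-5)},\qquad \hat t_{2}=-\frac{n-4}{2(2n-3)}+\frac{\sqrt{5(n-4)(2n-5)}}{2(2n-3)(2n-5)}, $$ let $\varphi\in\left(\frac{\pi}{4},\frac{\pi}{2}\right)$ be the angle with $\cos\varphi=\dfrac{2n-11}{2n-5}\cdot\dfrac{\sqrt{2n-3}}{\sqrt{5(n-3)}}$, and put $$ \begin{aligned} t_1&=-\frac{n-3}{2(2n-1)}-\frac{\sqrt{5(n-3)}}{(2n-1)\sqrt{2n-3}}\cos\left(\frac{\varphi}{3}-\frac{\pi}{3}\right),\\ t_2&=-\frac{n-3}{2(2n-1)}-\frac{\sqrt{5(n-3)}}{(2n-1)\sqrt{2n-3}}\cos\left(\frac{\varphi}{3}+\frac{\pi}{3}\right),\\ t_3&=-\frac{n-3}{2(2n-1)}+\frac{\sqrt{5(n-3)}}{(2n-1)\sqrt{2n-3}}\cos\frac{\varphi}{3}. \end{aligned} $$ Then $-\frac14<t_1<\hat t_1<t_2<\hat t_2<t_3<0$, and the extremum points of the function $a\mapsto A^2_{n,5}(a)$ on $(0;1)$ are the following: $a=\frac12$ and $a=\frac12\pm\frac12\sqrt{1+4\hat t_i}$, $i=1,2$, are points of (local) minimum, and $a=\frac12\pm\frac12\sqrt{1+4t_i}$, $i=1,2,3$, are points of (local) maximum.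
   Context: For integers $n\ge1$, $0\le k\le n-1$ and $a\in(0;1)$, $A_{n,k}(a):=\sup\{|f^{(k)}(a)| : f\in \mathring{W}_2^n[0;1],\ \int_0^1|f^{(n)}(x)|^2dx\le 1\}$ and $A^2_{n,k}(a)=(A_{n,k}(a))^2$. Here $\mathring{W}_2^n[0;1]$ is the space of functions $f$ on $[0;1]$ whose derivatives up to order $n-1$ are absolutely continuous, with $f^{(n)}\in L_2[0;1]$ and $f^{(j)}(0)=f^{(j)}(1)=0$ for $j=0,\dots,n-1$. *)

theory Defs
  imports "HOL-Analysis.Analysis"
begin

text \<open>Absolute continuity of a function on the interval from \<open>a\<close> to \<open>b\<close>. The set \<open>I\<close> lists the
  endpoints of finitely many non-overlapping subintervals, which may share endpoints.\<close>

definition absolutely_continuous_on_interval :: "real \<Rightarrow> real \<Rightarrow> (real \<Rightarrow> real) \<Rightarrow> bool" where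
  "absolutely_continuous_on_interval a b f \<longleftrightarrow>
     (\<forall>\<epsilon>>0. \<exists>\<delta>>0. \<forall>I :: (real \<times> real) set.
        finite I \<longrightarrow>
        (\<forall>(u, v)\<in>I. a \<le> u \<and> u \<le> v \<and> v \<le> b) \<longrightarrow>
        disjoint_family_on (\<lambda>(u, v). {u<..<v}) I \<longrightarrow>
        (\<Sum>(u, v)\<in>I. v - u) < \<delta> \<longrightarrow>
        (\<Sum>(u, v)\<in>I. \<bar>f v - f u\<bar>) < \<epsilon>)"

text \<open>The \<open>k\<close>-th derivative on the closed unit interval: one-sided at 0 and 1, and independent of
  the values of \<open>f\<close> outside the interval. Where a derivative does not exist the value is arbitrary
  (in \<open>W20\<close> below this only happens for order \<open>n\<close>, on a null set).\<close>

definition nth_deriv :: "nat \<Rightarrow> (real \<Rightarrow> real) \<Rightarrow> real \<Rightarrow> real" where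
  "nth_deriv k = (\<lambda>g x. vector_derivative g (at x within {0..1})) ^^ k"

definition L2 :: "(real \<Rightarrow> real) \<Rightarrow> bool" where
  "L2 g \<longleftrightarrow> g \<in> borel_measurable (lebesgue_on {0..1}) \<and>
            integrable (lebesgue_on {0..1}) (\<lambda>x. \<bar>g x\<bar>\<^sup>2)"

definition W20 :: "nat \<Rightarrow> (real \<Rightarrow> real) set" where
  "W20 n = {f.
     (\<forall>j. Suc j < n \<longrightarrow> nth_deriv j f differentiable_on {0..1}) \<and>
     (\<forall>j<n. absolutely_continuous_on_interval 0 1 (nth_deriv j f)) \<and>
     L2 (nth_deriv n f) \<and>
     (\<forall>j<n. nth_deriv j f 0 = 0 \<and> nth_deriv j f 1 = 0)}"

text \<open>For \<open>k < n\<close> and \<open>0 < a < 1\<close> the set below is nonempty and bounded, so the real-valued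
  supremum is the genuine one.\<close>

definition A :: "nat \<Rightarrow> nat \<Rightarrow> real \<Rightarrow> real" where
  "A n k a = Sup {\<bar>nth_deriv k f a\<bar> | f.
     f \<in> W20 n \<and> (LINT x|lebesgue_on {0..1}. \<bar>nth_deriv n f x\<bar>\<^sup>2) \<le> 1}"

definition local_min_points :: "real set \<Rightarrow> (real \<Rightarrow> real) \<Rightarrow> real set" where
  "local_min_points S F = {a \<in> S. \<forall>\<^sub>F x in at a within S. F a \<le> F x}"

definition local_max_points :: "real set \<Rightarrow> (real \<Rightarrow> real) \<Rightarrow> real set" where
  "local_max_points S F = {a \<in> S. \<forall>\<^sub>F x in at a within S. F x \<le> F a}"

definition t_hat1 :: "nat \<Rightarrow> real" where
  "t_hat1 n = - (real n - 4) / (2 * (2 * real n - 3))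
     - sqrt (5 * (real n - 4) * (2 * real n - 5)) / (2 * (2 * real n - 3) * (2 * real n - 5))"

definition t_hat2 :: "nat \<Rightarrow> real" where
  "t_hat2 n = - (real n - 4) / (2 * (2 * real n - 3))
     + sqrt (5 * (real n - 4) * (2 * real n - 5)) / (2 * (2 * real n - 3) * (2 * real n - 5))"

definition is_angle :: "nat \<Rightarrow> real \<Rightarrow> bool" where
  "is_angle n \<phi> \<longleftrightarrow> \<phi> \<in> {pi / 4<..<pi / 2} \<and>
     cos \<phi> = (2 * real n - 11) / (2 * real n - 5) * (sqrt (2 * real n - 3) / sqrt (5 * (real n - 3)))"

definition t1 :: "nat \<Rightarrow> real \<Rightarrow> real" where
  "t1 n \<phi> = - (real n - 3) / (2 * (2 * real n - 1))
     - sqrt (5 * (real n - 3)) / ((2 * real n - 1) * sqrt (2 * real n - 3)) * cos (\<phi> / 3 - pi / 3)"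

definition t2 :: "nat \<Rightarrow> real \<Rightarrow> real" where
  "t2 n \<phi> = - (real n - 3) / (2 * (2 * real n - 1))
     - sqrt (5 * (real n - 3)) / ((2 * real n - 1) * sqrt (2 * real n - 3)) * cos (\<phi> / 3 + pi / 3)"

definition t3 :: "nat \<Rightarrow> real \<Rightarrow> real" where
  "t3 n \<phi> = - (real n - 3) / (2 * (2 * real n - 1))
     + sqrt (5 * (real n - 3)) / ((2 * real n - 1) * sqrt (2 * real n - 3)) * cos (\<phi> / 3)"

end

theory Submission
  imports Defs "HOL-Computational_Algebra.Polynomial"
begin

text \<open>Put \<open>r = n - k\<close>. Taylor's formula writes \<open>f\<^sup>(\<^sup>k\<^sup>)(a)\<close> as the inner product of \<open>f\<^sup>(\<^sup>n\<^sup>)\<close> with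
  \<open>(a - x)\<^sub>+\<^sup>r\<^sup>-\<^sup>1 / (r - 1)!\<close>, and the boundary conditions say that \<open>f\<^sup>(\<^sup>n\<^sup>)\<close> is orthogonal to the polynomials of
  degree less than \<open>n\<close>. So \<open>A\<^sub>n\<^sub>,\<^sub>k(a)\<close> is the \<open>L\<^sub>2\<close> distance of this kernel from those polynomials. Expanding in
  shifted Legendre polynomials \<open>L\<^sub>m\<close>, whose inner product with the kernel is the \<open>r\<close>-fold primitive
  \<open>(I\<^sup>r L\<^sub>m)(a)\<close>, the derivative of the squared distance telescopes to \<open>- (I\<^sup>r\<^sup>-\<^sup>1 L\<^sub>n)(a) (I\<^sup>r\<^sup>-\<^sup>1 L\<^sub>n\<^sub>-\<^sub>1)(a)\<close>. By
  Rodrigues' formula the two factors are, up to constants, the \<open>(k + 1)\<close>-st derivative of \<open>(x\<^sup>2 - x)\<^sup>n\<close> and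
  the \<open>k\<close>-th derivative of \<open>(x\<^sup>2 - x)\<^sup>n\<^sup>-\<^sup>1\<close>. For \<open>k = 5\<close> this leaves a cubic and a quadratic in
  \<open>t = a\<^sup>2 - a\<close>, with interlacing roots \<open>t\<^sub>i\<close> and \<open>t_hat\<^sub>i\<close>.

  As \<open>f\<^sup>(\<^sup>n\<^sup>-\<^sup>1\<^sup>)\<close> is only absolutely continuous, Taylor's formula needs the Lebesgue fundamental theorem of
  calculus. Here the positive variation splits the function into a difference of monotone absolutely continuous
  ones, whose densities come from the Radon-Nikodym theorem.\<close>

section \<open>Absolutely continuous functions have finite positive variation\<close>

text \<open>Only finitely many Legendre polynomials enter, so no completeness or infinite expansion
  is used. The code works with \<open>i = r - 1\<close>, which is \<open>n - 6\<close> for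
  \<open>k = 5\<close>. The powers of \<open>x^2 - x\<close> are symmetric about \<open>1/2\<close>:
  a derivative of even order is therefore a polynomial in \<open>t\<close> alone, while one of odd
  order also carries the factor \<open>2 * x - 1\<close>. That factor produces the extremum at
  \<open>1/2\<close>. The derivative of the squared distance becomes minus \<open>2 * a - 1\<close>
  times a positive function times five linear factors in \<open>t\<close>, whose sorted roots belong
  alternately to the cubic and to the quadratic; this alternation decides which points are minima
  and which are maxima. The radicals come from completing the square, the cosines from Vieta's
  trigonometric solution of a cubic with three real roots. The interlacing is not read off these
  closed forms. It follows from the signs of the cubic at \<open>-1/4\<close>, at the roots of the
  quadratic and at \<open>0\<close>; at a root of the quadratic the cubic reduces to a linear
  remainder.\<close>

definition interval_family :: "real \<Rightarrow> real \<Rightarrow> (real \<times> real) set \<Rightarrow> bool" where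
  "interval_family a b I \<longleftrightarrow> finite I \<and> (\<forall>(u, v)\<in>I. a \<le> u \<and> u < v \<and> v \<le> b) \<and>
     disjoint_family_on (\<lambda>(u, v). {u<..<v}) I"

lemma interval_family_empty [simp]: "interval_family a b {}"
  by (auto simp: interval_family_def disjoint_family_on_def)

lemma interval_family_mono:
  "interval_family a b I \<Longrightarrow> a' \<le> a \<Longrightarrow> b \<le> b' \<Longrightarrow> interval_family a' b' I"
  by (fastforce simp: interval_family_def)

text \<open>Degenerate pairs \<open>(u, u)\<close> add nothing to either sum. Without them,
  different pairs have disjoint nonempty interiors, so families can be cut, shrunk and glued without
  two pairs being identified.\<close>

lemma absolutely_continuous_on_interval_family:
  "absolutely_continuous_on_interval a b f \<longleftrightarrow>
     (\<forall>\<epsilon>>0. \<exists>\<delta>>0. \<forall>I. interval_family a b I \<longrightarrow>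
        (\<Sum>(u, v)\<in>I. v - u) < \<delta> \<longrightarrow> (\<Sum>(u, v)\<in>I. \<bar>f v - f u\<bar>) < \<epsilon>)" (is "_ \<longleftrightarrow> ?R")
proof
  assume L: "absolutely_continuous_on_interval a b f"
  show ?R
  proof (intro allI impI)
    fix \<epsilon> :: real assume "\<epsilon> > 0"
    with L obtain \<delta> where \<delta>: "\<delta> > 0" "\<forall>I. finite I \<longrightarrow>
        (\<forall>(u, v)\<in>I. a \<le> u \<and> u \<le> v \<and> v \<le> b) \<longrightarrow>
        disjoint_family_on (\<lambda>(u, v). {u<..<v}) I \<longrightarrow>
        (\<Sum>(u, v)\<in>I. v - u) < \<delta> \<longrightarrow> (\<Sum>(u, v)\<in>I. \<bar>f v - f u\<bar>) < \<epsilon>"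
      unfolding absolutely_continuous_on_interval_def by meson
    have "(\<Sum>(u, v)\<in>I. \<bar>f v - f u\<bar>) < \<epsilon>"
      if "interval_family a b I" "(\<Sum>(u, v)\<in>I. v - u) < \<delta>" for I
      using that by (intro \<delta>(2)[rule_format]) (auto simp: interval_family_def)
    then show "\<exists>\<delta>>0. \<forall>I. interval_family a b I \<longrightarrow>
        (\<Sum>(u, v)\<in>I. v - u) < \<delta> \<longrightarrow> (\<Sum>(u, v)\<in>I. \<bar>f v - f u\<bar>) < \<epsilon>"
      using \<delta>(1) by blast
  qed
next
  assume R: ?R
  show "absolutely_continuous_on_interval a b f"
    unfolding absolutely_continuous_on_interval_def
  proof (intro allI impI)
    fix \<epsilon> :: real assume "\<epsilon> > 0"
    then obtain \<delta> where \<delta>: "\<delta> > 0" "\<And>I. interval_family a b I \<Longrightarrow>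
        (\<Sum>(u, v)\<in>I. v - u) < \<delta> \<Longrightarrow> (\<Sum>(u, v)\<in>I. \<bar>f v - f u\<bar>) < \<epsilon>"
      using R by blast
    have *: "(\<Sum>(u, v)\<in>I. \<bar>f v - f u\<bar>) < \<epsilon>"
      if I: "finite I" "\<forall>(u, v)\<in>I. a \<le> u \<and> u \<le> v \<and> v \<le> b"
        "disjoint_family_on (\<lambda>(u, v). {u<..<v}) I" "(\<Sum>(u, v)\<in>I. v - u) < \<delta>" for I
    proof -
      define J where "J = {(u, v) \<in> I. u < v}"
      have "J \<subseteq> I" by (auto simp: J_def)
      have "interval_family a b J"
        unfolding interval_family_def
      proof (intro conjI)
        show "finite J" using I(1) \<open>J \<subseteq> I\<close> by (rule rev_finite_subset)
        show "\<forall>(u, v)\<in>J. a \<le> u \<and> u < v \<and> v \<le> b" using I(2) by (auto simp: J_def)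
        show "disjoint_family_on (\<lambda>(u, v). {u<..<v}) J"
          using I(3) \<open>J \<subseteq> I\<close> by (rule disjoint_family_on_mono[rotated])
      qed
      moreover have "(\<Sum>(u, v)\<in>I. v - u) = (\<Sum>(u, v)\<in>J. v - u)"
        by (rule sum.mono_neutral_right) (use I in \<open>auto simp: J_def\<close>)
      moreover have "(\<Sum>(u, v)\<in>I. \<bar>f v - f u\<bar>) = (\<Sum>(u, v)\<in>J. \<bar>f v - f u\<bar>)"
        by (rule sum.mono_neutral_right) (use I in \<open>force simp: J_def\<close>)+
      ultimately show ?thesis using \<delta>(2)[of J] I(4) by simp
    qed
    show "\<exists>\<delta>>0. \<forall>I. finite I \<longrightarrow> (\<forall>(u, v)\<in>I. a \<le> u \<and> u \<le> v \<and> v \<le> b) \<longrightarrow>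
        disjoint_family_on (\<lambda>(u, v). {u<..<v}) I \<longrightarrow> (\<Sum>(u, v)\<in>I. v - u) < \<delta> \<longrightarrow>
        (\<Sum>(u, v)\<in>I. \<bar>f v - f u\<bar>) < \<epsilon>"
      by (rule exI[of _ \<delta>], intro conjI allI impI \<delta>(1) *)
  qed
qed

lemma interval_family_singleton: "a \<le> u \<Longrightarrow> u < v \<Longrightarrow> v \<le> b \<Longrightarrow> interval_family a b {(u, v)}"
  by (auto simp: interval_family_def disjoint_family_on_def)

lemma absolutely_continuous_imp_continuous_on:
  assumes "absolutely_continuous_on_interval a b f"
  shows "continuous_on {a..b} f"
  unfolding continuous_on_iff
proof (intro ballI allI impI)
  fix x e :: real assume x: "x \<in> {a..b}" and e: "e > 0"
  obtain \<delta> where \<delta>: "\<delta> > 0" "\<And>I. interval_family a b I \<Longrightarrow>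
        (\<Sum>(u, v)\<in>I. v - u) < \<delta> \<Longrightarrow> (\<Sum>(u, v)\<in>I. \<bar>f v - f u\<bar>) < e"
    using assms e unfolding absolutely_continuous_on_interval_family by blast
  have "dist (f y) (f x) < e" if y: "y \<in> {a..b}" "dist y x < \<delta>" for y
  proof -
    consider "x < y" | "y < x" | "x = y" by linarith
    then show ?thesis
    proof cases
      case 1
      then show ?thesis
        using \<delta>(2)[of "{(x, y)}"] x y by (auto simp: interval_family_singleton dist_real_def)
    next
      case 2
      then show ?thesis
        using \<delta>(2)[of "{(y, x)}"] x y by (auto simp: interval_family_singleton dist_real_def)
    qed (use e in auto)
  qed
  then show "\<exists>d>0. \<forall>x'\<in>{a..b}. dist x' x < d \<longrightarrow> dist (f x') (f x) < e"
    using \<delta>(1) by blast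
qed

lemma interval_family_length_le:
  assumes "interval_family a b I" "a \<le> b"
  shows "(\<Sum>(u, v)\<in>I. v - u) \<le> b - a"
proof -
  define S where "S = (\<lambda>(u :: real, v). {u<..<v})"
  have fin: "finite I" using assms by (simp add: interval_family_def)
  have S: "S p \<in> fmeasurable lborel" "S p \<subseteq> {a..b}" "measure lborel (S p) = snd p - fst p"
    if "p \<in> I" for p
    using assms that by (auto simp: interval_family_def S_def fmeasurable_def split_beta)
  have disj: "pairwise (\<lambda>i j. disjnt (S i) (S j)) I"
    using assms by (simp add: interval_family_def S_def pairwise_def disjoint_family_on_def disjnt_def)
  have "(\<Sum>(u, v)\<in>I. v - u) = (\<Sum>p\<in>I. measure lborel (S p))"
    by (intro sum.cong) (simp_all add: S split_beta)
  also have "\<dots> = measure lborel (\<Union>p\<in>I. S p)"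
    using fin S(1) disj by (rule measure_UNION'[symmetric])
  also have "\<dots> \<le> measure lborel {a..b}"
  proof (rule measure_mono_fmeasurable)
    show "(\<Union>p\<in>I. S p) \<subseteq> {a..b}" using S(2) by blast
    show "(\<Union>p\<in>I. S p) \<in> sets lborel"
      using fin S(1) by (intro sets.finite_UN fmeasurableD) auto
  qed (use assms(2) in \<open>simp add: fmeasurable_def\<close>)
  finally show ?thesis using assms by simp
qed

text \<open>Replacing intervals by nondegenerate subintervals keeps them disjoint, and hence keeps
  them different. Both halves of the cut in \<open>interval_family_split\<close> are of this
  kind.\<close>

lemma interval_family_image:
  assumes I: "interval_family a b I" and "J \<subseteq> I"
    and T: "\<And>u v. (u, v) \<in> J \<Longrightarrow> a' \<le> fst (T (u, v)) \<and> u \<le> fst (T (u, v)) \<and>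
      fst (T (u, v)) < snd (T (u, v)) \<and> snd (T (u, v)) \<le> v \<and> snd (T (u, v)) \<le> b'"
  shows "interval_family a' b' (T ` J)" "inj_on T J"
proof -
  have disj: "{max u u'<..<min v v'} = {}"
    if "(u, v) \<in> J" "(u', v') \<in> J" "(u, v) \<noteq> (u', v')" for u v u' v'
  proof -
    have "disjoint_family_on (\<lambda>(u, v). {u<..<v}) I" using I by (simp add: interval_family_def)
    moreover have "(u, v) \<in> I" "(u', v') \<in> I" using that \<open>J \<subseteq> I\<close> by auto
    ultimately have "(case (u, v) of (u, v) \<Rightarrow> {u<..<v}) \<inter> (case (u', v') of (u, v) \<Rightarrow> {u<..<v}) = {}"
      using that(3) by (rule disjoint_family_onD)
    then show ?thesis by simp
  qed
  have *: "p = q" if "p \<in> J" "q \<in> J" "T p = T q" for p q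
  proof (rule ccontr)
    assume ne: "p \<noteq> q"
    obtain u v u' v' where [simp]: "p = (u, v)" "q = (u', v')" by (cases p; cases q)
    have "{max u u'<..<min v v'} = {}" by (rule disj) (use that ne in auto)
    moreover have "max u u' \<le> fst (T p)" "fst (T p) < snd (T p)" "snd (T p) \<le> min v v'"
      using T[of u v] T[of u' v'] that by auto
    ultimately show False by force
  qed
  then show "inj_on T J" by (auto simp: inj_on_def)
  have fin: "finite J" using I \<open>J \<subseteq> I\<close> by (auto simp: interval_family_def intro: finite_subset)
  have "(case T p of (u, v) \<Rightarrow> {u<..<v}) \<inter> (case T q of (u, v) \<Rightarrow> {u<..<v}) = {}"
    if "p \<in> J" "q \<in> J" "T p \<noteq> T q" for p q
  proof -
    obtain u v u' v' where [simp]: "p = (u, v)" "q = (u', v')" by (cases p; cases q)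
    have "{max u u'<..<min v v'} = {}" by (rule disj) (use that in auto)
    then have "min v v' \<le> max u u'" by simp
    moreover have "max u u' \<le> max (fst (T p)) (fst (T q))" "min (snd (T p)) (snd (T q)) \<le> min v v'"
      using T[of u v] T[of u' v'] that by auto
    ultimately have "min (snd (T p)) (snd (T q)) \<le> max (fst (T p)) (fst (T q))" 
      by (meson order_trans)
    then show ?thesis by (simp add: split_beta)
  qed
  then have "disjoint_family_on (\<lambda>(u, v). {u<..<v}) (T ` J)"
    unfolding disjoint_family_on_def ball_simps by metis
  moreover have "a' \<le> fst (T p) \<and> fst (T p) < snd (T p) \<and> snd (T p) \<le> b'" if "p \<in> J" for p
    using T[of "fst p" "snd p"] that by auto
  then have "\<forall>(u, v)\<in>T ` J. a' \<le> u \<and> u < v \<and> v \<le> b'"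
    by (simp add: split_beta)
  ultimately show "interval_family a' b' (T ` J)"
    using fin by (simp add: interval_family_def)
qed

text \<open>An interval with \<open>x\<close> inside is cut there, and \<open>f v - f u\<close> is
  the sum of the two signed increments. Equality holds because the sums are signed; with absolute
  values only an inequality would remain.\<close>

lemma interval_family_split:
  fixes f :: "real \<Rightarrow> real"
  assumes I: "interval_family a y I" and "a \<le> x" "x \<le> y"
  obtains I1 I2 where "interval_family a x I1" "interval_family x y I2"
    "(\<Sum>(u, v)\<in>I. f v - f u) = (\<Sum>(u, v)\<in>I1. f v - f u) + (\<Sum>(u, v)\<in>I2. f v - f u)"
proof -
  define T1 where "T1 = (\<lambda>(u :: real, v). (u, min v x))"
  define T2 where "T2 = (\<lambda>(u :: real, v :: real). (max u x, v))"
  define J1 where "J1 = {p \<in> I. fst p < x}"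
  define J2 where "J2 = {p \<in> I. x < snd p}"
  have J: "J1 \<subseteq> I" "J2 \<subseteq> I" by (auto simp: J1_def J2_def)
  have fin: "finite I" using I by (simp add: interval_family_def)
  have b: "a \<le> u \<and> u < v \<and> v \<le> y" if "(u, v) \<in> I" for u v
    using I that by (auto simp: interval_family_def)
  note 1 = interval_family_image[OF I J(1), of a T1 x]
  note 2 = interval_family_image[OF I J(2), of x T2 y]
  have T1: "interval_family a x (T1 ` J1)" "inj_on T1 J1"
    by (rule 1; use b in \<open>force simp: T1_def J1_def\<close>)+
  have T2: "interval_family x y (T2 ` J2)" "inj_on T2 J2"
    by (rule 2; use b in \<open>force simp: T2_def J2_def\<close>)+
  have "(\<Sum>(u, v)\<in>I. f v - f u) = (\<Sum>(u, v)\<in>I. (if u < x then f (min v x) - f u else 0)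
      + (if x < v then f v - f (max u x) else 0))"
    using b by (intro sum.cong) (force simp: min_def max_def split: prod.splits)+
  also have "\<dots> = (\<Sum>p\<in>I. if fst p < x then f (min (snd p) x) - f (fst p) else 0)
      + (\<Sum>p\<in>I. if x < snd p then f (snd p) - f (max (fst p) x) else 0)"
    by (simp add: sum.distrib split_beta)
  also have "(\<Sum>p\<in>I. if fst p < x then f (min (snd p) x) - f (fst p) else 0)
      = (\<Sum>p\<in>J1. f (min (snd p) x) - f (fst p))"
    using fin by (simp add: J1_def sum.inter_filter split_beta)
  also have "\<dots> = (\<Sum>(u, v)\<in>T1 ` J1. f v - f u)"
    by (subst sum.reindex[OF T1(2)]) (simp add: T1_def split_beta)
  also have "(\<Sum>p\<in>I. if x < snd p then f (snd p) - f (max (fst p) x) else 0)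
      = (\<Sum>p\<in>J2. f (snd p) - f (max (fst p) x))"
    using fin by (simp add: J2_def sum.inter_filter split_beta)
  also have "\<dots> = (\<Sum>(u, v)\<in>T2 ` J2. f v - f u)"
    by (subst sum.reindex[OF T2(2)]) (simp add: T2_def split_beta)
  finally show thesis
    by (rule that[OF T1(1) T2(1)])
qed

text \<open>No positive parts are taken: a family need not cover \<open>[a, x]\<close>, so the
  supremum may simply leave out the intervals on which \<open>f\<close> decreases.\<close>

definition positive_variation :: "(real \<Rightarrow> real) \<Rightarrow> real \<Rightarrow> real \<Rightarrow> real" where
  "positive_variation f a x = (SUP I\<in>{I. interval_family a x I}. \<Sum>(u, v)\<in>I. f v - f u)"

text \<open>For \<epsilon> = 1 a piece shorter than \<delta> contributes at most 1, and finitely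
  many such pieces make up the interval.\<close>

lemma absolutely_continuous_variation_bounded:
  fixes f :: "real \<Rightarrow> real"
  assumes "absolutely_continuous_on_interval a b f"
  obtains B where "\<And>I. interval_family a b I \<Longrightarrow> (\<Sum>(u, v)\<in>I. f v - f u) \<le> B"
proof -
  obtain \<delta> where \<delta>: "\<delta> > 0" "\<And>I. interval_family a b I \<Longrightarrow>
        (\<Sum>(u, v)\<in>I. v - u) < \<delta> \<Longrightarrow> (\<Sum>(u, v)\<in>I. \<bar>f v - f u\<bar>) < 1"
    using assms unfolding absolutely_continuous_on_interval_family by (metis zero_less_one)
  have step: "(\<Sum>(u, v)\<in>I. f v - f u) \<le> 1"
    if "interval_family x y I" "a \<le> x" "x \<le> y" "y \<le> b" "y - x < \<delta>" for x y I
  proof -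
    have "(\<Sum>(u, v)\<in>I. f v - f u) \<le> (\<Sum>(u, v)\<in>I. \<bar>f v - f u\<bar>)"
      by (intro sum_mono) auto
    also have "\<dots> < 1"
      using that by (intro \<delta>(2)) (auto intro: interval_family_mono order_le_less_trans[OF interval_family_length_le])
    finally show ?thesis by simp
  qed
  have main: "(\<Sum>(u, v)\<in>I. f v - f u) \<le> Suc k"
    if "interval_family a x I" "a \<le> x" "x \<le> b" "x - a < Suc k * \<delta>" for x I k
    using that
  proof (induction k arbitrary: x I)
    case 0
    then show ?case using step[of a x I] by simp
  next
    case (Suc k)
    \<comment> \<open>The last of \<open>k + 2\<close> equal pieces is split off: it is shorter than
      \<delta>, and the rest is shorter than \<open>Suc k * \<delta>\<close>.\<close>
    define x' where "x' = a + (x - a) * (real (Suc k) / real (Suc (Suc k)))"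
    have xx: "a \<le> x'" "x - x' = (x - a) / real (Suc (Suc k))"
    proof -
      show "a \<le> x'" using Suc.prems(2) unfolding x'_def by simp
      show "x - x' = (x - a) / real (Suc (Suc k))" by (simp add: x'_def field_simps)
    qed
    then have "x' \<le> x" using Suc.prems by (metis diff_ge_0_iff_ge divide_nonneg_nonneg of_nat_0_le_iff)
    have d: "(x - a) / real (Suc (Suc k)) < \<delta>"
      using Suc.prems by (simp add: field_simps)
    have "x' - a = real (Suc k) * ((x - a) / real (Suc (Suc k)))"
      by (simp add: x'_def field_simps)
    then have d': "x' - a < real (Suc k) * \<delta>"
      using mult_strict_left_mono[OF d, of "real (Suc k)"] by simp
    obtain I1 I2 where I12: "interval_family a x' I1" "interval_family x' x I2"
      "(\<Sum>(u, v)\<in>I. f v - f u) = (\<Sum>(u, v)\<in>I1. f v - f u) + (\<Sum>(u, v)\<in>I2. f v - f u)"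
      using interval_family_split[OF Suc.prems(1) xx(1) \<open>x' \<le> x\<close>, of f] by blast
    have "(\<Sum>(u, v)\<in>I1. f v - f u) \<le> Suc k"
      using Suc.prems \<open>x' \<le> x\<close> by (intro Suc.IH[OF I12(1) xx(1) _ d']) simp
    moreover have "(\<Sum>(u, v)\<in>I2. f v - f u) \<le> 1"
      using Suc.prems \<open>x' \<le> x\<close> xx d by (intro step[OF I12(2)]) auto
    ultimately show ?case using I12(3) by simp
  qed
  show thesis
  proof (cases "a \<le> b")
    case True
    obtain k where "b - a < real k * \<delta>" using reals_Archimedean3[OF \<delta>(1)] by blast
    then have "b - a < real (Suc k) * \<delta>" using \<delta>(1) by (simp add: algebra_simps)
    then show thesis using True by (intro that[of "Suc k"] main) auto
  next
    case False
    then have "I = {}" if "interval_family a b I" for I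
      using that by (auto simp: interval_family_def)
    then show thesis by (intro that[of 0]) fastforce
  qed
qed

context
  fixes a b :: real and f :: "real \<Rightarrow> real"
  assumes ac: "absolutely_continuous_on_interval a b f"
begin

lemma positive_variation_bdd:
  assumes "x \<le> b"
  shows "bdd_above ((\<lambda>I. \<Sum>(u, v)\<in>I. f v - f u) ` {I. interval_family a x I})"
proof -
  obtain B where "\<And>I. interval_family a b I \<Longrightarrow> (\<Sum>(u, v)\<in>I. f v - f u) \<le> B"
    using absolutely_continuous_variation_bounded[OF ac] by blast
  then show ?thesis
    using assms by (intro bdd_aboveI[of _ B]) (auto intro: interval_family_mono)
qed

lemma positive_variation_upper:
  "x \<le> b \<Longrightarrow> interval_family a x I \<Longrightarrow> (\<Sum>(u, v)\<in>I. f v - f u) \<le> positive_variation f a x"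
  unfolding positive_variation_def using positive_variation_bdd by (auto intro!: cSUP_upper)

lemma positive_variation_least:
  "(\<And>I. interval_family a x I \<Longrightarrow> (\<Sum>(u, v)\<in>I. f v - f u) \<le> c) \<Longrightarrow> positive_variation f a x \<le> c"
  unfolding positive_variation_def by (rule cSUP_least) (auto intro!: exI[of _ "{}"])

lemma positive_variation_mono:
  "x \<le> y \<Longrightarrow> y \<le> b \<Longrightarrow> positive_variation f a x \<le> positive_variation f a y"
  by (rule positive_variation_least) (auto intro: positive_variation_upper interval_family_mono)

text \<open>Adjoining the interval \<open>(x, y)\<close> to a family in \<open>[a, x]\<close> gives
  one in \<open>[a, y]\<close>, so the variation grows by at least \<open>f y - f x\<close>. With
  \<open>positive_variation_mono\<close> this writes \<open>f\<close> as a difference of two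
  nondecreasing functions.\<close>

lemma positive_variation_minus_mono:
  assumes "a \<le> x" "x \<le> y" "y \<le> b"
  shows "positive_variation f a x - f x \<le> positive_variation f a y - f y"
proof (cases "x = y")
  case False
  have "positive_variation f a x \<le> positive_variation f a y - (f y - f x)"
  proof (rule positive_variation_least)
    fix I assume I: "interval_family a x I"
    then have fin: "finite I" and "(x, y) \<notin> I"
      using False assms by (auto simp: interval_family_def)
    moreover have "interval_family a y (insert (x, y) I)"
      using I False assms unfolding interval_family_def disjoint_family_on_def by fastforce
    ultimately show "(\<Sum>(u, v)\<in>I. f v - f u) \<le> positive_variation f a y - (f y - f x)"
      using positive_variation_upper[of y "insert (x, y) I"] assms by simp
  qed
  then show ?thesis by simp
qed simp

text \<open>Cutting a family of \<open>[a, y]\<close> at \<open>x\<close> leaves a part bounded by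
  the variation up to \<open>x\<close>. If every family of \<open>[x, y]\<close> fell short by
  \<open>e\<close>, the variation up to \<open>y\<close> could be lowered by
  \<open>e\<close>.\<close>

lemma positive_variation_increment:
  assumes "a \<le> x" "x \<le> y" "y \<le> b" "e > 0"
  shows "\<exists>I. interval_family x y I \<and>
    positive_variation f a y - positive_variation f a x < (\<Sum>(u, v)\<in>I. f v - f u) + e"
proof (rule ccontr)
  assume no: "\<not> ?thesis"
  have *: "(\<Sum>(u, v)\<in>I. f v - f u) + e \<le> positive_variation f a y - positive_variation f a x"
    if "interval_family x y I" for I
    using that no by (meson not_le)
  have "positive_variation f a y \<le> positive_variation f a y - e"
  proof (rule positive_variation_least)
    fix I assume "interval_family a y I"
    then obtain I1 I2 where I12: "interval_family a x I1" "interval_family x y I2"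
      "(\<Sum>(u, v)\<in>I. f v - f u) = (\<Sum>(u, v)\<in>I1. f v - f u) + (\<Sum>(u, v)\<in>I2. f v - f u)"
      using interval_family_split[of a y I x f] assms by blast
    show "(\<Sum>(u, v)\<in>I. f v - f u) \<le> positive_variation f a y - e"
      using positive_variation_upper[OF _ I12(1)] *[OF I12(2)] I12(3) assms by linarith
  qed
  then show False using assms by simp
qed

text \<open>Each increment of the variation is nearly attained by a family inside the same interval.
  These families glue to one whose total length is no larger, and there the absolute continuity of
  \<open>f\<close> applies.\<close>

lemma absolutely_continuous_positive_variation:
  "absolutely_continuous_on_interval a b (positive_variation f a)"
  unfolding absolutely_continuous_on_interval_family
proof (intro allI impI)
  fix \<epsilon> :: real assume "\<epsilon> > 0"
  then obtain \<delta> where \<delta>: "\<delta> > 0" "\<And>I. interval_family a b I \<Longrightarrow>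
        (\<Sum>(u, v)\<in>I. v - u) < \<delta> \<Longrightarrow> (\<Sum>(u, v)\<in>I. \<bar>f v - f u\<bar>) < \<epsilon> / 2"
    using ac unfolding absolutely_continuous_on_interval_family by (metis half_gt_zero)
  have "(\<Sum>(u, v)\<in>J. \<bar>positive_variation f a v - positive_variation f a u\<bar>) < \<epsilon>"
    if J: "interval_family a b J" and len: "(\<Sum>(u, v)\<in>J. v - u) < \<delta>" for J
  proof -
    \<comment> \<open>The \<open>card J\<close> errors add up to at most \<epsilon>/2; the
      \<open>+ 1\<close> keeps the denominator positive for empty \<open>J\<close>.\<close>
    define e where "e = \<epsilon> / (2 * (card J + 1))"
    have "e > 0" using \<open>\<epsilon> > 0\<close> by (auto simp: e_def)
    have fin: "finite J" using J by (simp add: interval_family_def)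
    have Jb: "a \<le> u \<and> u < v \<and> v \<le> b" if "(u, v) \<in> J" for u v
      using J that by (auto simp: interval_family_def)
    have "\<exists>I. interval_family (fst p) (snd p) I \<and> positive_variation f a (snd p) -
      positive_variation f a (fst p) < (\<Sum>(u, v)\<in>I. f v - f u) + e" if "p \<in> J" for p
      using Jb[of "fst p" "snd p"] that \<open>e > 0\<close> by (intro positive_variation_increment) auto
    then obtain F where F: "\<And>p. p \<in> J \<Longrightarrow> interval_family (fst p) (snd p) (F p)"
      "\<And>p. p \<in> J \<Longrightarrow> positive_variation f a (snd p) - positive_variation f a (fst p)
         < (\<Sum>(u, v)\<in>F p. f v - f u) + e"
      by metis
    define K where "K = (\<Union>p\<in>J. F p)"
    have finF: "finite (F p)" if "p \<in> J" for p using F(1)[OF that] by (simp add: interval_family_def)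
    have sub: "fst p \<le> u \<and> u < v \<and> v \<le> snd p" if "p \<in> J" "(u, v) \<in> F p" for p u v
      using F(1)[OF that(1)] that(2) by (auto simp: interval_family_def)
    have disj2: "{u<..<v} \<inter> {u'<..<v'} = {}"
      if "p \<in> J" "q \<in> J" "p \<noteq> q" "(u, v) \<in> F p" "(u', v') \<in> F q" for p q u v u' v'
    proof -
      have "{fst p<..<snd p} \<inter> {fst q<..<snd q} = {}"
        using J that unfolding interval_family_def disjoint_family_on_def by (auto simp: split_beta)
      moreover have "{u<..<v} \<subseteq> {fst p<..<snd p}" "{u'<..<v'} \<subseteq> {fst q<..<snd q}"
        using sub[OF that(1,4)] sub[OF that(2,5)] by auto
      ultimately show ?thesis by blast
    qed
    have Fdisj: "F p \<inter> F q = {}" if "p \<in> J" "q \<in> J" "p \<noteq> q" for p q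
    proof (rule ccontr)
      assume "F p \<inter> F q \<noteq> {}"
      then obtain u v where "(u, v) \<in> F p" "(u, v) \<in> F q" by auto
      then show False using disj2[OF that, of u v u v] sub[OF that(1), of u v] by simp
    qed
    have sumK: "(\<Sum>x\<in>K. h x) = (\<Sum>p\<in>J. \<Sum>x\<in>F p. h x)" for h :: "real \<times> real \<Rightarrow> real"
      unfolding K_def using fin finF Fdisj by (intro sum.UNION_disjoint) auto
    have "interval_family a b K"
      unfolding interval_family_def disjoint_family_on_def
    proof (intro conjI ballI impI)
      show "finite K" using fin finF by (auto simp: K_def)
      fix p assume "p \<in> K"
      then obtain P where P: "P \<in> J" "p \<in> F P" by (auto simp: K_def)
      show "case p of (u, v) \<Rightarrow> a \<le> u \<and> u < v \<and> v \<le> b"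
        using sub[OF P(1), of "fst p" "snd p"] P Jb[of "fst P" "snd P"] by (auto simp: split_beta)
      fix q assume "q \<in> K" "p \<noteq> q"
      then obtain Q where Q: "Q \<in> J" "q \<in> F Q" by (auto simp: K_def)
      show "(case p of (u, v) \<Rightarrow> {u<..<v}) \<inter> (case q of (u, v) \<Rightarrow> {u<..<v}) = {}"
      proof (cases "P = Q")
        case True
        then show ?thesis
          using F(1)[OF P(1)] P Q \<open>p \<noteq> q\<close> unfolding interval_family_def disjoint_family_on_def by blast
      next
        case False
        then show ?thesis
          using disj2[OF P(1) Q(1) False, of "fst p" "snd p" "fst q" "snd q"] P Q by (simp add: split_beta)
      qed
    qed
    moreover have "(\<Sum>(u, v)\<in>K. v - u) < \<delta>"
    proof -
      have "(\<Sum>(u, v)\<in>K. v - u) = (\<Sum>p\<in>J. \<Sum>(u, v)\<in>F p. v - u)" by (rule sumK)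
      also have "\<dots> \<le> (\<Sum>p\<in>J. snd p - fst p)"
        using F(1) Jb by (intro sum_mono interval_family_length_le) (auto intro: less_imp_le)
      also have "\<dots> < \<delta>" using len by (simp add: split_beta)
      finally show ?thesis .
    qed
    ultimately have "(\<Sum>(u, v)\<in>K. \<bar>f v - f u\<bar>) < \<epsilon> / 2" by (rule \<delta>(2))
    have "(\<Sum>(u, v)\<in>J. \<bar>positive_variation f a v - positive_variation f a u\<bar>)
        = (\<Sum>p\<in>J. positive_variation f a (snd p) - positive_variation f a (fst p))"
      using Jb positive_variation_mono by (intro sum.cong) (force simp: split_beta)+
    also have "\<dots> \<le> (\<Sum>p\<in>J. (\<Sum>(u, v)\<in>F p. \<bar>f v - f u\<bar>) + e)"
    proof (rule sum_mono)
      fix p assume "p \<in> J"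
      have "(\<Sum>(u, v)\<in>F p. f v - f u) \<le> (\<Sum>(u, v)\<in>F p. \<bar>f v - f u\<bar>)" by (rule sum_mono) auto
      then show "positive_variation f a (snd p) - positive_variation f a (fst p)
          \<le> (\<Sum>(u, v)\<in>F p. \<bar>f v - f u\<bar>) + e"
        using F(2)[OF \<open>p \<in> J\<close>] by linarith
    qed
    also have "\<dots> = (\<Sum>(u, v)\<in>K. \<bar>f v - f u\<bar>) + card J * e"
      by (simp add: sumK sum.distrib)
    also have "\<dots> < \<epsilon> / 2 + card J * e" using \<open>(\<Sum>(u, v)\<in>K. \<bar>f v - f u\<bar>) < \<epsilon> / 2\<close> by simp
    also have "\<dots> \<le> \<epsilon>" using \<open>\<epsilon> > 0\<close> by (simp add: e_def field_simps)
    finally show ?thesis .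
  qed
  then show "\<exists>\<delta>>0. \<forall>J. interval_family a b J \<longrightarrow> (\<Sum>(u, v)\<in>J. v - u) < \<delta> \<longrightarrow>
      (\<Sum>(u, v)\<in>J. \<bar>positive_variation f a v - positive_variation f a u\<bar>) < \<epsilon>"
    using \<delta>(1) by blast
qed

end

section \<open>The fundamental theorem of calculus for absolutely continuous functions\<close>

text \<open>The density is the Radon-Nikodym derivative of the Stieltjes measure of
  \<open>G\<close>. The work lies in passing from finite interval families to arbitrary null
  sets.\<close>

lemma mono_absolutely_continuous_density:
  fixes G :: "real \<Rightarrow> real"
  assumes ac: "absolutely_continuous_on_interval a b G" and "a \<le> b"
    and mono: "\<And>x y. a \<le> x \<Longrightarrow> x \<le> y \<Longrightarrow> y \<le> b \<Longrightarrow> G x \<le> G y"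
  obtains h where "h absolutely_integrable_on {a..b}"
    "\<And>x. x \<in> {a..b} \<Longrightarrow> integral {a..x} h = G x - G a"
proof (cases "a = b")
  case True
  then show thesis
    by (intro that[of "\<lambda>_. 0"]) auto
next
  case False
  then have "a < b" using \<open>a \<le> b\<close> by simp
  \<comment> \<open>\<open>interval_measure\<close> needs a nondecreasing right-continuous function
    on the whole line; the constant continuation puts no mass outside
    \<open>{a<..b}\<close>.\<close>
  define F where "F x = G (max a (min b x))" for x
  have monoF: "F x \<le> F y" if "x \<le> y" for x y
    unfolding F_def using that \<open>a \<le> b\<close> by (intro mono) auto
  have contF: "continuous_on UNIV F"
    unfolding F_def
    by (rule continuous_on_compose2[OF absolutely_continuous_imp_continuous_on[OF ac]])
       (use \<open>a \<le> b\<close> in \<open>auto intro!: continuous_intros\<close>)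
  have rcontF: "continuous (at_right x) F" for x
    using contF by (simp add: continuous_on_eq_continuous_at continuous_at_imp_continuous_at_within)
  define M where "M = interval_measure F"
  have sets_M [simp]: "sets M = sets borel" and space_M [simp]: "space M = UNIV"
    by (simp_all add: M_def)
  have Ioc: "emeasure M {u<..v} = ennreal (F v - F u)" if "u \<le> v" for u v
    unfolding M_def using that monoF rcontF by (rule emeasure_interval_measure_Ioc)
  have Icc: "emeasure M {u..v} = ennreal (F v - F u)" if "u \<le> v" for u v
    unfolding M_def using that monoF contF by (rule emeasure_interval_measure_Icc)
  have UN: "(\<Union>n. {a - real n<..b + real n}) = UNIV"
  proof (intro equalityI subsetI UNIV_I)
    fix x :: real
    obtain n where n: "\<bar>x\<bar> + \<bar>a\<bar> + \<bar>b\<bar> < real n" using reals_Archimedean2 by blast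
    then have "x \<in> {a - real n<..b + real n}" by auto
    then show "x \<in> (\<Union>n. {a - real n<..b + real n})" by blast
  qed
  have "emeasure M (\<Union>n. {a - real n<..b + real n}) = (SUP n. emeasure M {a - real n<..b + real n})"
    by (rule SUP_emeasure_incseq[symmetric]) (auto simp: incseq_def)
  also have "\<dots> = (SUP n::nat. ennreal (G b - G a))"
    using \<open>a < b\<close> by (intro SUP_cong) (auto simp: Ioc F_def)
  finally have total: "emeasure M UNIV = ennreal (G b - G a)" by (simp only: UN) simp
  interpret M: finite_measure M by (rule finite_measureI) (simp add: total)
  have "emeasure M (UNIV - {a<..b}) = emeasure M UNIV - emeasure M {a<..b}"
    by (rule emeasure_Diff) (auto simp: Ioc \<open>a \<le> b\<close>)
  also have "\<dots> = 0" using \<open>a \<le> b\<close> by (simp add: total Ioc F_def)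
  finally have outside: "emeasure M (UNIV - {a<..b}) = 0" .
  \<comment> \<open>A null set lies in an open set of measure below \<delta>, and its part in
    \<open>[a, b]\<close> in countably many non-overlapping closed intervals inside that set.
    Absolute continuity of \<open>G\<close> bounds the mass of each finite subfamily by
    \<open>e\<close>, hence also that of the whole union.\<close>
  have acM: "absolutely_continuous lborel M"
    unfolding absolutely_continuous_def
  proof
    fix N :: "real set" assume N: "N \<in> null_sets lborel"
    then have Nb: "N \<in> sets borel" by (simp add: null_sets_def)
    have "emeasure M N \<le> ennreal e" if "e > 0" for e :: real
    proof -
      obtain \<delta> where \<delta>: "\<delta> > 0" "\<And>I. interval_family a b I \<Longrightarrow>
          (\<Sum>(u, v)\<in>I. v - u) < \<delta> \<Longrightarrow> (\<Sum>(u, v)\<in>I. \<bar>G v - G u\<bar>) < e"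
        using ac \<open>e > 0\<close> unfolding absolutely_continuous_on_interval_family by meson
      obtain U where U: "open U" "N \<subseteq> U" "emeasure lborel (U - N) < ennreal \<delta>"
        using outer_regular_lborel[OF Nb \<delta>(1)] by blast
      have Ub: "U \<in> sets borel" using U by simp
      have "emeasure lborel U = emeasure lborel ((U - N) \<union> N)"
        using U(2) by (intro arg_cong[of _ _ "emeasure lborel"]) auto
      also have "\<dots> = emeasure lborel (U - N)"
        using N Ub Nb by (intro emeasure_Un_null_set) auto
      finally have mU: "emeasure lborel U < ennreal \<delta>" using U(3) by simp
      \<comment> \<open>Every covering interval has a tag in \<open>N\<close>, so this gauge
        confines it to \<open>U\<close>.\<close>
      define g where "g x = (if x \<in> U then U else UNIV)" for x
      have "gauge g" using U(1) by (auto simp: gauge_def g_def)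
      obtain D where D: "countable D" "\<Union>D \<subseteq> cbox a b"
        "\<And>K. K \<in> D \<Longrightarrow> interior K \<noteq> {} \<and> (\<exists>c d. K = cbox c d)"
        "pairwise (\<lambda>A B. interior A \<inter> interior B = {}) D"
        "\<And>K. K \<in> D \<Longrightarrow> \<exists>x\<in>N \<inter> {a..b} \<inter> K. K \<subseteq> g x"
        "N \<inter> {a..b} \<subseteq> \<Union>D"
        by (rule covering_lemma[of "N \<inter> {a..b}" a b g]) (use \<open>a < b\<close> \<open>gauge g\<close> in auto)
      have DU: "K \<subseteq> U" if "K \<in> D" for K
        using D(5)[OF that] U(2) by (auto simp: g_def split: if_splits)
      have Dint: "\<exists>u v. K = {u..v} \<and> a \<le> u \<and> u < v \<and> v \<le> b" if "K \<in> D" for K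
      proof -
        have "interior K \<noteq> {} \<and> (\<exists>c d. K = cbox c d)" using D(3)[OF that] .
        then obtain u v where uv: "K = {u..v}" by auto
        then have "u < v" using D(3)[OF that] by auto
        moreover have "K \<subseteq> {a..b}" using D(2) Union_upper[OF that] by simp
        ultimately show ?thesis using uv by auto
      qed
      have fin: "measure M (\<Union>E) \<le> e" if E: "E \<subseteq> D" "finite E" for E
      proof -
        define I where "I = (\<lambda>K. (Inf K, Sup K)) ` E"
        have K: "K = {Inf K..Sup K} \<and> a \<le> Inf K \<and> Inf K < Sup K \<and> Sup K \<le> b" if "K \<in> E" for K
        proof -
          have "K \<in> D" using that E by auto
          then obtain u v where "K = {u..v}" "a \<le> u" "u < v" "v \<le> b" using Dint by blast
          then show ?thesis by simp
        qed
        have inj: "inj_on (\<lambda>K. (Inf K, Sup K)) E"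
          by (rule inj_onI) (metis K Pair_inject)
        have sumI: "(\<Sum>(u, v)\<in>I. h u v) = (\<Sum>K\<in>E. h (Inf K) (Sup K))" for h :: "real \<Rightarrow> real \<Rightarrow> real"
          unfolding I_def by (subst sum.reindex[OF inj]) simp
        have disj: "{Inf K<..<Sup K} \<inter> {Inf L<..<Sup L} = {}" if "K \<in> E" "L \<in> E" "K \<noteq> L" for K L
        proof -
          have "interior K \<inter> interior L = {}" using D(4) E that by (auto simp: pairwise_def)
          then show ?thesis using K[OF that(1)] K[OF that(2)] by (metis interior_atLeastAtMost_real)
        qed
        have I: "interval_family a b I"
          unfolding interval_family_def disjoint_family_on_def
        proof (intro conjI ballI impI)
          show "finite I" using E by (simp add: I_def)
          fix p assume "p \<in> I"
          then obtain K where k: "K \<in> E" "p = (Inf K, Sup K)" by (auto simp: I_def)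
          show "case p of (u, v) \<Rightarrow> a \<le> u \<and> u < v \<and> v \<le> b" using K[OF k(1)] k(2) by simp
          fix q assume "q \<in> I" "p \<noteq> q"
          then obtain L where l: "L \<in> E" "q = (Inf L, Sup L)" by (auto simp: I_def)
          show "(case p of (u, v) \<Rightarrow> {u<..<v}) \<inter> (case q of (u, v) \<Rightarrow> {u<..<v}) = {}"
            using disj[OF k(1) l(1)] k l \<open>p \<noteq> q\<close> by auto
        qed
        have "(\<Sum>(u, v)\<in>I. v - u) = (\<Sum>K\<in>E. measure lborel {Inf K<..<Sup K})"
          unfolding sumI
        proof (rule sum.cong[OF refl])
          fix K assume "K \<in> E"
          then have "Inf K \<le> Sup K" using K by (simp add: less_imp_le)
          then show "Sup K - Inf K = measure lborel {Inf K<..<Sup K}" by simp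
        qed
        also have "\<dots> = measure lborel (\<Union>K\<in>E. {Inf K<..<Sup K})"
          using E disj K by (intro measure_UNION'[symmetric])
            (simp_all add: fmeasurable_def pairwise_def disjnt_def less_imp_le)
        also have "\<dots> < \<delta>"
        proof -
          have "(\<Union>K\<in>E. {Inf K<..<Sup K}) \<subseteq> U"
          proof (rule UN_least)
            fix K assume "K \<in> E"
            have "{Inf K<..<Sup K} \<subseteq> K" using K[OF \<open>K \<in> E\<close>] by (metis greaterThanLessThan_subseteq_atLeastAtMost_iff order_refl)
            then show "{Inf K<..<Sup K} \<subseteq> U" using DU \<open>K \<in> E\<close> E by blast
          qed
          then have "emeasure lborel (\<Union>K\<in>E. {Inf K<..<Sup K}) < ennreal \<delta>"
            using mU Ub by (intro order_le_less_trans[OF emeasure_mono mU]) auto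
          moreover from this have "emeasure lborel (\<Union>K\<in>E. {Inf K<..<Sup K}) =
              ennreal (measure lborel (\<Union>K\<in>E. {Inf K<..<Sup K}))"
            by (intro emeasure_eq_ennreal_measure) (auto simp: top_unique)
          ultimately show ?thesis by (simp add: ennreal_less_iff)
        qed
        finally have small: "(\<Sum>(u, v)\<in>I. \<bar>G v - G u\<bar>) < e" by (rule \<delta>(2)[OF I])
        have "measure M (\<Union>E) = measure M (\<Union>K\<in>E. K)" by simp
        also have "\<dots> \<le> (\<Sum>K\<in>E. measure M K)"
        proof (rule measure_UNION_le[OF E(2)])
          fix K assume "K \<in> E"
          then show "K \<in> sets M" using K[of K] by (metis sets_M atLeastAtMost_borel)
        qed
        also have "\<dots> = (\<Sum>K\<in>E. \<bar>G (Sup K) - G (Inf K)\<bar>)"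
        proof (rule sum.cong[OF refl])
          fix K assume "K \<in> E"
          note k = K[OF this]
          then have "emeasure M K = ennreal (F (Sup K) - F (Inf K))"
            using Icc[of "Inf K" "Sup K"] by simp
          moreover have "F (Sup K) = G (Sup K)" "F (Inf K) = G (Inf K)"
            using k by (auto simp: F_def)
          moreover have "G (Inf K) \<le> G (Sup K)" using k by (intro mono) auto
          ultimately show "measure M K = \<bar>G (Sup K) - G (Inf K)\<bar>" by (simp add: measure_def)
        qed
        also have "\<dots> = (\<Sum>(u, v)\<in>I. \<bar>G v - G u\<bar>)" by (simp add: sumI)
        finally show ?thesis using small by simp
      qed
      have Dset: "K \<in> sets borel" if "K \<in> D" for K using Dint[OF that] by auto
      have DM: "\<Union>D \<in> sets M" using D(1) Dset by (intro sets.countable_Union) (simp_all add: subset_iff)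
      have "measure M (\<Union>D) \<le> e"
        using D(1) _ fin by (rule measure_Union_bound) (use Dset in \<open>simp_all add: M.fmeasurable_eq_sets\<close>)
      have "emeasure M N \<le> emeasure M (\<Union>D \<union> (UNIV - {a<..b}))"
        
      proof (rule emeasure_mono)
        show "N \<subseteq> \<Union>D \<union> (UNIV - {a<..b})" using D(6) by fastforce
        show "\<Union>D \<union> (UNIV - {a<..b}) \<in> sets M" using DM by (intro sets.Un) simp_all
      qed
      also have "\<dots> = emeasure M (\<Union>D)"
        using DM outside by (intro emeasure_Un_null_set) (simp_all add: null_sets_def)
      also have "\<dots> \<le> ennreal e"
        using \<open>measure M (\<Union>D) \<le> e\<close> by (simp add: M.emeasure_eq_measure ennreal_leI)
      finally show ?thesis .
    qed
    then have "emeasure M N \<le> 0 + ennreal e" if "e > 0" for e using that by simp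
    then have "emeasure M N \<le> 0" by (rule ennreal_le_epsilon)
    then show "N \<in> null_sets M" using Nb by (simp add: null_sets_def)
  qed
  moreover have "sets M = sets lborel" by simp
  ultimately obtain h where h: "h \<in> borel_measurable lborel"
    "AE x in lborel. RN_deriv lborel M x = ennreal (h x)" "\<And>x. 0 \<le> h x"
    using sigma_finite_measure.real_RN_deriv[OF sigma_finite_lborel M.finite_measure_axioms] by blast
  have "density lborel (RN_deriv lborel M) = M"
    using acM by (intro sigma_finite_measure.density_RN_deriv[OF sigma_finite_lborel]) simp_all
  then have dens: "density lborel (\<lambda>x. ennreal (h x)) = M"
    using h by (subst density_cong[of _ _ "RN_deriv lborel M"]) auto
  have nn: "(\<integral>\<^sup>+x. ennreal (h x) * indicator {a..x'} x \<partial>lborel) = ennreal (G x' - G a)" if "x' \<in> {a..b}" for x'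
  proof -
    have "emeasure M {a..x'} = (\<integral>\<^sup>+x. ennreal (h x) * indicator {a..x'} x \<partial>lborel)"
      unfolding dens[symmetric] using h by (intro emeasure_density) auto
    then show ?thesis using that Icc[of a x'] by (simp add: F_def)
  qed
  have hb: "has_bochner_integral lborel (\<lambda>x. indicator {a..x'} x *\<^sub>R h x) (G x' - G a)" if "x' \<in> {a..b}" for x'
  proof (rule has_bochner_integral_nn_integral)
    show "(\<lambda>x. indicator {a..x'} x *\<^sub>R h x) \<in> borel_measurable lborel" using h by auto
    show "0 \<le> G x' - G a" using mono[of a x'] that by simp
    have "(\<integral>\<^sup>+x. ennreal (indicator {a..x'} x *\<^sub>R h x) \<partial>lborel) =
       (\<integral>\<^sup>+x. ennreal (h x) * indicator {a..x'} x \<partial>lborel)"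
      by (intro nn_integral_cong) (auto simp: indicator_def)
    then show "(\<integral>\<^sup>+x. ennreal (indicator {a..x'} x *\<^sub>R h x) \<partial>lborel) = ennreal (G x' - G a)"
      using nn[OF that] by simp
  qed (use h in auto)
  have si: "set_integrable lborel {a..x'} h" if "x' \<in> {a..b}" for x'
    using hb[OF that] by (simp add: set_integrable_def integrable.intros)
  show thesis
  proof
    show "h absolutely_integrable_on {a..b}"
      using si[of b] \<open>a \<le> b\<close>
      by (auto simp: set_integrable_def integrable_completion)
    show "integral {a..x'} h = G x' - G a" if "x' \<in> {a..b}" for x'
      using set_borel_integral_eq_integral(2)[OF si[OF that]] hb[OF that]
      by (simp add: set_lebesgue_integral_def has_bochner_integral_iff)
  qed
qed

lemma absolutely_continuous_diff:
  assumes "absolutely_continuous_on_interval a b f" "absolutely_continuous_on_interval a b g"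
  shows "absolutely_continuous_on_interval a b (\<lambda>x. f x - g x)"
  unfolding absolutely_continuous_on_interval_family
proof (intro allI impI)
  fix \<epsilon> :: real assume "\<epsilon> > 0"
  then have "\<epsilon> / 2 > 0" by simp
  obtain d where d: "d > 0" "\<And>I. interval_family a b I \<Longrightarrow>
     (\<Sum>(u, v)\<in>I. v - u) < d \<Longrightarrow> (\<Sum>(u, v)\<in>I. \<bar>f v - f u\<bar>) < \<epsilon> / 2"
    using assms(1) \<open>\<epsilon> / 2 > 0\<close> unfolding absolutely_continuous_on_interval_family by meson
  obtain d' where d': "d' > 0" "\<And>I. interval_family a b I \<Longrightarrow>
     (\<Sum>(u, v)\<in>I. v - u) < d' \<Longrightarrow> (\<Sum>(u, v)\<in>I. \<bar>g v - g u\<bar>) < \<epsilon> / 2"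
    using assms(2) \<open>\<epsilon> / 2 > 0\<close> unfolding absolutely_continuous_on_interval_family by meson
  have "(\<Sum>(u, v)\<in>I. \<bar>f v - g v - (f u - g u)\<bar>) < \<epsilon>"
    if "interval_family a b I" "(\<Sum>(u, v)\<in>I. v - u) < min d d'" for I
  proof -
    have "(\<Sum>(u, v)\<in>I. \<bar>f v - g v - (f u - g u)\<bar>) \<le> (\<Sum>(u, v)\<in>I. \<bar>f v - f u\<bar>) + (\<Sum>(u, v)\<in>I. \<bar>g v - g u\<bar>)"
      unfolding sum.distrib[symmetric] by (rule sum_mono) auto
    also have "\<dots> < \<epsilon>" using d(2)[OF that(1)] d'(2)[OF that(1)] that(2) by simp
    finally show ?thesis .
  qed
  then show "\<exists>\<delta>>0. \<forall>I. interval_family a b I \<longrightarrow> (\<Sum>(u, v)\<in>I. v - u) < \<delta> \<longrightarrow>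
      (\<Sum>(u, v)\<in>I. \<bar>f v - g v - (f u - g u)\<bar>) < \<epsilon>"
    using d(1) d'(1) by (intro exI[of _ "min d d'"]) auto
qed

text \<open>This is the Lebesgue differentiation theorem on the line, with averages over
  \<open>[x, x + t]\<close> only.\<close>

lemma integral_right_derivative_AE:
  fixes h :: "real \<Rightarrow> real"
  assumes h: "\<And>a b. h integrable_on {a..b}"
  obtains N where "negligible N"
    "\<And>x. x \<notin> N \<Longrightarrow> ((\<lambda>t. integral {x..x + t} h / t) \<longlongrightarrow> h x) (at_right 0)"
proof -
  obtain N where N: "negligible N" "\<And>x e. x \<notin> N \<Longrightarrow> 0 < e \<Longrightarrow>
      \<exists>d>0. \<forall>t. 0 < t \<and> t < d \<longrightarrow> norm (integral (cbox x (x + t *\<^sub>R One)) h /\<^sub>R t ^ DIM(real) - h x) < e"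
    using integrable_ccontinuous_explicit[of h] h by (metis cbox_interval)
  show thesis
  proof (rule that[OF N(1)])
    fix x assume x: "x \<notin> N"
    show "((\<lambda>t. integral {x..x + t} h / t) \<longlongrightarrow> h x) (at_right 0)"
      unfolding tendsto_iff
    proof (intro allI impI)
      fix e :: real assume "e > 0"
      then obtain d where "d > 0" "\<forall>t. 0 < t \<and> t < d \<longrightarrow> \<bar>integral {x..x + t} h / t - h x\<bar> < e"
        using N(2)[OF x, of e] by (auto simp: divide_inverse mult.commute)
      then show "\<forall>\<^sub>F t in at_right 0. dist (integral {x..x + t} h / t) (h x) < e"
        unfolding eventually_at_right_field by (auto simp: dist_real_def intro!: exI[of _ d])
    qed
  qed
qed

text \<open>The left difference quotient at \<open>x\<close> is the right one of the reflected
  function at \<open>-x\<close>, so the one-sided theorem is applied twice; the second null set is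
  reflected back.\<close>

lemma has_derivative_integral_AE:
  fixes h :: "real \<Rightarrow> real"
  assumes h: "\<And>a b. h integrable_on {a..b}"
  obtains N where "negligible N"
    "\<And>x a. x \<notin> N \<Longrightarrow> a < x \<Longrightarrow> ((\<lambda>y. integral {a..y} h) has_real_derivative h x) (at x)"
proof -
  obtain N where N: "negligible N"
    "\<And>x. x \<notin> N \<Longrightarrow> ((\<lambda>t. integral {x..x + t} h / t) \<longlongrightarrow> h x) (at_right 0)"
    using integral_right_derivative_AE[OF h] by blast
  have "(\<lambda>x. h (- x)) integrable_on {c..d}" for c d
    using Henstock_Kurzweil_Integration.integrable_reflect_real[where f = h and a = "- d" and b = "- c", THEN iffD2, OF h]
    unfolding minus_minus .
  then obtain N' where N': "negligible N'"
    "\<And>x. x \<notin> N' \<Longrightarrow> ((\<lambda>t. integral {x..x + t} (\<lambda>x. h (- x)) / t) \<longlongrightarrow> h (- x)) (at_right 0)"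
    using integral_right_derivative_AE by blast
  have "negligible (uminus ` N')"
    by (rule negligible_differentiable_image_negligible[OF order_refl N'(1)])
      (auto intro!: derivative_intros differentiable_at_imp_differentiable_on)
  then have "negligible (N \<union> uminus ` N')" using N(1) by (simp add: negligible_Un)
  moreover have "((\<lambda>y. integral {a..y} h) has_real_derivative h x) (at x)"
    if x: "x \<notin> N \<union> uminus ` N'" and "a < x" for x a
  proof -
    have "- x \<notin> N'" using x by (metis UnCI image_eqI minus_minus)
    have right: "((\<lambda>t. (integral {a..x + t} h - integral {a..x} h) / t) \<longlongrightarrow> h x) (at_right 0)"
    proof (rule Lim_transform_eventually[OF N(2)])
      show "x \<notin> N" using x by simp
      show "\<forall>\<^sub>F t in at_right 0. integral {x..x + t} h / t = (integral {a..x + t} h - integral {a..x} h) / t"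
      proof (rule eventually_at_right_less[THEN eventually_mono])
        fix t :: real assume "0 < t"
        then have "integral {a..x} h + integral {x..x + t} h = integral {a..x + t} h"
          using \<open>a < x\<close> h by (intro Henstock_Kurzweil_Integration.integral_combine) auto
        then show "integral {x..x + t} h / t = (integral {a..x + t} h - integral {a..x} h) / t" by simp
      qed
    qed
    have left: "((\<lambda>t. (integral {a..x + - t} h - integral {a..x} h) / - t) \<longlongrightarrow> h x) (at_right 0)"
    proof (rule Lim_transform_eventually)
      show "((\<lambda>t. integral {- x..- x + t} (\<lambda>x. h (- x)) / t) \<longlongrightarrow> h x) (at_right 0)"
        using N'(2)[OF \<open>- x \<notin> N'\<close>] by simp
      show "\<forall>\<^sub>F t in at_right 0. integral {- x..- x + t} (\<lambda>x. h (- x)) / t =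
          (integral {a..x + - t} h - integral {a..x} h) / - t"
        unfolding eventually_at_right_field
      proof (intro exI[of _ "x - a"] conjI allI impI)
        fix t :: real assume t: "0 < t" "t < x - a"
        have "integral {a..x - t} h + integral {x - t..x} h = integral {a..x} h"
          using t h by (intro Henstock_Kurzweil_Integration.integral_combine) auto
        moreover have "integral {- x..- x + t} (\<lambda>x. h (- x)) = integral {x - t..x} h"
          using Henstock_Kurzweil_Integration.integral_reflect_real[of x "x - t" h] by simp
        ultimately show "integral {- x..- x + t} (\<lambda>x. h (- x)) / t =
          (integral {a..x + - t} h - integral {a..x} h) / - t"
          using t(1) by (simp add: field_simps)
      qed (use \<open>a < x\<close> in simp)
    qed
    have left': "((\<lambda>t. (integral {a..x + t} h - integral {a..x} h) / t) \<longlongrightarrow> h x) (at_left 0)"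
      using left by (subst filterlim_at_left_to_right) simp
    show ?thesis
      unfolding DERIV_def using left' right by (rule filterlim_split_at)
  qed
  ultimately show thesis by (rule that)
qed

theorem absolutely_continuous_fundamental_theorem:
  fixes f :: "real \<Rightarrow> real"
  assumes ac: "absolutely_continuous_on_interval a b f" and "a \<le> b"
  obtains h N where "h absolutely_integrable_on {a..b}" "negligible N"
    "\<And>x. x \<in> {a..b} - N \<Longrightarrow> (f has_real_derivative h x) (at x)"
    "\<And>x. x \<in> {a..b} \<Longrightarrow> integral {a..x} h = f x - f a"
proof -
  let ?V = "positive_variation f a"
  obtain h1 where h1: "h1 absolutely_integrable_on {a..b}"
    "\<And>x. x \<in> {a..b} \<Longrightarrow> integral {a..x} h1 = ?V x - ?V a"
    using mono_absolutely_continuous_density[OF absolutely_continuous_positive_variation[OF ac] \<open>a \<le> b\<close>]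
      positive_variation_mono[OF ac] by blast
  obtain h2 where h2: "h2 absolutely_integrable_on {a..b}"
    "\<And>x. x \<in> {a..b} \<Longrightarrow> integral {a..x} h2 = (?V x - f x) - (?V a - f a)"
    using mono_absolutely_continuous_density[OF absolutely_continuous_diff[OF
          absolutely_continuous_positive_variation[OF ac] ac] \<open>a \<le> b\<close>]
      positive_variation_minus_mono[OF ac] by blast
  \<comment> \<open>Zero outside \<open>{a..b}\<close>, so that \<open>h\<close> is integrable over
    every compact interval, as \<open>has_derivative_integral_AE\<close> demands.\<close>
  define h where "h x = (if x \<in> {a..b} then h1 x - h2 x else 0)" for x
  have "(\<lambda>x. h1 x - h2 x) absolutely_integrable_on {a..b}"
    using h1(1) h2(1) by (rule set_integral_diff)
  then have hab: "h absolutely_integrable_on {a..b}"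
    by (rule absolutely_integrable_spike[OF _ negligible_empty]) (simp add: h_def)
  have hint: "integral {a..x} h = f x - f a" if "x \<in> {a..b}" for x
  proof -
    have i: "h1 integrable_on {a..x}" "h2 integrable_on {a..x}"
      using h1(1) h2(1) that by (auto intro: integrable_on_subinterval set_lebesgue_integral_eq_integral(1))
    have "integral {a..x} h = integral {a..x} (\<lambda>x. h1 x - h2 x)"
      using that by (intro integral_cong) (simp add: h_def)
    also have "\<dots> = f x - f a"
      using i h1(2)[OF that] h2(2)[OF that] by (simp add: Henstock_Kurzweil_Integration.integral_diff)
    finally show ?thesis .
  qed
  have "(\<lambda>x. if x \<in> {a..b} then h1 x - h2 x else 0) integrable_on UNIV"
    using \<open>(\<lambda>x. h1 x - h2 x) absolutely_integrable_on {a..b}\<close>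
    by (subst integrable_restrict_UNIV) (rule set_lebesgue_integral_eq_integral(1))
  then have "h integrable_on {c..d}" for c d
    unfolding h_def[abs_def] by (rule integrable_on_subinterval) simp
  then obtain N where N: "negligible N"
    "\<And>x a. x \<notin> N \<Longrightarrow> a < x \<Longrightarrow> ((\<lambda>y. integral {a..y} h) has_real_derivative h x) (at x)"
    using has_derivative_integral_AE by blast
  show thesis
  proof (rule that[OF hab])
    \<comment> \<open>The endpoints are added because \<open>f\<close> is recovered as an integral
      only inside \<open>{a..b}\<close>, while the derivative is two-sided.\<close>
    show "negligible (N \<union> {a, b})" using N(1) by (simp add: negligible_Un)
    show "(f has_real_derivative h x) (at x)" if "x \<in> {a..b} - (N \<union> {a, b})" for x
    proof -
      have x: "x \<notin> N" "x \<in> {a<..<b}" using that by auto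
      have "((\<lambda>y. integral {a..y} h + f a) has_real_derivative h x) (at x)"
        using N(2)[of x a] x by (auto intro!: derivative_eq_intros)
      then show ?thesis
        by (rule has_field_derivative_transform_within_open[of _ _ _ "{a<..<b}"]) (use x hint in auto)
    qed
  qed (rule hint)
qed

section \<open>Shifted Legendre polynomials and their iterated primitives\<close>

definition pint :: "real poly \<Rightarrow> real poly" where
  "pint p = (\<Sum>i\<le>degree p. monom (coeff p i / real (Suc i)) (Suc i))"

lemma coeff_pint: "coeff (pint p) m = (case m of 0 \<Rightarrow> 0 | Suc i \<Rightarrow> coeff p i / real (Suc i))"
proof (cases m)
  case 0
  then show ?thesis by (simp add: pint_def coeff_sum)
next
  case (Suc j)
  have "coeff (pint p) m = (\<Sum>i\<le>degree p. if i = j then coeff p i / real (Suc i) else 0)"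
    unfolding pint_def coeff_sum Suc by (intro sum.cong) auto
  also have "\<dots> = coeff p j / real (Suc j)"
    by (simp add: coeff_eq_0)
  finally show ?thesis by (simp add: Suc)
qed

lemma pderiv_pint [simp]: "pderiv (pint p) = p"
  by (rule poly_eqI) (simp add: coeff_pderiv coeff_pint)

lemma poly_pint_0 [simp]: "poly (pint p) 0 = 0"
  by (simp add: poly_0_coeff_0 coeff_pint)

lemma pint_pderiv: "poly p 0 = 0 \<Longrightarrow> pint (pderiv p) = p"
  by (rule poly_eqI) (auto simp: coeff_pderiv coeff_pint poly_0_coeff_0 split: nat.splits)

lemma pint_diff: "pint (p - q) = pint p - pint q"
  by (rule poly_eqI) (auto simp: coeff_pint diff_divide_distrib split: nat.splits)

lemma pint_smult: "pint (smult c p) = smult c (pint p)"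
  by (rule poly_eqI) (auto simp: coeff_pint split: nat.splits)

lemma pint_funpow_diff: "(pint ^^ r) (p - q) = (pint ^^ r) p - (pint ^^ r) q"
  by (induction r) (simp_all add: pint_diff)

lemma pint_funpow_smult: "(pint ^^ r) (smult c p) = smult c ((pint ^^ r) p)"
  by (induction r) (simp_all add: pint_smult)

lemma pint_funpow_pderiv:
  "(\<And>i. i < j \<Longrightarrow> poly ((pderiv ^^ i) p) 0 = 0) \<Longrightarrow> (pint ^^ j) ((pderiv ^^ j) p) = p"
proof (induction j)
  case (Suc j)
  have "(pint ^^ Suc j) ((pderiv ^^ Suc j) p) = (pint ^^ j) (pint (pderiv ((pderiv ^^ j) p)))"
    by (simp add: funpow_swap1)
  also have "\<dots> = p" using Suc by (simp add: pint_pderiv)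
  finally show ?case .
qed simp

lemma pderiv_funpow_smult: "(pderiv ^^ j) (smult (c :: real) p) = smult c ((pderiv ^^ j) p)"
  by (induction j) (simp_all add: pderiv_smult)

lemma pderiv_funpow_add: "(pderiv ^^ j) (p + q :: real poly) = (pderiv ^^ j) p + (pderiv ^^ j) q"
  by (induction j) (simp_all add: pderiv_add)

text \<open>Division by \<open>m!\<close> keeps factorials out of the recursion
  \<open>pderiv2_tpow\<close> and gives the Legendre polynomials the value 1 at 1.\<close>

definition tpow :: "nat \<Rightarrow> real poly" where
  "tpow m = smult (1 / fact m) ([:0, -1, 1:] ^ m)"

text \<open>Rodrigues' formula for the Legendre polynomials moved to the unit interval.\<close>

definition legendre :: "nat \<Rightarrow> real poly" where
  "legendre m = (pderiv ^^ m) (tpow m)"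

lemma poly_tpow: "poly (tpow m) x = (x\<^sup>2 - x) ^ m / fact m"
  by (simp add: tpow_def poly_power power2_eq_square algebra_simps)

lemma tpow_0 [simp]: "tpow 0 = 1" by (simp add: tpow_def)

lemma pderiv_tpow_Suc: "pderiv (tpow (Suc m)) = [:-1, 2:] * tpow m"
proof -
  have "pderiv [:0, -1, 1::real:] = [:-1, 2:]" by (simp add: pderiv_pCons)
  then have "pderiv (tpow (Suc m)) = smult (1 / fact (Suc m)) (smult (real (Suc m)) ([:0, -1, 1:] ^ m) * [:-1, 2:])"
    by (simp only: tpow_def pderiv_smult pderiv_power_Suc)
  also have "\<dots> = [:-1, 2:] * tpow m"
    by (simp add: tpow_def mult.commute)
  finally show ?thesis .
qed

text \<open>The two facts behind it are \<open>(2 x - 1)^2 = 1 + 4 (x^2 - x)\<close> and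
  \<open>(x^2 - x) * tpow m = (m + 1) * tpow (m + 1)\<close>. The boundary values, the Legendre
  recurrence and the fifth and sixth derivatives all come from this recursion.\<close>

lemma pderiv2_tpow: "pderiv (pderiv (tpow (Suc (Suc m)))) = tpow m + smult (4 * real m + 6) (tpow (Suc m))"
proof -
  have "pderiv (pderiv (tpow (Suc (Suc m)))) = [:-1, 2:] * ([:-1, 2:] * tpow m) + smult 2 (tpow (Suc m))"
    unfolding pderiv_tpow_Suc pderiv_mult by (simp add: pderiv_pCons)
  also have "\<dots> = tpow m + smult (4 * real m + 6) (tpow (Suc m))"
  proof (intro poly_eq_poly_eq_iff[THEN iffD1] ext)
    fix x :: real
    have "poly (tpow (Suc m)) x * real (Suc m) = (x\<^sup>2 - x) * poly (tpow m) x"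
      by (simp add: poly_tpow del: of_nat_Suc)
    then have "real m * poly (tpow (Suc m)) x = (x\<^sup>2 - x) * poly (tpow m) x - poly (tpow (Suc m)) x"
      by (simp add: algebra_simps)
    then show "poly ([:-1, 2:] * ([:-1, 2:] * tpow m) + smult 2 (tpow (Suc m))) x
        = poly (tpow m + smult (4 * real m + 6) (tpow (Suc m))) x"
      by (simp add: algebra_simps power2_eq_square)
  qed
  finally show ?thesis .
qed

text \<open>The condition \<open>x^2 = x\<close> treats both endpoints at once. The induction goes
  down two derivatives at a time: \<open>pderiv2_tpow\<close> lowers the order by two and the
  exponent by at most two.\<close>

lemma tpow_boundary: "j < m \<Longrightarrow> x\<^sup>2 = x \<Longrightarrow> poly ((pderiv ^^ j) (tpow m)) x = 0"
proof (induction j arbitrary: m rule: less_induct)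
  case (less j)
  consider "j = 0" | "j = 1" | i where "j = Suc (Suc i)" by (cases j rule: nat.exhaust) (auto, metis nat.exhaust)
  then show ?case
  proof cases
    case 1
    then show ?thesis using less.prems by (simp add: poly_tpow)
  next
    case 2
    then obtain k where "m = Suc (Suc k)" using less.prems by (metis One_nat_def less_imp_Suc_add plus_1_eq_Suc add_Suc)
    then show ?thesis using 2 less.prems by (simp add: pderiv_tpow_Suc poly_tpow)
  next
    case 3
    then obtain k where m: "m = Suc (Suc k)" and k: "i < k"
      using less.prems(1) by (cases m rule: nat.exhaust) (simp, metis Suc_less_eq not_less_zero nat.exhaust)
    have "(pderiv ^^ j) (tpow m) = (pderiv ^^ i) (pderiv (pderiv (tpow m)))"
      by (simp add: 3 funpow_swap1)
    also have "\<dots> = (pderiv ^^ i) (tpow k) + smult (4 * real k + 6) ((pderiv ^^ i) (tpow (Suc k)))"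
      unfolding m pderiv2_tpow pderiv_funpow_add pderiv_funpow_smult ..
    finally show ?thesis using less.IH[of i k] less.IH[of i "Suc k"] less.prems(2) k 3 by simp
  qed
qed

lemma legendre_0 [simp]: "legendre 0 = 1" by (simp add: legendre_def)

lemma legendre_1: "legendre (Suc 0) = [:-1, 2:]" by (simp add: legendre_def pderiv_tpow_Suc)

text \<open>Differentiating \<open>pderiv2_tpow\<close> another \<open>m + 1\<close> times gives the
  classical \<open>P'_{k+1} - P'_{k-1} = (2 k + 1) P_k\<close> with \<open>k = m + 1\<close>,
  doubled by the substitution \<open>2 x - 1\<close>.\<close>

lemma pderiv_legendre:
  "pderiv (legendre (Suc (Suc m))) = pderiv (legendre m) + smult (4 * real m + 6) (legendre (Suc m))"
proof -
  have "pderiv (legendre (Suc (Suc m))) = (pderiv ^^ Suc m) (pderiv (pderiv (tpow (Suc (Suc m)))))"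
    by (simp add: legendre_def funpow_swap1)
  also have "\<dots> = pderiv (legendre m) + smult (4 * real m + 6) (legendre (Suc m))"
    unfolding pderiv2_tpow pderiv_funpow_add pderiv_funpow_smult by (simp add: legendre_def)
  finally show ?thesis .
qed

lemma poly_funpow_pderiv_0: "poly ((pderiv ^^ m) p) 0 = fact m * coeff p m" for p :: "real poly"
proof -
  have "coeff ((pderiv ^^ m) p) i = fact (i + m) / fact i * coeff p (i + m)" for i
  proof (induction m arbitrary: i)
    case (Suc m)
    show ?case by (simp add: coeff_pderiv Suc) 
  qed simp
  then show ?thesis by (simp add: poly_0_coeff_0)
qed

lemma tpow_eq: "tpow m = smult (1 / fact m) (monom 1 m * [:-1, 1:] ^ m)"
proof -
  have *: "[:0, -1, 1:] = monom 1 1 * [:-1, 1 :: real:]" by (simp add: monom_altdef)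
  show ?thesis by (simp only: tpow_def * power_mult_distrib monom_power power_one mult_1_left)
qed

lemma poly_legendre_0: "poly (legendre m) 0 = (- 1) ^ m"
proof -
  have "coeff (monom 1 m * [:-1, 1 :: real:] ^ m) m = coeff ([:-1, 1:] ^ m) 0"
    by (simp add: coeff_monom_mult)
  also have "\<dots> = (- 1) ^ m" by (simp add: coeff_0_power)
  finally show ?thesis
    by (simp add: legendre_def poly_funpow_pderiv_0 tpow_eq)
qed

lemma pint_legendre:
  "smult (4 * real m + 6) (pint (legendre (Suc m))) = legendre (Suc (Suc m)) - legendre m"
proof -
  have "smult (4 * real m + 6) (pint (legendre (Suc m))) = pint (pderiv (legendre (Suc (Suc m)) - legendre m))"
    by (simp add: pderiv_diff pderiv_legendre pint_smult)
  also have "\<dots> = legendre (Suc (Suc m)) - legendre m"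
    \<comment> \<open>The indices differ by two, so both polynomials have the same value at 0 and no
      integration constant appears.\<close>
    by (rule pint_pderiv) (simp add: poly_legendre_0)
  finally show ?thesis .
qed

lemma degree_tpow [simp]: "degree (tpow m) = 2 * m"
  by (simp add: tpow_def degree_power_eq)

lemma degree_funpow_pderiv: "degree ((pderiv ^^ j) p) = degree p - j" for p :: "real poly"
  by (induction j) (simp_all add: degree_pderiv)

lemma degree_legendre [simp]: "degree (legendre m) = m"
  by (simp add: legendre_def degree_funpow_pderiv)

text \<open>Subtracting the multiple of \<open>legendre d\<close> with the same leading coefficient
  lowers the degree. The induction-rule form suits orthogonality, a property closed under linear
  combinations.\<close>

lemma legendre_spans:
  assumes "degree p < n" and "\<And>m. m < n \<Longrightarrow> P (legendre m)"
    and "P 0" "\<And>p q. P p \<Longrightarrow> P q \<Longrightarrow> P (p + q)" "\<And>c p. P p \<Longrightarrow> P (smult c p)"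
  shows "P p"
  using assms(1)
proof (induction "degree p" arbitrary: p rule: less_induct)
  case less
  define d where "d = degree p"
  define c where "c = lead_coeff p / lead_coeff (legendre d)"
  define q where "q = p - smult c (legendre d)"
  have "legendre d \<noteq> 0"
    using poly_legendre_0[of d] by (metis poly_0 power_eq_0_iff zero_neq_neg_one)
  then have "lead_coeff (legendre d) \<noteq> 0" by (simp only: leading_coeff_neq_0 not_False_eq_True)
  then have q0: "coeff q d = 0" by (simp add: q_def c_def d_def)
  have "degree q \<le> d" unfolding q_def d_def
    by (intro degree_diff_le) (auto intro: order_trans[OF degree_smult_le])
  have "P (smult c (legendre d))" using less.prems by (intro assms(2,5)) (simp add: d_def)
  moreover have "P q"
  proof (cases "q = 0")
    case False
    then have "degree q < d" using \<open>degree q \<le> d\<close> q0 by (metis le_neq_implies_less leading_coeff_0_iff)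
    then show ?thesis using less.hyps[of q] less.prems by (simp add: d_def)
  qed (use assms(3) in simp)
  ultimately have "P (q + smult c (legendre d))" by (rule assms(4)[rotated])
  then show ?case by (simp add: q_def)
qed

text \<open>The product \<open>I\<^sup>r L\<^sub>m \<cdot> I\<^sup>r\<^sup>-\<^sup>1 L\<^sub>m\<close> telescopes, because \<open>(4m + 2) I L\<^sub>m = L\<^sub>m\<^sub>+\<^sub>1 - L\<^sub>m\<^sub>-\<^sub>1\<close>.\<close>

lemma legendre_telescope:
  "(\<Sum>m\<le>n. (4 * real m + 2) * (poly ((pint ^^ Suc r) (legendre m)) a * poly ((pint ^^ r) (legendre m)) a))
   = (poly ((pint ^^ r) 1) a)\<^sup>2 + poly ((pint ^^ r) (legendre (Suc n))) a * poly ((pint ^^ r) (legendre n)) a"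
proof (induction n)
  case 0
  \<comment> \<open>At index 0 the recurrence reads \<open>2 I L_0 = L_1 + 1\<close>, as if
    \<open>L_{-1}\<close> were \<open>-1\<close>. This is the source of the square that the
    telescoping leaves over.\<close>
  have "legendre (Suc 0) = smult 2 (pint 1) - 1"
    unfolding legendre_1
    by (rule poly_eqI) (auto simp: coeff_pint coeff_pCons split: nat.splits)
  then have "(pint ^^ r) (legendre (Suc 0)) = smult 2 ((pint ^^ Suc r) 1) - (pint ^^ r) 1"
    by (simp only: pint_funpow_diff pint_funpow_smult funpow_Suc_right o_apply)
  then have eq: "poly ((pint ^^ r) (legendre (Suc 0))) a = 2 * poly ((pint ^^ Suc r) 1) a - poly ((pint ^^ r) 1) a"
    by (simp only: poly_diff poly_smult)
  show ?case by (simp add: eq power2_eq_square algebra_simps del: funpow.simps)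
next
  case (Suc n)
  have "smult (4 * real n + 6) ((pint ^^ Suc r) (legendre (Suc n))) = (pint ^^ r) (legendre (Suc (Suc n)) - legendre n)"
    unfolding pint_legendre[symmetric] by (simp only: pint_funpow_smult funpow_Suc_right o_apply)
  then have "poly (smult (4 * real n + 6) ((pint ^^ Suc r) (legendre (Suc n)))) a
     = poly ((pint ^^ r) (legendre (Suc (Suc n))) - (pint ^^ r) (legendre n)) a"
    unfolding pint_funpow_diff by (rule arg_cong)
  then have eq: "(4 * real (Suc n) + 2) * poly ((pint ^^ Suc r) (legendre (Suc n))) a
     = poly ((pint ^^ r) (legendre (Suc (Suc n)))) a - poly ((pint ^^ r) (legendre n)) a"
    unfolding poly_diff poly_smult by (simp add: add.commute)
  have eq': "(4 * real (Suc n) + 2) * (poly ((pint ^^ Suc r) (legendre (Suc n))) a * q)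
     = (poly ((pint ^^ r) (legendre (Suc (Suc n)))) a - poly ((pint ^^ r) (legendre n)) a) * q" for q
    unfolding mult.assoc[symmetric] eq ..
  show ?case
    unfolding sum.atMost_Suc Suc.IH eq' by (simp add: algebra_simps del: funpow.simps)
qed

text \<open>All derivatives of \<open>tpow m\<close> of order below \<open>m\<close> vanish at 0, so
  each primitive just undoes one derivative in Rodrigues' formula.\<close>

lemma pint_funpow_legendre:
  assumes "r \<le> m"
  shows "(pint ^^ r) (legendre m) = (pderiv ^^ (m - r)) (tpow m)"
proof -
  have "legendre m = (pderiv ^^ r) ((pderiv ^^ (m - r)) (tpow m))"
    unfolding legendre_def o_apply[of "pderiv ^^ r" "pderiv ^^ (m - r)", symmetric] funpow_add[symmetric]
    using assms by simp
  moreover have "(pint ^^ r) ((pderiv ^^ r) ((pderiv ^^ (m - r)) (tpow m))) = (pderiv ^^ (m - r)) (tpow m)"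
  proof (rule pint_funpow_pderiv)
    fix i assume "i < r"
    have "(pderiv ^^ i) ((pderiv ^^ (m - r)) (tpow m)) = (pderiv ^^ (i + (m - r))) (tpow m)"
      by (simp add: funpow_add)
    then show "poly ((pderiv ^^ i) ((pderiv ^^ (m - r)) (tpow m))) 0 = 0"
      using tpow_boundary[of "i + (m - r)" m 0] assms \<open>i < r\<close> by simp
  qed
  ultimately show ?thesis by simp
qed

text \<open>Three applications of \<open>pderiv2_tpow\<close>, grouped as four derivatives after
  two; every summand is a power of \<open>x^2 - x\<close>.\<close>

lemma pderiv6_tpow:
  "(pderiv ^^ 6) (tpow (m + 6)) = tpow m + smult (12 * real m + 42) (tpow (m + 1))
     + smult ((4 * real m + 18) * (12 * real m + 42)) (tpow (m + 2))
     + smult ((4 * real m + 22) * (4 * real m + 18) * (4 * real m + 14)) (tpow (m + 3))"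
proof -
  have 2: "(pderiv ^^ 2) (tpow (k + 2)) = tpow k + smult (4 * real k + 6) (tpow (k + 1))" for k
    using pderiv2_tpow[of k] by (simp add: numeral_2_eq_2)
  have 4: "(pderiv ^^ 4) (tpow (k + 4)) = tpow k + smult (8 * real k + 20) (tpow (k + 1))
     + smult ((4 * real k + 14) * (4 * real k + 10)) (tpow (k + 2))" for k
  proof -
    have "(pderiv ^^ 4) (tpow (k + 4)) = (pderiv ^^ 2) ((pderiv ^^ 2) (tpow (k + 2 + 2)))"
      by (simp add: numeral_2_eq_2 numeral_eq_Suc)
    also have "\<dots> = (pderiv ^^ 2) (tpow (k + 2)) + smult (4 * real k + 14) ((pderiv ^^ 2) (tpow (k + 1 + 2)))"
      unfolding 2[of "k + 2"] pderiv_funpow_add pderiv_funpow_smult by (simp add: ac_simps)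
    also have "\<dots> = tpow k + smult (8 * real k + 20) (tpow (k + 1))
     + smult ((4 * real k + 14) * (4 * real k + 10)) (tpow (k + 2))"
      unfolding 2 by (rule poly_eqI) (simp add: algebra_simps)
    finally show ?thesis .
  qed
  have e: "m + 1 + 1 = m + 2" "m + 1 + 2 = m + 3" by simp_all
  have "(pderiv ^^ 6) (tpow (m + 6)) = (pderiv ^^ 4) ((pderiv ^^ 2) (tpow (m + 4 + 2)))"
    by (simp add: numeral_2_eq_2 numeral_eq_Suc)
  also have "\<dots> = (pderiv ^^ 4) (tpow (m + 4)) + smult (4 * real m + 22) ((pderiv ^^ 4) (tpow (m + 1 + 4)))"
    unfolding 2[of "m + 4"] pderiv_funpow_add pderiv_funpow_smult by (simp add: ac_simps)
  also have "\<dots> = tpow m + smult (12 * real m + 42) (tpow (m + 1))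
     + smult ((4 * real m + 18) * (12 * real m + 42)) (tpow (m + 2))
     + smult ((4 * real m + 22) * (4 * real m + 18) * (4 * real m + 14)) (tpow (m + 3))"
    unfolding 4 e by (rule poly_eqI) (simp add: algebra_simps)
  finally show ?thesis .
qed

text \<open>Two double steps and one single derivative; only the single one produces the factor
  \<open>2 x - 1\<close>.\<close>

lemma pderiv5_tpow:
  "(pderiv ^^ 5) (tpow (m + 5)) = [:-1, 2:] * (tpow m + smult (8 * real m + 28) (tpow (m + 1))
     + smult ((4 * real m + 18) * (4 * real m + 14)) (tpow (m + 2)))"
proof -
  have 2: "(pderiv ^^ 2) (tpow (k + 2)) = tpow k + smult (4 * real k + 6) (tpow (k + 1))" for k
    using pderiv2_tpow[of k] by (simp add: numeral_2_eq_2)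
  have 1: "pderiv (tpow (k + 1)) = [:-1, 2:] * tpow k" for k
    using pderiv_tpow_Suc[of k] by simp
  have e: "m + 3 + 1 = m + 4" "m + 1 + 2 = m + 3" "m + 2 + 2 = m + 4" by simp_all
  have "(pderiv ^^ 5) (tpow (m + 5)) = pderiv ((pderiv ^^ 2) ((pderiv ^^ 2) (tpow (m + 3 + 2))))"
    by (simp add: numeral_2_eq_2 numeral_eq_Suc)
  also have "\<dots> = pderiv ((pderiv ^^ 2) (tpow (m + 1 + 2)) + smult (4 * real m + 18) ((pderiv ^^ 2) (tpow (m + 2 + 2))))"
    unfolding 2[of "m + 3"] pderiv_funpow_add pderiv_funpow_smult e by (simp add: add.commute)
  also have "\<dots> = pderiv (tpow (m + 1)) + smult (8 * real m + 28) (pderiv (tpow (m + 1 + 1)))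
     + smult ((4 * real m + 18) * (4 * real m + 14)) (pderiv (tpow (m + 2 + 1)))"
    unfolding 2 pderiv_add pderiv_smult by (rule poly_eqI) (simp add: algebra_simps)
  also have "\<dots> = [:-1, 2:] * (tpow m + smult (8 * real m + 28) (tpow (m + 1))
     + smult ((4 * real m + 18) * (4 * real m + 14)) (tpow (m + 2)))"
    unfolding 1 by (simp add: distrib_left)
  finally show ?thesis .
qed

text \<open>With \<open>m = n - 6\<close>, the four powers in \<open>pderiv6_tpow\<close> are
  written over the common denominator \<open>(m + 3)!\<close>, which turns the quotients of
  factorials into the linear factors in \<open>n\<close>.\<close>

lemma poly_pderiv6_tpow:
  assumes "n \<ge> 6"
  shows "poly ((pderiv ^^ 6) (tpow n)) x = (x\<^sup>2 - x) ^ (n - 6) / fact (n - 3) *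
    ((real n - 3) * (real n - 4) * (real n - 5) + (12 * real n - 30) * (real n - 3) * (real n - 4) * (x\<^sup>2 - x)
     + (4 * real n - 6) * (12 * real n - 30) * (real n - 3) * (x\<^sup>2 - x)\<^sup>2
     + (4 * real n - 2) * (4 * real n - 6) * (4 * real n - 10) * (x\<^sup>2 - x)^3)"
proof -
  obtain m where n: "n = m + 6" using assms by (metis add.commute le_Suc_ex)
  define t where "t = x\<^sup>2 - x"
  define f :: real where "f = fact (m + 3)"
  define M where "M = real m"
  have M: "M \<ge> 0" by (simp add: M_def)
  have "f > 0" by (simp add: f_def)
  have f3: "f = (M + 3) * (M + 2) * (M + 1) * fact m" and f2: "f = (M + 3) * (M + 2) * fact (m + 1)"
    and f1: "f = (M + 3) * fact (m + 2)"
    by (simp_all add: f_def M_def numeral_3_eq_3 numeral_2_eq_2 algebra_simps)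
  have p: "poly (tpow m) x = t ^ m / f * ((M + 3) * (M + 2) * (M + 1))"
    "poly (tpow (m + 1)) x = t ^ m / f * ((M + 3) * (M + 2) * t)"
    "poly (tpow (m + 2)) x = t ^ m / f * ((M + 3) * t\<^sup>2)"
    "poly (tpow (m + 3)) x = t ^ m / f * t^3"
    unfolding poly_tpow t_def[symmetric]
  proof -
    show "t ^ m / fact m = t ^ m / f * ((M + 3) * (M + 2) * (M + 1))" unfolding f3 using M by simp
    show "t ^ (m + 1) / fact (m + 1) = t ^ m / f * ((M + 3) * (M + 2) * t)"
      unfolding f2 using M by (simp del: fact_Suc)
    show "t ^ (m + 2) / fact (m + 2) = t ^ m / f * ((M + 3) * t\<^sup>2)"
      unfolding f1 using M by (simp add: power_add power2_eq_square del: fact_Suc)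
    show "t ^ (m + 3) / fact (m + 3) = t ^ m / f * t ^ 3"
      by (simp add: f_def power_add del: fact_Suc)
  qed
  define c where "c = t ^ m / f"
  have e: "real (m + 6) = M + 6" "m + 6 - 6 = m" "m + 6 - 3 = m + 3" by (simp_all add: M_def)
  show ?thesis
    unfolding n pderiv6_tpow t_def[symmetric] poly_add poly_smult p e f_def[symmetric] c_def[symmetric]
    unfolding M_def[symmetric] by algebra
qed

lemma poly_pderiv5_tpow:
  assumes "n \<ge> 6"
  shows "poly ((pderiv ^^ 5) (tpow (n - 1))) x = (2 * x - 1) * (x\<^sup>2 - x) ^ (n - 6) / fact (n - 4) *
    ((real n - 4) * (real n - 5) + (8 * real n - 20) * (real n - 4) * (x\<^sup>2 - x)
      + (4 * real n - 6) * (4 * real n - 10) * (x\<^sup>2 - x)\<^sup>2)"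
proof -
  obtain m where n: "n = m + 6" using assms by (metis add.commute le_Suc_ex)
  define t where "t = x\<^sup>2 - x"
  define f :: real where "f = fact (m + 2)"
  define M where "M = real m"
  have M: "M \<ge> 0" by (simp add: M_def)
  have f2: "f = (M + 2) * (M + 1) * fact m" and f1: "f = (M + 2) * fact (m + 1)"
    by (simp_all add: f_def M_def numeral_2_eq_2 algebra_simps)
  have p: "poly (tpow m) x = t ^ m / f * ((M + 2) * (M + 1))"
    "poly (tpow (m + 1)) x = t ^ m / f * ((M + 2) * t)"
    "poly (tpow (m + 2)) x = t ^ m / f * t\<^sup>2"
    unfolding poly_tpow t_def[symmetric]
  proof -
    show "t ^ m / fact m = t ^ m / f * ((M + 2) * (M + 1))" unfolding f2 using M by simp
    show "t ^ (m + 1) / fact (m + 1) = t ^ m / f * ((M + 2) * t)"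
      unfolding f1 using M by (simp del: fact_Suc)
    show "t ^ (m + 2) / fact (m + 2) = t ^ m / f * t\<^sup>2"
      by (simp add: f_def power_add power2_eq_square del: fact_Suc)
  qed
  define c where "c = t ^ m / f"
  have e: "real (m + 6) = M + 6" "m + 6 - 6 = m" "m + 6 - 4 = m + 2" "m + 6 - 1 = m + 5"
    by (simp_all add: M_def)
  have q: "poly [:-1, 2:] x = 2 * x - 1" "(2 * x - 1) * t ^ m / f = (2 * x - 1) * c" by (simp_all add: c_def)
  show ?thesis
    unfolding n e pderiv5_tpow t_def[symmetric] poly_mult poly_add poly_smult p f_def[symmetric] q c_def[symmetric]
    unfolding M_def[symmetric] by algebra
qed

section \<open>Iterated integration by parts\<close>

lemma absolutely_continuous_cong:
  assumes "absolutely_continuous_on_interval a b f" "\<And>x. x \<in> {a..b} \<Longrightarrow> f x = g x"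
  shows "absolutely_continuous_on_interval a b g"
proof -
  have *: "(\<Sum>(u, v)\<in>I. \<bar>g v - g u\<bar>) = (\<Sum>(u, v)\<in>I. \<bar>f v - f u\<bar>)" if "interval_family a b I" for I
  proof (rule sum.cong[OF refl])
    fix p assume "p \<in> I"
    then have "a \<le> fst p" "fst p < snd p" "snd p \<le> b"
      using that by (auto simp: interval_family_def)
    then show "(case p of (u, v) \<Rightarrow> \<bar>g v - g u\<bar>) = (case p of (u, v) \<Rightarrow> \<bar>f v - f u\<bar>)"
      using assms(2)[of "fst p"] assms(2)[of "snd p"] by (simp add: split_beta)
  qed
  show ?thesis
    unfolding absolutely_continuous_on_interval_family
  proof (intro allI impI)
    fix e :: real assume "e > 0"
    then obtain d where d: "d > 0" "\<And>I. interval_family a b I \<Longrightarrow>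
       (\<Sum>(u, v)\<in>I. v - u) < d \<Longrightarrow> (\<Sum>(u, v)\<in>I. \<bar>f v - f u\<bar>) < e"
      using assms(1) unfolding absolutely_continuous_on_interval_family by meson
    show "\<exists>d>0. \<forall>I. interval_family a b I \<longrightarrow> (\<Sum>(u, v)\<in>I. v - u) < d \<longrightarrow> (\<Sum>(u, v)\<in>I. \<bar>g v - g u\<bar>) < e"
      by (rule exI[of _ d]) (simp add: d *)
  qed
qed

text \<open>The shape of the bound covers sums, products and Lipschitz images alike.\<close>

lemma absolutely_continuous_dominated:
  fixes f g h :: "real \<Rightarrow> real"
  assumes "absolutely_continuous_on_interval a b f" "absolutely_continuous_on_interval a b g"
    and B: "B \<ge> 0" and dom: "\<And>u v. a \<le> u \<Longrightarrow> u \<le> v \<Longrightarrow> v \<le> b \<Longrightarrow> \<bar>h v - h u\<bar> \<le> B * (\<bar>f v - f u\<bar> + \<bar>g v - g u\<bar>)"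
  shows "absolutely_continuous_on_interval a b h"
  unfolding absolutely_continuous_on_interval_family
proof (intro allI impI)
  fix \<epsilon> :: real assume "\<epsilon> > 0"
  define e where "e = \<epsilon> / (B + 1) / 2"
  have "e > 0" using \<open>\<epsilon> > 0\<close> B by (simp add: e_def)
  obtain d where d: "d > 0" "\<And>I. interval_family a b I \<Longrightarrow>
     (\<Sum>(u, v)\<in>I. v - u) < d \<Longrightarrow> (\<Sum>(u, v)\<in>I. \<bar>f v - f u\<bar>) < e"
    using assms(1) \<open>e > 0\<close> unfolding absolutely_continuous_on_interval_family by meson
  obtain d' where d': "d' > 0" "\<And>I. interval_family a b I \<Longrightarrow>
     (\<Sum>(u, v)\<in>I. v - u) < d' \<Longrightarrow> (\<Sum>(u, v)\<in>I. \<bar>g v - g u\<bar>) < e"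
    using assms(2) \<open>e > 0\<close> unfolding absolutely_continuous_on_interval_family by meson
  have "(\<Sum>(u, v)\<in>I. \<bar>h v - h u\<bar>) < \<epsilon>"
    if I: "interval_family a b I" "(\<Sum>(u, v)\<in>I. v - u) < min d d'" for I
  proof -
    have "(\<Sum>(u, v)\<in>I. \<bar>h v - h u\<bar>) \<le> (\<Sum>(u, v)\<in>I. B * (\<bar>f v - f u\<bar> + \<bar>g v - g u\<bar>))"
    proof (rule sum_mono)
      fix p assume "p \<in> I"
      then have "a \<le> fst p" "fst p \<le> snd p" "snd p \<le> b"
        using I by (auto simp: interval_family_def less_imp_le)
      then show "(case p of (u, v) \<Rightarrow> \<bar>h v - h u\<bar>) \<le> (case p of (u, v) \<Rightarrow> B * (\<bar>f v - f u\<bar> + \<bar>g v - g u\<bar>))"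
        using dom[of "fst p" "snd p"] by (simp add: split_beta)
    qed
    also have "\<dots> = B * ((\<Sum>(u, v)\<in>I. \<bar>f v - f u\<bar>) + (\<Sum>(u, v)\<in>I. \<bar>g v - g u\<bar>))"
      unfolding distrib_left sum_distrib_left sum.distrib[symmetric] by (intro sum.cong) (auto simp: distrib_left)
    also have "\<dots> \<le> B * (e + e)"
      using d(2)[OF I(1)] d'(2)[OF I(1)] I(2) B by (intro mult_left_mono add_mono) auto
    also have "\<dots> < (B + 1) * (e + e)" using \<open>e > 0\<close> by simp
    also have "\<dots> = (B + 1) * (\<epsilon> / (B + 1))" unfolding e_def field_sum_of_halves ..
    also have "\<dots> = \<epsilon>" using B by simp
    finally show ?thesis .
  qed
  then show "\<exists>\<delta>>0. \<forall>I. interval_family a b I \<longrightarrow> (\<Sum>(u, v)\<in>I. v - u) < \<delta> \<longrightarrow>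
      (\<Sum>(u, v)\<in>I. \<bar>h v - h u\<bar>) < \<epsilon>"
    using d(1) d'(1) by (intro exI[of _ "min d d'"]) auto
qed

lemma absolutely_continuous_id: "absolutely_continuous_on_interval a b (\<lambda>x. x)"
  unfolding absolutely_continuous_on_interval_family
proof (intro allI impI)
  fix e :: real assume "e > 0"
  have "(\<Sum>(u, v)\<in>I. \<bar>v - u\<bar>) = (\<Sum>(u, v)\<in>I. v - u)" if "interval_family a b I" for I
    using that by (intro sum.cong) (auto simp: interval_family_def)
  then show "\<exists>d>0. \<forall>I. interval_family a b I \<longrightarrow> (\<Sum>(u, v)\<in>I. v - u) < d \<longrightarrow> (\<Sum>(u, v)\<in>I. \<bar>v - u\<bar>) < e"
    using \<open>e > 0\<close> by (intro exI[of _ e]) auto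
qed

lemma absolutely_continuous_const: "absolutely_continuous_on_interval a b (\<lambda>x. c)"
  by (rule absolutely_continuous_dominated[OF absolutely_continuous_id absolutely_continuous_id, of 0]) auto

lemma absolutely_continuous_add:
  assumes "absolutely_continuous_on_interval a b f" "absolutely_continuous_on_interval a b g"
  shows "absolutely_continuous_on_interval a b (\<lambda>x. f x + g x)"
  by (rule absolutely_continuous_dominated[OF assms, of 1]) auto

lemma absolutely_continuous_max_0:
  assumes "absolutely_continuous_on_interval a b f"
  shows "absolutely_continuous_on_interval a b (\<lambda>x. max 0 (f x))"
  by (rule absolutely_continuous_dominated[OF assms assms, of 1]) (auto simp: max_def abs_if)

lemma absolutely_continuous_mult:
  assumes f: "absolutely_continuous_on_interval a b f" and g: "absolutely_continuous_on_interval a b g"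
  shows "absolutely_continuous_on_interval a b (\<lambda>x. f x * g x)"
proof -
  have "bounded (f ` {a..b})" "bounded (g ` {a..b})"
    using f g by (auto intro!: compact_imp_bounded compact_continuous_image absolutely_continuous_imp_continuous_on)
  then obtain B1 B2 where B1: "\<And>x. x \<in> {a..b} \<Longrightarrow> \<bar>f x\<bar> \<le> B1" and B2: "\<And>x. x \<in> {a..b} \<Longrightarrow> \<bar>g x\<bar> \<le> B2"
    unfolding bounded_iff real_norm_def by (meson imageI)
  define B where "B = max 0 (max B1 B2)"
  have "B \<ge> 0" "B1 \<le> B" "B2 \<le> B" by (simp_all add: B_def)
  then have B: "B \<ge> 0" "\<bar>f x\<bar> \<le> B" "\<bar>g x\<bar> \<le> B" if "x \<in> {a..b}" for x
    using B1[OF that] B2[OF that] by linarith+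
  show ?thesis
  proof (rule absolutely_continuous_dominated[OF f g \<open>B \<ge> 0\<close>])
    fix u v assume uv: "a \<le> u" "u \<le> v" "v \<le> b"
    have "f v * g v - f u * g u = (f v - f u) * g v + f u * (g v - g u)" by (simp add: algebra_simps)
    also have "\<bar>\<dots>\<bar> \<le> \<bar>f v - f u\<bar> * \<bar>g v\<bar> + \<bar>f u\<bar> * \<bar>g v - g u\<bar>"
      by (metis abs_mult abs_triangle_ineq)
    also have "\<dots> \<le> \<bar>f v - f u\<bar> * B + B * \<bar>g v - g u\<bar>"
      using uv by (intro add_mono mult_left_mono mult_right_mono B(2,3)) auto
    finally show "\<bar>f v * g v - f u * g u\<bar> \<le> B * (\<bar>f v - f u\<bar> + \<bar>g v - g u\<bar>)" by (simp add: algebra_simps)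
  qed
qed

lemma absolutely_continuous_power:
  "absolutely_continuous_on_interval a b f \<Longrightarrow> absolutely_continuous_on_interval a b (\<lambda>x. f x ^ n)"
  by (induction n) (simp_all add: absolutely_continuous_const absolutely_continuous_mult)

lemma absolutely_continuous_sum:
  "(\<And>i. i \<in> I \<Longrightarrow> absolutely_continuous_on_interval a b (f i)) \<Longrightarrow>
    absolutely_continuous_on_interval a b (\<lambda>x. \<Sum>i\<in>I. f i x)"
  by (induction I rule: infinite_finite_induct)
     (simp_all add: absolutely_continuous_const absolutely_continuous_add)

lemma absolutely_continuous_poly: "absolutely_continuous_on_interval a b (poly p)"
proof -
  have "absolutely_continuous_on_interval a b (\<lambda>x. \<Sum>i\<le>degree p. coeff p i * x ^ i)"
    by (intro absolutely_continuous_sum absolutely_continuous_mult absolutely_continuous_const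
        absolutely_continuous_power absolutely_continuous_id)
  then show ?thesis by (rule absolutely_continuous_cong) (simp add: poly_altdef)
qed

lemma pderiv_funpow_zero [simp]: "(pderiv ^^ n) (0 :: real poly) = 0"
  by (induction n) simp_all

lemma pderiv_funpow_eq_0: "degree p < n \<Longrightarrow> (pderiv ^^ n) p = 0" for p :: "real poly"
proof (induction n arbitrary: p)
  case (Suc n)
  show ?case
  proof (cases "degree p = 0")
    case True
    then have "pderiv p = 0" by (simp add: pderiv_eq_0_iff)
    then show ?thesis unfolding funpow_Suc_right o_apply by (simp add: pderiv_funpow_zero)
  next
    case False
    then show ?thesis using Suc by (simp add: funpow_Suc_right degree_pderiv del: funpow.simps)
  qed
qed simp

text \<open>In the derivative of the alternating sum, neighbouring terms cancel. Only the product
  with the top derivative \<open>D\<close> and the last boundary term survive.\<close>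

lemma iterated_parts_has_derivative:
  fixes \<phi> :: "nat \<Rightarrow> real \<Rightarrow> real"
  assumes \<phi>: "\<And>j. Suc j < n \<Longrightarrow> (\<phi> j has_real_derivative \<phi> (Suc j) x) (at x)"
    and D: "(\<phi> (n - 1) has_real_derivative D) (at x)" and "m < n"
  shows "((\<lambda>x. \<Sum>j<Suc m. (- 1) ^ j * (poly ((pderiv ^^ j) p) x * \<phi> (n - 1 - j) x)) has_real_derivative
    poly p x * D + (- 1) ^ m * (poly ((pderiv ^^ Suc m) p) x * \<phi> (n - 1 - m) x)) (at x)"
  using \<open>m < n\<close>
proof (induction m)
  case 0
  show ?case using D by (auto intro!: derivative_eq_intros poly_DERIV)
next
  case (Suc m)
  have "(\<phi> (n - 1 - Suc m) has_real_derivative \<phi> (n - 1 - m) x) (at x)"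
    using \<phi>[of "n - 1 - Suc m"] Suc.prems by (simp add: Suc_diff_Suc)
  then have "((\<lambda>x. (- 1) ^ Suc m * (poly ((pderiv ^^ Suc m) p) x * \<phi> (n - 1 - Suc m) x)) has_real_derivative
    (- 1) ^ Suc m * (poly ((pderiv ^^ Suc (Suc m)) p) x * \<phi> (n - 1 - Suc m) x +
       \<phi> (n - 1 - m) x * poly ((pderiv ^^ Suc m) p) x)) (at x)"
    using poly_DERIV[of "(pderiv ^^ Suc m) p" x]
    by (intro DERIV_cmult DERIV_mult) simp_all
  from DERIV_add[OF Suc.IH this] Suc.prems show ?case
    by (simp add: algebra_simps del: funpow.simps)
qed

text \<open>The alternating sum \<open>H\<close> is absolutely continuous and vanishes at 0, so it
  is the integral of its almost everywhere derivative. That derivative is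
  \<open>poly p x * E x\<close>, because the \<open>n\<close>-th derivative of \<open>p\<close> is
  zero; integrability of the product is part of this conclusion.\<close>

theorem iterated_parts:
  fixes \<phi> :: "nat \<Rightarrow> real \<Rightarrow> real"
  assumes \<phi>: "\<And>j x. Suc j < n \<Longrightarrow> x \<in> {0<..<1} \<Longrightarrow> (\<phi> j has_real_derivative \<phi> (Suc j) x) (at x)"
    and ac: "\<And>j. j < n \<Longrightarrow> absolutely_continuous_on_interval 0 1 (\<phi> j)"
    and zero: "\<And>j. j < n \<Longrightarrow> \<phi> j 0 = 0"
    and S: "negligible S" and E: "\<And>x. x \<in> {0<..<1} - S \<Longrightarrow> (\<phi> (n - 1) has_real_derivative E x) (at x)"
    and p: "degree p < n" and c: "c \<in> {0..1}"
  shows "((\<lambda>x. poly p x * E x) has_integral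
    (\<Sum>j<n. (- 1) ^ j * (poly ((pderiv ^^ j) p) c * \<phi> (n - 1 - j) c))) {0..c}"
proof -
  define H where "H x = (\<Sum>j<n. (- 1) ^ j * (poly ((pderiv ^^ j) p) x * \<phi> (n - 1 - j) x))" for x
  have "absolutely_continuous_on_interval 0 1 H"
    unfolding H_def[abs_def]
    by (intro absolutely_continuous_sum absolutely_continuous_mult absolutely_continuous_const
        absolutely_continuous_poly ac) (use p in auto)
  then obtain h N where h: "h absolutely_integrable_on {0..1}" "negligible N"
    "\<And>x. x \<in> {0..1} - N \<Longrightarrow> (H has_real_derivative h x) (at x)"
    "\<And>x. x \<in> {0..1} \<Longrightarrow> integral {0..x} h = H x - H 0"
    using absolutely_continuous_fundamental_theorem[of 0 1 H] by auto
  have "H 0 = 0" unfolding H_def using zero by (intro sum.neutral) auto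
  have "h integrable_on {0..c}"
    using h(1) c by (auto intro: integrable_on_subinterval set_lebesgue_integral_eq_integral(1))
  then have int: "(h has_integral H c) {0..c}"
    using h(4)[OF c] \<open>H 0 = 0\<close> by (simp add: has_integral_integral)
  have eq: "poly p x * E x = h x" if x: "x \<in> {0..c} - (N \<union> S \<union> {0, 1})" for x
  proof -
    have x': "x \<in> {0<..<1}" using x c by auto
    obtain m where m: "n = Suc m" using p by (metis not_less_zero not0_implies_Suc)
    have "(H has_real_derivative poly p x * E x + (- 1) ^ m * (poly ((pderiv ^^ n) p) x * \<phi> (n - 1 - m) x)) (at x)"
      unfolding H_def[abs_def] m
      using \<phi>[OF _ x'] E[of x] x x' by (intro iterated_parts_has_derivative) (auto simp: m)
    then have "(H has_real_derivative poly p x * E x) (at x)"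
      using p by (simp add: pderiv_funpow_eq_0)
    moreover have "(H has_real_derivative h x) (at x)" using x c by (intro h(3)) auto
    ultimately show ?thesis by (rule DERIV_unique)
  qed
  have "negligible (N \<union> S \<union> {0, 1})" using h(2) S by (simp add: negligible_Un)
  then have "((\<lambda>x. poly p x * E x) has_integral H c) {0..c}"
    using eq int by (rule has_integral_spike)
  then show ?thesis by (simp add: H_def)
qed

section \<open>Taylor's formula with integral remainder\<close>

definition tpoly :: "real \<Rightarrow> nat \<Rightarrow> real poly" where
  "tpoly c i = smult (1 / fact i) ([:- c, 1:] ^ i)"

lemma poly_tpoly: "poly (tpoly c i) x = (x - c) ^ i / fact i"
  by (simp add: tpoly_def poly_power)

lemma degree_tpoly [simp]: "degree (tpoly c i) = i"
  by (simp add: tpoly_def degree_linear_power)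

lemma pderiv_tpoly: "pderiv (tpoly c i) = (case i of 0 \<Rightarrow> 0 | Suc i' \<Rightarrow> tpoly c i')"
proof (cases i)
  case 0
  then show ?thesis by (simp add: tpoly_def)
next
  case (Suc i')
  have "pderiv (tpoly c (Suc i')) = smult (1 / fact (Suc i')) (smult (real (Suc i')) ([:- c, 1:] ^ i'))"
    unfolding tpoly_def pderiv_smult pderiv_power_Suc by (simp add: pderiv_pCons)
  then show ?thesis by (simp add: Suc tpoly_def)
qed

lemma funpow_pderiv_tpoly: "(pderiv ^^ j) (tpoly c i) = (if j \<le> i then tpoly c (i - j) else 0)"
proof (induction j)
  case (Suc j)
  show ?case by (auto simp: Suc pderiv_tpoly split: nat.splits intro!: arg_cong[of _ _ "tpoly c"])
qed simp

text \<open>For the divided power about \<open>c\<close>, all derivatives except the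
  \<open>i\<close>-th vanish at \<open>c\<close>, so a single boundary term remains.\<close>

corollary taylor_remainder:
  fixes \<phi> :: "nat \<Rightarrow> real \<Rightarrow> real"
  assumes \<phi>: "\<And>j x. Suc j < n \<Longrightarrow> x \<in> {0<..<1} \<Longrightarrow> (\<phi> j has_real_derivative \<phi> (Suc j) x) (at x)"
    and ac: "\<And>j. j < n \<Longrightarrow> absolutely_continuous_on_interval 0 1 (\<phi> j)"
    and zero: "\<And>j. j < n \<Longrightarrow> \<phi> j 0 = 0"
    and S: "negligible S" and E: "\<And>x. x \<in> {0<..<1} - S \<Longrightarrow> (\<phi> (n - 1) has_real_derivative E x) (at x)"
    and i: "i < n" and c: "c \<in> {0..1}"
  shows "((\<lambda>x. poly (tpoly c i) x * E x) has_integral (- 1) ^ i * \<phi> (n - 1 - i) c) {0..c}"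
proof -
  have "(\<Sum>j<n. (- 1) ^ j * (poly ((pderiv ^^ j) (tpoly c i)) c * \<phi> (n - 1 - j) c)) =
     (\<Sum>j<n. if j = i then (- 1) ^ i * \<phi> (n - 1 - i) c else 0)"
    by (intro sum.cong) (auto simp: funpow_pderiv_tpoly poly_tpoly)
  also have "\<dots> = (- 1) ^ i * \<phi> (n - 1 - i) c" using i by simp
  finally have "(\<Sum>j<n. (- 1) ^ j * (poly ((pderiv ^^ j) (tpoly c i)) c * \<phi> (n - 1 - j) c)) =
     (- 1) ^ i * \<phi> (n - 1 - i) c" .
  moreover have "((\<lambda>x. poly (tpoly c i) x * E x) has_integral
    (\<Sum>j<n. (- 1) ^ j * (poly ((pderiv ^^ j) (tpoly c i)) c * \<phi> (n - 1 - j) c))) {0..c}"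
    using assms by (intro iterated_parts[where S = S]) auto
  ultimately show ?thesis by simp
qed

section \<open>The roots and the sign pattern of the derivative\<close>

text \<open>With \<open>t = x\<^sup>2 - x\<close>, the fifth derivative of \<open>t\<^sup>n\<^sup>-\<^sup>1\<close> is \<open>2 x - 1\<close> times \<open>quadB n t\<close> and the sixth
  derivative of \<open>t\<^sup>n\<close> is \<open>cubicC n t\<close>, both up to a constant and the factor \<open>t\<^sup>n\<^sup>-\<^sup>6\<close>.\<close>

definition quadB :: "real \<Rightarrow> real \<Rightarrow> real" where
  "quadB N t = (N - 4) * (N - 5) + (8 * N - 20) * (N - 4) * t + (4 * N - 6) * (4 * N - 10) * t\<^sup>2"

definition cubicC :: "real \<Rightarrow> real \<Rightarrow> real" where
  "cubicC N t = (N - 3) * (N - 4) * (N - 5) + (12 * N - 30) * (N - 3) * (N - 4) * t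
     + (4 * N - 6) * (12 * N - 30) * (N - 3) * t\<^sup>2 + (4 * N - 2) * (4 * N - 6) * (4 * N - 10) * t^3"

lemma quadB_factor:
  assumes "n \<ge> 6"
  shows "quadB (real n) t = (4 * real n - 6) * (4 * real n - 10) * ((t - t_hat1 n) * (t - t_hat2 n))"
proof -
  define N where "N = real n"
  have N: "N \<ge> 6" using assms by (simp add: N_def)
  define p where "p = (N - 4) / (2 * (2 * N - 3))"
  define q where "q = sqrt (5 * (N - 4) * (2 * N - 5)) / (2 * (2 * N - 3) * (2 * N - 5))"
  have th: "t_hat1 n = - p - q" "t_hat2 n = - p + q"
    unfolding t_hat1_def t_hat2_def p_def q_def N_def by (simp_all only: minus_divide_left)
  have "q\<^sup>2 = 5 * (N - 4) * (2 * N - 5) / (2 * (2 * N - 3) * (2 * N - 5))\<^sup>2"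
    using N by (simp add: q_def power_divide)
  also have "\<dots> = 5 * (N - 4) / (4 * (2 * N - 3)\<^sup>2 * (2 * N - 5))"
    using N by (simp add: power2_eq_square divide_simps) (simp add: algebra_simps)
  finally have q: "q\<^sup>2 = 5 * (N - 4) / (4 * (2 * N - 3)\<^sup>2 * (2 * N - 5))" .
  have "(t - t_hat1 n) * (t - t_hat2 n) = (t + p)\<^sup>2 - q\<^sup>2"
    by (simp add: th power2_eq_square algebra_simps)
  also have "(4 * N - 6) * (4 * N - 10) * \<dots> = quadB N t"
  proof -
    define u where "u = 2 * N - 3"
    define v where "v = 2 * N - 5"
    have uv: "u \<noteq> 0" "v \<noteq> 0" "4 * N - 6 = 2 * u" "4 * N - 10 = 2 * v" using N by (auto simp: u_def v_def)
    have "(4 * N - 6) * (4 * N - 10) * ((t + p)\<^sup>2 - q\<^sup>2)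
        = 4 * u * v * t\<^sup>2 + 4 * v * (N - 4) * t + ((N - 4)\<^sup>2 * v - 5 * (N - 4)) / u"
      unfolding q p_def u_def[symmetric] v_def[symmetric] uv(3,4)
      using uv(1,2) by (simp add: field_simps power2_eq_square)
    also have "((N - 4)\<^sup>2 * v - 5 * (N - 4)) / u = (N - 4) * (N - 5)"
      using uv(1,2) by (simp add: field_simps power2_eq_square) (simp add: u_def v_def algebra_simps)
    finally show ?thesis
      by (simp add: quadB_def u_def v_def algebra_simps)
  qed
  finally show ?thesis by (simp add: N_def)
qed

text \<open>Division with remainder. The remainder has the sign of \<open>- (t - s)\<close>, where \<open>s\<close> is the point that
  \<open>quadB_separator\<close> puts between the two roots of \<open>quadB\<close>; this decides the sign of the cubic at those roots.\<close>

lemma cubicC_quadB: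
  assumes "N \<ge> 6"
  shows "cubicC N t = ((4 * N - 2) * t + (2 * N\<^sup>2 - 9 * N + 19) / (2 * N - 3)) * quadB N t
    - 10 * (N - 4) / (2 * N - 3) * (2 * (2 * N - 7) * t + (N - 5))"
proof -
  have "(2 * N - 3) * cubicC N t = ((4 * N - 2) * (2 * N - 3) * t + (2 * N\<^sup>2 - 9 * N + 19)) * quadB N t
    - 10 * (N - 4) * (2 * (2 * N - 7) * t + (N - 5))"
    by (simp add: cubicC_def quadB_def) (simp add: algebra_simps power2_eq_square power3_eq_cube)
  moreover have "2 * N - 3 \<noteq> 0" using assms by simp
  ultimately show ?thesis by (simp add: divide_simps) (simp add: algebra_simps)
qed

text \<open>The argument is the zero of the linear remainder in \<open>cubicC_quadB\<close>. The
  leading coefficient of \<open>quadB\<close> is positive, so a negative value means lying strictly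
  between the roots.\<close>

lemma quadB_separator:
  assumes "N \<ge> 6"
  shows "quadB N (- (N - 5) / (2 * (2 * N - 7))) < 0"
proof -
  define d where "d = 2 * (2 * N - 7)"
  have "d > 0" using assms by (simp add: d_def)
  have "quadB N (- (N - 5) / d) * d\<^sup>2 = - 12 * (N - 5) * (2 * N - 3)"
    using \<open>d > 0\<close> by (simp add: quadB_def field_simps power2_eq_square) (simp add: d_def algebra_simps)
  also have "\<dots> < 0" using assms by (simp add: mult_neg_pos)
  finally have "quadB N (- (N - 5) / d) < 0" using \<open>d > 0\<close> by (simp add: mult_less_0_iff)
  then show ?thesis unfolding d_def .
qed

lemma pos_mult_sign:
  fixes k x :: real
  assumes "k > 0"
  shows "k * x < 0 \<longleftrightarrow> x < 0" "0 < k * x \<longleftrightarrow> 0 < x"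
  using assms by (simp_all add: mult_less_0_iff zero_less_mult_iff)

text \<open>\<open>quadB\<close> is positive at \<open>-1/4\<close>, where it equals
  \<open>15/4\<close>, and at 0, but negative at the separator between them; this traps one root on
  each side.\<close>

lemma t_hat_bounds:
  assumes "n \<ge> 6"
  shows "- 1 / 4 < t_hat1 n" "t_hat1 n < - (real n - 5) / (2 * (2 * real n - 7))"
    "- (real n - 5) / (2 * (2 * real n - 7)) < t_hat2 n" "t_hat2 n < 0"
proof -
  define N where "N = real n"
  have N: "N \<ge> 6" using assms by (simp add: N_def)
  define s where "s = - (N - 5) / (2 * (2 * N - 7))"
  have s: "- 1 / 4 < s" "s < 0" using N by (auto simp: s_def field_simps)
  have le: "t_hat1 n \<le> t_hat2 n"
  proof -
    have "0 \<le> sqrt (5 * (N - 4) * (2 * N - 5)) / (2 * (2 * N - 3) * (2 * N - 5))" using N by simp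
    then show ?thesis by (simp add: t_hat1_def t_hat2_def N_def)
  qed
  have pos: "(4 * N - 6) * (4 * N - 10) > 0" using N by simp
  have fac: "quadB N t = (4 * N - 6) * (4 * N - 10) * ((t - t_hat1 n) * (t - t_hat2 n))" for t
    using quadB_factor[OF assms, of t] by (simp add: N_def)
  have "(s - t_hat1 n) * (s - t_hat2 n) < 0"
    using quadB_separator[OF N] unfolding s_def[symmetric] fac pos_mult_sign[OF pos] .
  then have 1: "t_hat1 n < s" "s < t_hat2 n" using le by (auto simp: mult_less_0_iff)
  have "quadB N (- 1 / 4) > 0" by (simp add: quadB_def power2_eq_square algebra_simps)
  then have "(- 1 / 4 - t_hat1 n) * (- 1 / 4 - t_hat2 n) > 0"
    unfolding fac pos_mult_sign[OF pos] .
  then have 2: "- 1 / 4 < t_hat1 n" using 1 s by (auto simp: zero_less_mult_iff)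
  have "quadB N 0 > 0" using N by (simp add: quadB_def)
  then have "(0 - t_hat1 n) * (0 - t_hat2 n) > 0"
    unfolding fac pos_mult_sign[OF pos] .
  then have 3: "t_hat2 n < 0" using 1 s by (auto simp: zero_less_mult_iff mult_less_0_iff)
  show "- 1 / 4 < t_hat1 n" "t_hat1 n < - (real n - 5) / (2 * (2 * real n - 7))"
    "- (real n - 5) / (2 * (2 * real n - 7)) < t_hat2 n" "t_hat2 n < 0"
    using 1 2 3 by (simp_all add: s_def N_def)
qed

text \<open>At a root of \<open>quadB\<close> the cubic is minus a positive multiple of the linear
  remainder, and \<open>t_hat_bounds\<close> tells on which side of the remainder's zero that root
  lies. \<open>cubic_interlacing\<close> needs exactly these four alternating signs.\<close>

lemma cubicC_signs:
  assumes "n \<ge> 6"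
  shows "cubicC (real n) (- 1 / 4) < 0" "cubicC (real n) (t_hat1 n) > 0"
    "cubicC (real n) (t_hat2 n) < 0" "cubicC (real n) 0 > 0"
proof -
  define N where "N = real n"
  have N: "N \<ge> 6" using assms by (simp add: N_def)
  have "cubicC N (- 1 / 4) = - 15 / 8"
    by (simp add: cubicC_def power2_eq_square power3_eq_cube algebra_simps)
  then show "cubicC (real n) (- 1 / 4) < 0" by (simp add: N_def)
  have k: "10 * (N - 4) / (2 * N - 3) > 0" "2 * N - 7 > 0" using N by auto
  have eq: "cubicC N t = - (10 * (N - 4) / (2 * N - 3) * (2 * (2 * N - 7) * t + (N - 5)))"
    if "t \<in> {t_hat1 n, t_hat2 n}" for t
    using that quadB_factor[OF assms, of t] cubicC_quadB[OF N, of t] by (auto simp: N_def)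
  have "2 * (2 * N - 7) * t_hat1 n + (N - 5) < 0" "2 * (2 * N - 7) * t_hat2 n + (N - 5) > 0"
    using t_hat_bounds(2,3)[OF assms] k(2) unfolding N_def[symmetric] by (auto simp: field_simps)
  then have "10 * (N - 4) / (2 * N - 3) * (2 * (2 * N - 7) * t_hat1 n + (N - 5)) < 0"
    "10 * (N - 4) / (2 * N - 3) * (2 * (2 * N - 7) * t_hat2 n + (N - 5)) > 0"
    using k(1) by (metis mult_pos_neg, metis mult_pos_pos)
  then show "cubicC (real n) (t_hat1 n) > 0" "cubicC (real n) (t_hat2 n) < 0"
    using eq[of "t_hat1 n"] eq[of "t_hat2 n"] by (auto simp: N_def)
  show "cubicC (real n) 0 > 0" using N by (simp add: cubicC_def N_def)
qed

text \<open>Moving the origin to the mean of the three roots removes the square term. With \<rho>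
  and \<phi> as in \<open>cubicC_factor\<close>, the bracket is
  \<open>z^3 - (3/4) \<rho>^2 z - \<rho>^3 cos \<phi> / 4\<close>, which is fitted to the
  triple-angle formula.\<close>

lemma cubicC_shift:
  assumes "N \<ge> 6"
  shows "cubicC N (- (N - 3) / (2 * (2 * N - 1)) + z) = (4 * N - 2) * (4 * N - 6) * (4 * N - 10) *
    (z^3 - 3 / 4 * (5 * (N - 3) / ((2 * N - 1)\<^sup>2 * (2 * N - 3))) * z
      - 5 * (N - 3) * (2 * N - 11) / (4 * (2 * N - 1)^3 * (2 * N - 3) * (2 * N - 5)))"
proof -
  define u where "u = 2 * N - 1"
  define v where "v = 2 * N - 3"
  define w where "w = 2 * N - 5"
  have nz: "u \<noteq> 0" "v \<noteq> 0" "w \<noteq> 0" using assms by (auto simp: u_def v_def w_def)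
  have eqs: "4 * N - 2 = 2 * u" "4 * N - 6 = 2 * v" "4 * N - 10 = 2 * w" by (auto simp: u_def v_def w_def)
  have "(4 * N - 2) * (4 * N - 6) * (4 * N - 10) *
    (z^3 - 3 / 4 * (5 * (N - 3) / (u\<^sup>2 * v)) * z - 5 * (N - 3) * (2 * N - 11) / (4 * u^3 * v * w))
     = 8 * u * v * w * z^3 - 30 * (N - 3) * w / u * z - 10 * (N - 3) * (2 * N - 11) / u\<^sup>2"
    unfolding eqs using nz by (simp add: field_simps power2_eq_square power3_eq_cube)
  moreover have "cubicC N (- (N - 3) / (2 * u) + z)
     = 8 * u * v * w * z^3 - 30 * (N - 3) * w / u * z - 10 * (N - 3) * (2 * N - 11) / u\<^sup>2"
  proof -
    define P where "P = (N - 3)"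
    have q: "12 * N - 30 = 6 * w" by (simp add: w_def)
    have "cubicC N (- P / (2 * u) + z) = 8 * u * v * w * z^3
       + (6 * w * (N - 4) - 6 * v * w * P / u) * P * z
       + (P * (N - 4) * (N - 5) - 3 * w * P\<^sup>2 * (N - 4) / u + 2 * v * w * P^3 / u\<^sup>2)"
      unfolding cubicC_def eqs q P_def[symmetric] using nz
      by (simp add: field_simps power2_eq_square power3_eq_cube)
    also have "6 * w * (N - 4) - 6 * v * w * P / u = - 30 * w / u"
      using nz by (simp add: field_simps) (simp add: u_def v_def P_def algebra_simps)
    also have "P * (N - 4) * (N - 5) - 3 * w * P\<^sup>2 * (N - 4) / u + 2 * v * w * P^3 / u\<^sup>2
      = P * ((N - 4) * (N - 5) * u\<^sup>2 - 3 * w * P * (N - 4) * u + 2 * v * w * P\<^sup>2) / u\<^sup>2"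
      using nz by (simp add: field_simps power2_eq_square power3_eq_cube)
    also have "(N - 4) * (N - 5) * u\<^sup>2 - 3 * w * P * (N - 4) * u + 2 * v * w * P\<^sup>2 = - 10 * (2 * N - 11)"
      by (simp add: u_def v_def w_def P_def power2_eq_square algebra_simps)
    finally show ?thesis using nz by (simp add: P_def field_simps)
  qed
  ultimately show ?thesis by (simp add: u_def v_def w_def)
qed

lemma is_angle_ex1:
  assumes "n \<ge> 6"
  shows "\<exists>!\<phi>. is_angle n \<phi>"
proof -
  define N where "N = real n"
  have N: "N \<ge> 6" using assms by (simp add: N_def)
  define c where "c = (2 * N - 11) / (2 * N - 5) * (sqrt (2 * N - 3) / sqrt (5 * (N - 3)))"
  have "c > 0" using N by (simp add: c_def)
  have "c\<^sup>2 = (2 * N - 11)\<^sup>2 * (2 * N - 3) / ((2 * N - 5)\<^sup>2 * (5 * (N - 3)))"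
    using N by (simp add: c_def power_mult_distrib power_divide)
  also have "\<dots> < 1 / 2"
  proof -
    \<comment> \<open>Expansion about the least admissible value \<open>N = 6\<close> makes all
      coefficients positive.\<close>
    have "5 * (N - 3) * (2 * N - 5)\<^sup>2 - 2 * ((2 * N - 11)\<^sup>2 * (2 * N - 3)) =
       4 * (N - 6)^3 + 112 * (N - 6)\<^sup>2 + 589 * (N - 6) + 717"
      by (simp add: power2_eq_square power3_eq_cube algebra_simps)
    also have "\<dots> > 0"
      using N by (intro add_nonneg_pos add_nonneg_nonneg mult_nonneg_nonneg zero_le_power) auto
    finally show ?thesis using N by (simp add: divide_simps) (simp add: algebra_simps)
  qed
  finally have "c\<^sup>2 < (sqrt 2 / 2)\<^sup>2" by (simp add: power_divide)
  then have "c < sqrt 2 / 2" by (rule power2_less_imp_less) simp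
  define \<phi> where "\<phi> = arccos c"
  have c1: "-1 \<le> c" "c \<le> 1" using \<open>c > 0\<close> \<open>c < sqrt 2 / 2\<close> sqrt2_less_2 by linarith+
  have "cos \<phi> = c" "0 \<le> \<phi>" "\<phi> \<le> pi" using c1 by (simp_all add: \<phi>_def arccos_lbound arccos_ubound)
  have "\<phi> < pi / 2"
  proof (rule ccontr)
    assume "\<not> ?thesis"
    then have "cos \<phi> \<le> cos (pi / 2)" using \<open>\<phi> \<le> pi\<close> by (intro cos_monotone_0_pi_le) auto
    then show False using \<open>cos \<phi> = c\<close> \<open>c > 0\<close> by simp
  qed
  moreover have "pi / 4 < \<phi>"
  proof (rule ccontr)
    assume "\<not> ?thesis"
    then have "cos (pi / 4) \<le> cos \<phi>" using \<open>0 \<le> \<phi>\<close> by (intro cos_monotone_0_pi_le) auto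
    then show False using \<open>cos \<phi> = c\<close> \<open>c < sqrt 2 / 2\<close> by (simp add: cos_45)
  qed
  ultimately have "is_angle n \<phi>"
    using \<open>cos \<phi> = c\<close> by (simp add: is_angle_def c_def N_def)
  moreover have "\<psi> = \<phi>" if "is_angle n \<psi>" for \<psi>
  proof (rule cos_inj_pi)
    show "0 \<le> \<psi>" "\<psi> \<le> pi" using that pi_gt_zero unfolding is_angle_def greaterThanLessThan_iff by linarith+
    show "cos \<psi> = cos \<phi>" using that \<open>cos \<phi> = c\<close> by (simp add: is_angle_def c_def N_def)
  qed fact+
  ultimately show ?thesis by blast
qed

text \<open>Vieta's substitution \<open>z = \<rho> cos \<theta>\<close> turns the depressed cubic
  into \<open>cos (3 \<theta>) = cos \<phi>\<close>. The solutions are \<phi>/3 and \<phi>/3 shifted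
  by a third of a turn either way, the latter written as negative cosines with shift
  \<open>pi / 3\<close>.\<close>

lemma cubicC_factor:
  assumes "n \<ge> 6" "is_angle n \<phi>"
  shows "cubicC (real n) t = (4 * real n - 2) * (4 * real n - 6) * (4 * real n - 10) *
    ((t - t1 n \<phi>) * (t - t2 n \<phi>) * (t - t3 n \<phi>))"
proof -
  define N where "N = real n"
  have N: "N \<ge> 6" using assms by (simp add: N_def)
  define s where "s = - (N - 3) / (2 * (2 * N - 1))"
  define \<rho> where "\<rho> = sqrt (5 * (N - 3)) / ((2 * N - 1) * sqrt (2 * N - 3))"
  define c where "c = cos (\<phi> / 3)"
  define e where "e = sqrt 3 / 2 * sin (\<phi> / 3)"
  have e2: "e\<^sup>2 = 3 / 4 * (1 - c\<^sup>2)"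
    by (simp add: e_def c_def power_mult_distrib power_divide sin_squared_eq)
  have t: "t1 n \<phi> = s - \<rho> * (c / 2 + e)" "t2 n \<phi> = s - \<rho> * (c / 2 - e)" "t3 n \<phi> = s + \<rho> * c"
    by (simp_all add: t1_def t2_def t3_def s_def \<rho>_def c_def e_def N_def cos_diff cos_add cos_60 sin_60)
  have r2: "\<rho>\<^sup>2 = 5 * (N - 3) / ((2 * N - 1)\<^sup>2 * (2 * N - 3))"
    using N by (simp add: \<rho>_def power_divide power_mult_distrib)
  have "\<rho> * cos \<phi> = (2 * N - 11) / ((2 * N - 5) * (2 * N - 1))"
    using assms(2) N by (simp add: is_angle_def \<rho>_def N_def)
  moreover have "cos \<phi> = 4 * c^3 - 3 * c" using cos_treble_cos[of "\<phi> / 3"] by (simp add: c_def)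
  ultimately have r1: "\<rho> * (4 * c^3 - 3 * c) = (2 * N - 11) / ((2 * N - 5) * (2 * N - 1))" by simp
  define z where "z = t - s"
  have "(t - t1 n \<phi>) * (t - t2 n \<phi>) * (t - t3 n \<phi>) = ((z + \<rho> * c / 2)\<^sup>2 - \<rho>\<^sup>2 * e\<^sup>2) * (z - \<rho> * c)"
    by (simp add: t z_def power2_eq_square field_simps)
  also have "\<dots> = z^3 - 3 / 4 * \<rho>\<^sup>2 * z - \<rho>\<^sup>2 * (\<rho> * (4 * c^3 - 3 * c)) / 4"
    unfolding e2 by (simp add: power2_eq_square power3_eq_cube field_simps)
  also have "(4 * N - 2) * (4 * N - 6) * (4 * N - 10) * \<dots> = cubicC N (s + z)"
    unfolding r1 r2 s_def cubicC_shift[OF N] by (simp add: power2_eq_square power3_eq_cube mult_ac)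
  finally show ?thesis by (simp add: z_def N_def)
qed

lemma t_order:
  assumes "n \<ge> 6" "is_angle n \<phi>"
  shows "t1 n \<phi> < t2 n \<phi>" "t2 n \<phi> < t3 n \<phi>"
proof -
  define N where "N = real n"
  have N: "N \<ge> 6" using assms by (simp add: N_def)
  have \<phi>: "0 < \<phi> / 3" "\<phi> / 3 < pi / 6" using assms(2) by (auto simp: is_angle_def)
  define \<rho> where "\<rho> = sqrt (5 * (N - 3)) / ((2 * N - 1) * sqrt (2 * N - 3))"
  have "\<rho> > 0" using N by (simp add: \<rho>_def)
  have sin: "0 < sin (\<phi> / 3)" using \<phi> pi_gt_zero by (intro sin_gt_zero) linarith+
  have "cos (pi / 6) < cos (\<phi> / 3)" using \<phi> pi_gt_zero by (intro cos_monotone_0_pi) linarith+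
  moreover have "sin (\<phi> / 3) < sin (pi / 6)" using \<phi> pi_gt_zero by (intro sin_monotone_2pi) linarith+
  ultimately have b: "sqrt 3 / 2 < cos (\<phi> / 3)" "sin (\<phi> / 3) < 1 / 2" by (simp_all add: cos_30 sin_30)
  have "- cos (\<phi> / 3 - pi / 3) < - cos (\<phi> / 3 + pi / 3)"
    using sin by (simp add: cos_diff cos_add cos_60 sin_60)
  then show "t1 n \<phi> < t2 n \<phi>"
    using \<open>\<rho> > 0\<close> unfolding t1_def t2_def N_def[symmetric] \<rho>_def[symmetric] by simp
  have "sqrt 3 * sin (\<phi> / 3) < sqrt 3 * (1 / 2)" using b by (intro mult_strict_left_mono) auto
  moreover have "cos (\<phi> / 3 + pi / 3) = cos (\<phi> / 3) / 2 - sqrt 3 * sin (\<phi> / 3) / 2"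
    by (simp add: cos_add cos_60 sin_60)
  moreover have "sqrt 3 > 0" by simp
  ultimately have "- cos (\<phi> / 3 + pi / 3) < cos (\<phi> / 3)" using b by linarith
  then have "\<rho> * (- cos (\<phi> / 3 + pi / 3)) < \<rho> * cos (\<phi> / 3)"
    using \<open>\<rho> > 0\<close> by (rule mult_strict_left_mono)
  then show "t2 n \<phi> < t3 n \<phi>"
    unfolding t2_def t3_def N_def[symmetric] \<rho>_def[symmetric] by simp
qed

text \<open>A monic cubic with ordered real roots is negative exactly to the left of all roots and
  between the last two. The four sign conditions then leave one possible order.\<close>

lemma cubic_interlacing:
  fixes x0 x1 x2 x3 r1 r2 r3 :: real
  assumes "x0 < x1" "x1 < x2" "x2 < x3" "r1 < r2" "r2 < r3"
    and "(x0 - r1) * (x0 - r2) * (x0 - r3) < 0" "(x1 - r1) * (x1 - r2) * (x1 - r3) > 0"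
    and "(x2 - r1) * (x2 - r2) * (x2 - r3) < 0" "(x3 - r1) * (x3 - r2) * (x3 - r3) > 0"
  shows "x0 < r1 \<and> r1 < x1 \<and> x1 < r2 \<and> r2 < x2 \<and> x2 < r3 \<and> r3 < x3"
proof -
  have neg: "x < r1 \<or> r2 < x \<and> x < r3" if "(x - r1) * (x - r2) * (x - r3) < 0" for x
    using that assms(4,5) by (auto simp: mult_less_0_iff zero_less_mult_iff)
  have pos: "r1 < x \<and> x < r2 \<or> r3 < x" if "(x - r1) * (x - r2) * (x - r3) > 0" for x
    using that assms(4,5) by (auto simp: mult_less_0_iff zero_less_mult_iff)
  show ?thesis using neg[OF assms(6)] pos[OF assms(7)] neg[OF assms(8)] pos[OF assms(9)] assms(1-5) by linarith
qed

lemma root_interlacing: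
  assumes "n \<ge> 6" "is_angle n \<phi>"
  shows "- 1 / 4 < t1 n \<phi> \<and> t1 n \<phi> < t_hat1 n \<and> t_hat1 n < t2 n \<phi> \<and>
      t2 n \<phi> < t_hat2 n \<and> t_hat2 n < t3 n \<phi> \<and> t3 n \<phi> < 0"
proof (rule cubic_interlacing)
  define k where "k = (4 * real n - 2) * (4 * real n - 6) * (4 * real n - 10)"
  have "k > 0" using assms by (simp add: k_def)
  have fac: "cubicC (real n) t = k * ((t - t1 n \<phi>) * (t - t2 n \<phi>) * (t - t3 n \<phi>))" for t
    unfolding k_def by (rule cubicC_factor[OF assms])
  show "(- 1 / 4 - t1 n \<phi>) * (- 1 / 4 - t2 n \<phi>) * (- 1 / 4 - t3 n \<phi>) < 0"
    "(t_hat1 n - t1 n \<phi>) * (t_hat1 n - t2 n \<phi>) * (t_hat1 n - t3 n \<phi>) > 0"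
    "(t_hat2 n - t1 n \<phi>) * (t_hat2 n - t2 n \<phi>) * (t_hat2 n - t3 n \<phi>) < 0"
    "(0 - t1 n \<phi>) * (0 - t2 n \<phi>) * (0 - t3 n \<phi>) > 0"
    using cubicC_signs[OF assms(1)] \<open>k > 0\<close> unfolding fac pos_mult_sign[OF \<open>k > 0\<close>] by auto
qed (use t_order[OF assms] t_hat_bounds[OF assms(1)] in auto)

section \<open>Local extrema from a factored derivative\<close>

lemma strict_local_min_deriv:
  fixes F G :: "real \<Rightarrow> real"
  assumes "open S" "c \<in> S" "\<And>x. x \<in> S \<Longrightarrow> (F has_real_derivative (x - c) * G x) (at x)"
    and "isCont G c" "G c > 0"
  shows "\<forall>\<^sub>F x in at c. F c < F x"
proof -
  have "\<forall>\<^sub>F x in nhds c. G x > 0"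
    using order_tendstoD(1)[OF assms(4)[unfolded isCont_def] assms(5)] assms(5)
    by (simp add: eventually_nhds_conv_at)
  then obtain d where d: "d > 0" "\<And>x. dist x c < d \<Longrightarrow> G x > 0"
    by (auto simp: eventually_nhds_metric)
  obtain d' where d': "d' > 0" "\<And>x. dist x c < d' \<Longrightarrow> x \<in> S"
    using assms(1,2) by (auto simp: open_dist)
  have "F c < F x" if "x \<noteq> c" "dist x c < min d d'" for x
  proof (cases "c < x")
    case True
    have "\<exists>z. c < z \<and> z < x \<and> F x - F c = (x - c) * ((z - c) * G z)"
      using True by (rule MVT2) (use that True in \<open>auto intro!: assms(3) d'(2) simp: dist_real_def\<close>)
    then obtain z where z: "c < z" "z < x" "F x - F c = (x - c) * ((z - c) * G z)" by blast
    moreover have "G z > 0" using z that by (intro d(2)) (auto simp: dist_real_def)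
    ultimately have "F x - F c > 0" using True by simp
    then show ?thesis by simp
  next
    case False
    have "x < c" using that False by simp
    have "\<exists>z. x < z \<and> z < c \<and> F c - F x = (c - x) * ((z - c) * G z)"
      using \<open>x < c\<close> by (rule MVT2) (use that \<open>x < c\<close> in \<open>auto intro!: assms(3) d'(2) simp: dist_real_def\<close>)
    then obtain z where z: "x < z" "z < c" "F c - F x = (c - x) * ((z - c) * G z)" by blast
    moreover have "G z > 0" using z that by (intro d(2)) (auto simp: dist_real_def)
    ultimately have "F c - F x < 0" using \<open>x < c\<close> by (simp add: mult_pos_neg mult_neg_pos)
    then show ?thesis by simp
  qed
  then show ?thesis
    unfolding eventually_at using d(1) d'(1) by (intro exI[of _ "min d d'"]) auto
qed

lemma not_local_extremum_deriv:
  fixes F :: "real \<Rightarrow> real"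
  assumes "open S" "c \<in> S" "(F has_real_derivative l) (at c)" "l \<noteq> 0"
  shows "c \<notin> local_min_points S F" "c \<notin> local_max_points S F"
proof -
  have ev: "\<exists>d>0. \<forall>y. \<bar>c - y\<bar> < d \<longrightarrow> P y" if P: "\<forall>\<^sub>F y in at c within S. P y" "P c" for P
  proof -
    have "\<forall>\<^sub>F y in nhds c. P y"
      using that by (simp add: at_within_open[OF \<open>c \<in> S\<close> \<open>open S\<close>] eventually_nhds_conv_at)
    then show ?thesis by (auto simp: eventually_nhds_metric dist_real_def abs_minus_commute)
  qed
  show "c \<notin> local_min_points S F"
  proof
    assume "c \<in> local_min_points S F"
    then have "\<exists>d>0. \<forall>y. \<bar>c - y\<bar> < d \<longrightarrow> F c \<le> F y"
      by (intro ev[of "\<lambda>y. F c \<le> F y"]) (simp_all add: local_min_points_def)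
    then show False using DERIV_local_min[OF assms(3)] \<open>l \<noteq> 0\<close> by blast
  qed
  show "c \<notin> local_max_points S F"
  proof
    assume "c \<in> local_max_points S F"
    then have "\<exists>d>0. \<forall>y. \<bar>c - y\<bar> < d \<longrightarrow> F y \<le> F c"
      by (intro ev[of "\<lambda>y. F y \<le> F c"]) (simp_all add: local_max_points_def)
    then show False using DERIV_local_max[OF assms(3)] \<open>l \<noteq> 0\<close> by blast
  qed
qed

text \<open>A maximum of \<open>F\<close> is a minimum of \<open>- F\<close>. Strictness of the
  inequality excludes that the same point is also an extremum of the other kind.\<close>

lemma local_extremum_simple_zero:
  fixes F G :: "real \<Rightarrow> real"
  assumes "open S" "c \<in> S" "\<And>x. x \<in> S \<Longrightarrow> (F has_real_derivative (x - c) * G x) (at x)"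
    and "isCont G c" "G c \<noteq> 0"
  shows "c \<in> local_min_points S F \<longleftrightarrow> G c > 0" "c \<in> local_max_points S F \<longleftrightarrow> G c < 0"
proof -
  have nontriv: "\<not> (\<forall>\<^sub>F x in at c. False)" by simp
  have w: "at c within S = at c" using assms(1,2) by (rule at_within_open[rotated])
  have pos: "c \<in> local_min_points S F \<and> c \<notin> local_max_points S F" if "G c > 0"
  proof -
    have *: "\<forall>\<^sub>F x in at c. F c < F x" using assms(1-4) that by (rule strict_local_min_deriv)
    have "\<not> (\<forall>\<^sub>F x in at c. F x \<le> F c)"
    proof
      assume "\<forall>\<^sub>F x in at c. F x \<le> F c"
      with * have "\<forall>\<^sub>F x in at c. False" by eventually_elim simp
      then show False using nontriv by simp
    qed
    moreover have "\<forall>\<^sub>F x in at c. F c \<le> F x" using * by eventually_elim simp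
    ultimately show ?thesis using assms(2) by (simp add: local_min_points_def local_max_points_def w)
  qed
  have neg: "c \<notin> local_min_points S F \<and> c \<in> local_max_points S F" if "G c < 0"
  proof -
    have "\<forall>\<^sub>F x in at c. - F c < - F x"
    proof (rule strict_local_min_deriv[OF assms(1,2), of _ "\<lambda>x. - G x"])
      show "((\<lambda>x. - F x) has_real_derivative (x - c) * - G x) (at x)" if "x \<in> S" for x
        using DERIV_minus[OF assms(3)[OF that]] by simp
    qed (use assms that in auto)
    then have *: "\<forall>\<^sub>F x in at c. F x < F c" by simp
    have "\<not> (\<forall>\<^sub>F x in at c. F c \<le> F x)"
    proof
      assume "\<forall>\<^sub>F x in at c. F c \<le> F x"
      with * have "\<forall>\<^sub>F x in at c. False" by eventually_elim simp
      then show False using nontriv by simp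
    qed
    moreover have "\<forall>\<^sub>F x in at c. F x \<le> F c" using * by eventually_elim simp
    ultimately show ?thesis using assms(2) by (simp add: local_min_points_def local_max_points_def w)
  qed
  show "c \<in> local_min_points S F \<longleftrightarrow> G c > 0" "c \<in> local_max_points S F \<longleftrightarrow> G c < 0"
    using pos neg assms(5) by (cases "G c > 0"; simp)+
qed

text \<open>With \<open>t = a\<^sup>2 - a\<close>, a zero \<open>t = \<tau>\<close> of the product gives the two symmetric zeros \<open>c\<close>, \<open>1 - c\<close>,
  and \<open>t - \<tau> = (a - c) (a - (1 - c))\<close>.\<close>

lemma local_extremum_symmetric:
  fixes F K :: "real \<Rightarrow> real"
  assumes T: "finite T" "T \<subseteq> {- 1 / 4<..<0}"
    and F: "\<And>a. a \<in> {0<..<1} \<Longrightarrow>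
      (F has_real_derivative - ((2 * a - 1) * K a * (\<Prod>\<tau>\<in>T. a\<^sup>2 - a - \<tau>))) (at a)"
    and K: "\<And>a. a \<in> {0<..<1} \<Longrightarrow> K a > 0" "continuous_on {0<..<1} K"
  defines "pt \<equiv> \<lambda>\<tau>. {1 / 2 - 1 / 2 * sqrt (1 + 4 * \<tau>), 1 / 2 + 1 / 2 * sqrt (1 + 4 * \<tau>)}"
  defines "P \<equiv> \<lambda>\<tau>. (\<Prod>\<sigma>\<in>T - {\<tau>}. \<tau> - \<sigma>)"
  shows "local_min_points {0<..<1} F =
      (if odd (card T) then {1 / 2} else {}) \<union> (\<Union>\<tau>\<in>{\<tau>\<in>T. P \<tau> < 0}. pt \<tau>)" (is ?min)
    and "local_max_points {0<..<1} F =
      (if even (card T) then {1 / 2} else {}) \<union> (\<Union>\<tau>\<in>{\<tau>\<in>T. P \<tau> > 0}. pt \<tau>)" (is ?max)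
proof -
  let ?S = "{0<..<1 :: real}"
  have isCont_K: "isCont K a" if "a \<in> ?S" for a
    using K(2) that by (simp add: continuous_on_eq_continuous_at)
  have pt_iff: "a \<in> pt \<tau> \<longleftrightarrow> a\<^sup>2 - a = \<tau>" if "\<tau> \<in> T" for a \<tau>
  proof -
    have "1 + 4 * \<tau> > 0" using T(2) that by auto
    then have "sqrt (1 + 4 * \<tau>) * sqrt (1 + 4 * \<tau>) = 1 + 4 * \<tau>" by simp
    moreover define q where "q = sqrt (1 + 4 * \<tau>)"
    ultimately have "\<tau> = (q * q - 1) / 4" by simp
    then have "a\<^sup>2 - a - \<tau> = (a - (1 / 2 - 1 / 2 * sqrt (1 + 4 * \<tau>))) * (a - (1 / 2 + 1 / 2 * sqrt (1 + 4 * \<tau>)))"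
      unfolding q_def[symmetric] by (simp add: field_simps power2_eq_square)
    then show ?thesis by (auto simp: pt_def)
  qed
  have pt_S: "a \<in> ?S \<and> a \<noteq> 1 / 2" if "\<tau> \<in> T" "a\<^sup>2 - a = \<tau>" for a \<tau>
  proof -
    have "- 1 / 4 < a\<^sup>2 - a" "a * (1 - a) > 0" using T(2) that by (auto simp: power2_eq_square algebra_simps)
    then have "0 < a" "a < 1" by (auto simp: zero_less_mult_iff)
    moreover have "a \<noteq> 1 / 2"
    proof
      assume "a = 1 / 2"
      have "(1 / 2 :: real)\<^sup>2 - 1 / 2 = - 1 / 4" by (simp add: power2_eq_square)
      then show False using \<open>- 1 / 4 < a\<^sup>2 - a\<close> unfolding \<open>a = 1 / 2\<close> by simp
    qed
    ultimately show ?thesis by simp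
  qed
  have root: "(c \<in> local_min_points ?S F \<longleftrightarrow> P \<tau> < 0) \<and> (c \<in> local_max_points ?S F \<longleftrightarrow> P \<tau> > 0)"
    if "\<tau> \<in> T" "c\<^sup>2 - c = \<tau>" for c \<tau>
  proof -
    define G where "G a = - ((a - (1 - c)) * (2 * a - 1) * K a * (\<Prod>\<sigma>\<in>T - {\<tau>}. a\<^sup>2 - a - \<sigma>))" for a
    have c: "c \<in> ?S" "c \<noteq> 1 / 2" using pt_S[OF that] by auto
    have der: "(F has_real_derivative (a - c) * G a) (at a)" if "a \<in> ?S" for a
    proof -
      have "(\<Prod>\<sigma>\<in>T. a\<^sup>2 - a - \<sigma>) = (a\<^sup>2 - a - \<tau>) * (\<Prod>\<sigma>\<in>T - {\<tau>}. a\<^sup>2 - a - \<sigma>)"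
        using T(1) \<open>\<tau> \<in> T\<close> by (rule prod.remove)
      moreover have "a\<^sup>2 - a - \<tau> = (a - c) * (a - (1 - c))"
        unfolding \<open>c\<^sup>2 - c = \<tau>\<close>[symmetric] by (simp add: power2_eq_square algebra_simps)
      ultimately show ?thesis using F[OF that] by (simp add: G_def mult_ac)
    qed
    \<comment> \<open>At \<open>a = c\<close> the factor \<open>a - (1 - c)\<close> equals
      \<open>2 c - 1\<close> and completes a square, so the two symmetric points are of the same
      kind.\<close>
    have "G c = - ((2 * c - 1)\<^sup>2 * K c * P \<tau>)"
      unfolding G_def P_def \<open>c\<^sup>2 - c = \<tau>\<close> by (simp add: power2_eq_square)
    moreover have "(2 * c - 1)\<^sup>2 * K c > 0" using c K(1) by (intro mult_pos_pos) auto
    ultimately have sgn: "G c > 0 \<longleftrightarrow> P \<tau> < 0" "G c < 0 \<longleftrightarrow> P \<tau> > 0"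
      by (simp_all add: pos_mult_sign)
    have "P \<tau> \<noteq> 0" using T(1) by (auto simp: P_def)
    then have "G c \<noteq> 0" using sgn by linarith
    moreover have "isCont G c" unfolding G_def[abs_def] by (intro continuous_intros isCont_K c)
    ultimately show ?thesis
      using local_extremum_simple_zero[OF open_greaterThanLessThan c(1) der] sgn by simp
  qed
  have half: "(1 / 2 \<in> local_min_points ?S F \<longleftrightarrow> odd (card T)) \<and> (1 / 2 \<in> local_max_points ?S F \<longleftrightarrow> even (card T))"
  proof -
    define G where "G a = - (2 * K a * (\<Prod>\<sigma>\<in>T. a\<^sup>2 - a - \<sigma>))" for a
    have der: "(F has_real_derivative (a - 1 / 2) * G a) (at a)" if "a \<in> ?S" for a
      using F[OF that] by (simp add: G_def algebra_simps)
    \<comment> \<open>At the centre \<open>t = -1/4\<close> lies below every root, so each factor is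
      negative and only their number matters.\<close>
    have "(\<Prod>\<sigma>\<in>T. (1 / 2)\<^sup>2 - 1 / 2 - \<sigma>) = (\<Prod>\<sigma>\<in>T. (- 1) * (\<sigma> + 1 / 4))"
      by (intro prod.cong) (simp_all add: power2_eq_square)
    also have "\<dots> = (- 1) ^ card T * (\<Prod>\<sigma>\<in>T. \<sigma> + 1 / 4)" by (simp only: prod.distrib prod_constant)
    finally have G: "G (1 / 2) = - ((2 * K (1 / 2) * (\<Prod>\<sigma>\<in>T. \<sigma> + 1 / 4)) * (- 1) ^ card T)"
      by (simp add: G_def)
    have "(\<Prod>\<sigma>\<in>T. \<sigma> + 1 / 4) > 0" using T(2) by (intro prod_pos) auto
    then have "2 * K (1 / 2) * (\<Prod>\<sigma>\<in>T. \<sigma> + 1 / 4) > 0" using K(1) by simp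
    then have sgn: "G (1 / 2) > 0 \<longleftrightarrow> odd (card T)" "G (1 / 2) < 0 \<longleftrightarrow> even (card T)"
      unfolding G by (cases "even (card T)"; simp)+
    then have "G (1 / 2) \<noteq> 0" by (metis less_irrefl)
    moreover have "isCont G (1 / 2)" unfolding G_def[abs_def] by (intro continuous_intros isCont_K) auto
    ultimately show ?thesis
      using local_extremum_simple_zero[OF open_greaterThanLessThan _ der] sgn by simp
  qed
  have other: "a \<notin> local_min_points ?S F \<and> a \<notin> local_max_points ?S F"
    if "a \<noteq> 1 / 2" "a\<^sup>2 - a \<notin> T" for a
  proof (cases "a \<in> ?S")
    case True
    have "- ((2 * a - 1) * K a * (\<Prod>\<tau>\<in>T. a\<^sup>2 - a - \<tau>)) \<noteq> 0"
      using that T(1) K(1)[OF True] by auto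
    then show ?thesis using not_local_extremum_deriv[OF open_greaterThanLessThan True F[OF True]] by blast
  qed (auto simp: local_min_points_def local_max_points_def)
  have half_T: "(1 / 2)\<^sup>2 - 1 / 2 \<notin> T" using T(2) by (auto simp: power2_eq_square)
  have mem: "a \<in> (\<Union>\<tau>\<in>{\<tau>\<in>T. Q \<tau>}. pt \<tau>) \<longleftrightarrow> a\<^sup>2 - a \<in> T \<and> Q (a\<^sup>2 - a)" for a Q
    using pt_iff by auto
  show ?min
  proof (rule set_eqI)
    fix a
    show "a \<in> local_min_points ?S F \<longleftrightarrow>
        a \<in> (if odd (card T) then {1 / 2} else {}) \<union> (\<Union>\<tau>\<in>{\<tau>\<in>T. P \<tau> < 0}. pt \<tau>)"
    proof (cases "a = 1 / 2")
      case True
      show ?thesis unfolding Un_iff mem True using half half_T by simp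
    next
      case False
      then show ?thesis
        unfolding Un_iff mem using root[of "a\<^sup>2 - a" a] other[of a] by (cases "a\<^sup>2 - a \<in> T") auto
    qed
  qed
  show ?max
  proof (rule set_eqI)
    fix a
    show "a \<in> local_max_points ?S F \<longleftrightarrow>
        a \<in> (if even (card T) then {1 / 2} else {}) \<union> (\<Union>\<tau>\<in>{\<tau>\<in>T. P \<tau> > 0}. pt \<tau>)"
    proof (cases "a = 1 / 2")
      case True
      show ?thesis unfolding Un_iff mem True using half half_T by simp
    next
      case False
      then show ?thesis
        unfolding Un_iff mem using root[of "a\<^sup>2 - a" a] other[of a] by (cases "a\<^sup>2 - a \<in> T") auto
    qed
  qed
qed

lemma local_extremum_cong:
  assumes "open S" "\<And>x. x \<in> S \<Longrightarrow> F x = G x"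
  shows "local_min_points S F = local_min_points S G" "local_max_points S F = local_max_points S G"
proof -
  have "\<forall>\<^sub>F x in at a within S. F x = G x" for a
    using assms(2) by (auto simp: eventually_at_filter)
  then have *: "(\<forall>\<^sub>F x in at a within S. Q (F x)) \<longleftrightarrow> (\<forall>\<^sub>F x in at a within S. Q (G x))" for a Q
    by (rule eventually_cong) simp
  show "local_min_points S F = local_min_points S G"
    unfolding local_min_points_def using assms(2) *[of "\<lambda>y. F _ \<le> y"] by auto
  show "local_max_points S F = local_max_points S G"
    unfolding local_max_points_def using assms(2) *[of "\<lambda>y. y \<le> F _"] by auto
qed

section \<open>The extremal problem as an L2 distance\<close>

lemma DERIV_shift_power:
  "((\<lambda>x::real. (x - c) ^ (k + 1) / C) has_real_derivative real (k + 1) * (x - c) ^ k / C) (at x)"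
  unfolding Suc_eq_plus1[symmetric]
  by (rule DERIV_cong[OF DERIV_cdivide[OF DERIV_power_Suc[OF DERIV_diff[OF DERIV_ident DERIV_const]]]]) simp

lemma has_integral_poly_pint:
  assumes "0 \<le> c"
  shows "(poly p has_integral poly (pint p) c) {0..c}"
proof -
  have "(poly p has_integral poly (pint p) c - poly (pint p) 0) {0..c}"
    using assms poly_DERIV[of "pint p"]
    by (intro fundamental_theorem_of_calculus)
       (auto simp: has_real_derivative_iff_has_vector_derivative[symmetric] intro: has_field_derivative_at_within)
  then show ?thesis by simp
qed

text \<open>Taylor's formula for the chain of iterated primitives of \<open>p\<close>, all of which
  vanish at 0.\<close>

lemma taylor_remainder_poly:
  assumes c: "c \<in> {0..1}"
  shows "((\<lambda>x. poly (tpoly c i) x * poly p x) has_integral (- 1) ^ i * poly ((pint ^^ Suc i) p) c) {0..c}"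
proof -
  let ?\<phi> = "\<lambda>j. poly ((pint ^^ (Suc i - j)) p)"
  have der: "(?\<phi> j has_real_derivative poly ((pint ^^ (i - j)) p) x) (at x)" if "j \<le> i" for j x
    using poly_DERIV[of "(pint ^^ Suc (i - j)) p" x] that by (simp add: Suc_diff_le)
  have "((\<lambda>x. poly (tpoly c i) x * poly p x) has_integral (- 1) ^ i * ?\<phi> (Suc i - 1 - i) c) {0..c}"
  proof (rule taylor_remainder[where S = "{}"])
    show "(?\<phi> j has_real_derivative ?\<phi> (Suc j) x) (at x)" if "Suc j < Suc i" for j x
      using der[of j x] that by simp
    show "(?\<phi> (Suc i - 1) has_real_derivative poly p x) (at x)" for x
      using der[of i x] by simp
    show "?\<phi> j 0 = 0" if "j < Suc i" for j
      using that by (simp add: Suc_diff_le)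
  qed (use c in \<open>simp_all add: absolutely_continuous_poly\<close>)
  then show ?thesis by simp
qed

text \<open>Integration by parts in Rodrigues' formula: every boundary term contains a derivative of
  \<open>tpow m\<close> of order below \<open>m\<close>, and these vanish at both ends.\<close>

lemma legendre_orthogonal:
  assumes "degree p < m"
  shows "((\<lambda>x. poly p x * poly (legendre m) x) has_integral 0) {0..1}"
proof -
  let ?\<phi> = "\<lambda>j. poly ((pderiv ^^ j) (tpow m))"
  have "((\<lambda>x. poly p x * poly (legendre m) x) has_integral
      (\<Sum>j<m. (- 1) ^ j * (poly ((pderiv ^^ j) p) 1 * ?\<phi> (m - 1 - j) 1))) {0..1}"
  proof (rule iterated_parts[where S = "{}"])
    show "(?\<phi> j has_real_derivative ?\<phi> (Suc j) x) (at x)" for j x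
      using poly_DERIV[of "(pderiv ^^ j) (tpow m)" x] by simp
    obtain m' where m: "m = Suc m'" using assms by (metis not_less_zero not0_implies_Suc)
    show "(?\<phi> (m - 1) has_real_derivative poly (legendre m) x) (at x)" for x
      using poly_DERIV[of "(pderiv ^^ m') (tpow m)" x] by (simp add: m legendre_def)
    show "?\<phi> j 0 = 0" if "j < m" for j using tpow_boundary[OF that, of 0] by simp
  qed (use assms in \<open>simp_all add: absolutely_continuous_poly\<close>)
  also have "(\<Sum>j<m. (- 1) ^ j * (poly ((pderiv ^^ j) p) 1 * ?\<phi> (m - 1 - j) 1)) = 0"
    using tpow_boundary[of _ m 1] by (intro sum.neutral) auto
  finally show ?thesis .
qed

text \<open>Orthogonality to the constant 1 makes the primitive of \<open>legendre (Suc n)\<close>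
  vanish at 1, and by \<open>pint_legendre\<close> the values at 1 then agree two indices
  apart.\<close>

lemma poly_legendre_1: "poly (legendre m) 1 = 1"
proof (induction m rule: induct_nat_012)
  case (ge2 n)
  have "((\<lambda>x. poly 1 x * poly (legendre (Suc n)) x) has_integral 0) {0..1}"
    by (rule legendre_orthogonal) simp
  then have "(poly (legendre (Suc n)) has_integral 0) {0..1}" by simp
  then have "poly (pint (legendre (Suc n))) 1 = 0"
    using has_integral_poly_pint[of 1 "legendre (Suc n)"] by (intro has_integral_unique) simp_all
  moreover have "poly (smult (4 * real n + 6) (pint (legendre (Suc n)))) 1 =
      poly (legendre (Suc (Suc n)) - legendre n) 1"
    by (rule arg_cong[OF pint_legendre])
  ultimately show ?case using ge2 by simp
qed (simp_all add: legendre_1)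

text \<open>The derivative of \<open>L_m L_{m+1}\<close> integrates to 2. By orthogonality and
  \<open>pderiv_legendre\<close>, the only part of it with nonzero integral is
  \<open>(4 m + 2) L_m^2\<close>.\<close>

lemma legendre_norm:
  "((\<lambda>x. poly (legendre m) x * poly (legendre m) x) has_integral 1 / (2 * real m + 1)) {0..1}"
proof (cases m)
  case 0
  then show ?thesis using has_integral_const_real[of "1::real" 0 1] by simp
next
  case (Suc n)
  let ?L = "poly (legendre m)" and ?L' = "poly (legendre (Suc m))"
  have "((\<lambda>x. poly (pderiv (legendre m * legendre (Suc m))) x) has_integral
      poly (legendre m * legendre (Suc m)) 1 - poly (legendre m * legendre (Suc m)) 0) {0..1}"
    by (intro fundamental_theorem_of_calculus)
       (auto simp: has_real_derivative_iff_has_vector_derivative[symmetric] simp del: poly_mult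
         intro: has_field_derivative_at_within poly_DERIV)
  moreover have "poly (legendre m * legendre (Suc m)) 1 - poly (legendre m * legendre (Suc m)) 0 = 2"
  proof -
    have "(- 1 :: real) ^ m * (- 1) ^ m = 1" by (simp flip: power_mult_distrib)
    then show ?thesis by (simp add: poly_legendre_0 poly_legendre_1)
  qed
  ultimately have 1: "((\<lambda>x. poly (pderiv (legendre m * legendre (Suc m))) x) has_integral 2) {0..1}" by simp
  have 2: "((\<lambda>x. poly (pderiv (legendre m)) x * ?L' x) has_integral 0) {0..1}"
    by (rule legendre_orthogonal) (simp add: degree_pderiv)
  have 3: "((\<lambda>x. poly (pderiv (legendre n)) x * ?L x) has_integral 0) {0..1}"
    by (rule legendre_orthogonal) (simp add: degree_pderiv Suc)
  have "((\<lambda>x. poly (pderiv (legendre m * legendre (Suc m))) x - poly (pderiv (legendre m)) x * ?L' x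
      - poly (pderiv (legendre n)) x * ?L x) has_integral 2 - 0 - 0) {0..1}"
    by (intro has_integral_diff 1 2 3)
  moreover have "poly (pderiv (legendre m * legendre (Suc m))) x - poly (pderiv (legendre m)) x * ?L' x
      - poly (pderiv (legendre n)) x * ?L x = (4 * real n + 6) * (?L x * ?L x)" for x
  proof -
    have "poly (pderiv (legendre (Suc m))) x = poly (pderiv (legendre n)) x + (4 * real n + 6) * ?L x"
      unfolding Suc pderiv_legendre by simp
    then show ?thesis by (simp add: pderiv_mult algebra_simps)
  qed
  ultimately have "((\<lambda>x. (4 * real n + 6) * (?L x * ?L x)) has_integral 2) {0..1}" by simp
  then have "((\<lambda>x. 1 / (4 * real n + 6) * ((4 * real n + 6) * (?L x * ?L x))) has_integral 1 / (4 * real n + 6) * 2) {0..1}"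
    by (rule has_integral_mult_right)
  moreover have "1 / (4 * real n + 6) * ((4 * real n + 6) * y) = y" for y :: real
  proof -
    have "4 * real n + 6 \<noteq> 0" by linarith
    then show ?thesis by simp
  qed
  moreover have "1 / (4 * real n + 6) * 2 = 1 / (2 * real m + 1)"
    by (simp add: Suc field_simps)
  ultimately show ?thesis by simp
qed

lemma legendre_orthonormal:
  "((\<lambda>x. poly (legendre i) x * poly (legendre m) x) has_integral (if i = m then 1 / (2 * real m + 1) else 0)) {0..1}"
proof -
  consider "i < m" | "m < i" | "i = m" by linarith
  then show ?thesis
  proof cases
    case 1
    then show ?thesis using legendre_orthogonal[of "legendre i" m] by simp
  next
    case 2
    then show ?thesis using legendre_orthogonal[of "legendre m" i] by (simp add: mult.commute)
  next
    case 3
    then show ?thesis using legendre_norm by simp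
  qed
qed

text \<open>Up to the sign \<open>(- 1) ^ i\<close> this is \<open>x \<mapsto> (a - x)\<^sub>+\<^sup>i / i!\<close>, the kernel which recovers \<open>f\<^sup>(\<^sup>n\<^sup>-\<^sup>1\<^sup>-\<^sup>i\<^sup>)(a)\<close>
  from \<open>f\<^sup>(\<^sup>n\<^sup>)\<close>.\<close>

definition kern :: "real \<Rightarrow> nat \<Rightarrow> real \<Rightarrow> real" where
  "kern a i x = (if x \<in> {0..a} then poly (tpoly a i) x else 0)"

definition kcoeff :: "real \<Rightarrow> nat \<Rightarrow> nat \<Rightarrow> real" where
  "kcoeff a i m = (- 1) ^ i * poly ((pint ^^ Suc i) (legendre m)) a"

text \<open>\<open>kproj\<close> is the orthogonal projection of the kernel to the polynomials of degree less than \<open>n\<close>, and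
  \<open>kdist2\<close> the square of its distance from them.\<close>

definition kproj :: "nat \<Rightarrow> real \<Rightarrow> nat \<Rightarrow> real poly" where
  "kproj n a i = (\<Sum>m<n. smult ((2 * real m + 1) * kcoeff a i m) (legendre m))"

definition kresid :: "nat \<Rightarrow> real \<Rightarrow> nat \<Rightarrow> real \<Rightarrow> real" where
  "kresid n a i x = kern a i x - poly (kproj n a i) x"

definition kdist2 :: "nat \<Rightarrow> nat \<Rightarrow> real \<Rightarrow> real" where
  "kdist2 n i a = a ^ (2 * i + 1) / ((2 * real i + 1) * (fact i)\<^sup>2)
     - (\<Sum>m<n. (2 * real m + 1) * (poly ((pint ^^ Suc i) (legendre m)) a)\<^sup>2)"

context
  fixes a :: real and i n :: nat
  assumes a: "a \<in> {0<..<1}" and i: "i < n"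
begin

lemma kern_has_integral:
  "((\<lambda>x. kern a i x * h x) has_integral I) {0..1} \<longleftrightarrow>
    ((\<lambda>x. poly (tpoly a i) x * h x) has_integral I) {0..a}"
proof -
  have "(\<lambda>x. kern a i x * h x) = (\<lambda>x. if x \<in> {0..a} then poly (tpoly a i) x * h x else 0)"
    by (auto simp: kern_def)
  moreover have "{0..a} \<subseteq> {0..1}" using a by auto
  ultimately show ?thesis using has_integral_restrict by metis
qed

lemma kern_legendre: "((\<lambda>x. kern a i x * poly (legendre m) x) has_integral kcoeff a i m) {0..1}"
  unfolding kern_has_integral kcoeff_def using a by (intro taylor_remainder_poly) auto

lemma kern_square:
  "((\<lambda>x. kern a i x * kern a i x) has_integral a ^ (2 * i + 1) / ((2 * real i + 1) * (fact i)\<^sup>2)) {0..1}"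
proof -
  define C where "C = (2 * real i + 1) * (fact i)\<^sup>2"
  have "C > 0" by (simp add: C_def)
  have "((\<lambda>x. poly (tpoly a i) x * poly (tpoly a i) x) has_integral
    (a - a) ^ (2 * i + 1) / C - (0 - a) ^ (2 * i + 1) / C) {0..a}"
  proof (rule fundamental_theorem_of_calculus)
    fix x
    have "((\<lambda>x. (x - a) ^ (2 * i + 1) / C) has_real_derivative real (2 * i + 1) * (x - a) ^ (2 * i) / C) (at x)"
      by (rule DERIV_shift_power)
    also have "real (2 * i + 1) * (x - a) ^ (2 * i) / C = poly (tpoly a i) x * poly (tpoly a i) x"
    proof -
      have "poly (tpoly a i) x * poly (tpoly a i) x = (x - a) ^ (2 * i) / (fact i)\<^sup>2"
        by (simp add: poly_tpoly power2_eq_square mult_2 power_add)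
      moreover have "2 * real i + 1 \<noteq> 0" by linarith
      ultimately show ?thesis by (simp add: C_def add.commute)
    qed
    finally show "((\<lambda>x. (x - a) ^ (2 * i + 1) / C) has_vector_derivative
        poly (tpoly a i) x * poly (tpoly a i) x) (at x within {0..a})"
      by (simp add: has_real_derivative_iff_has_vector_derivative[symmetric] has_field_derivative_at_within)
  qed (use a in simp)
  moreover have "(a - a) ^ (2 * i + 1) / C - (0 - a) ^ (2 * i + 1) / C = a ^ (2 * i + 1) / C" by simp
  ultimately have "((\<lambda>x. poly (tpoly a i) x * poly (tpoly a i) x) has_integral a ^ (2 * i + 1) / C) {0..a}" by simp
  then have "((\<lambda>x. kern a i x * poly (tpoly a i) x) has_integral a ^ (2 * i + 1) / C) {0..1}"
    unfolding kern_has_integral .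
  moreover have "(\<lambda>x. kern a i x * kern a i x) = (\<lambda>x. kern a i x * poly (tpoly a i) x)"
    by (auto simp: kern_def)
  ultimately show ?thesis by (simp only: C_def)
qed

text \<open>On the Legendre basis the weights \<open>2 m + 1\<close> in \<open>kproj\<close> cancel
  the squared norms, so projection and kernel have equal inner products.\<close>

lemma kresid_orthogonal:
  assumes "degree p < n"
  shows "((\<lambda>x. kresid n a i x * poly p x) has_integral 0) {0..1}"
  using assms
proof (rule legendre_spans)
  fix j assume "j < n"
  have "((\<lambda>x. \<Sum>m<n. ((2 * real m + 1) * kcoeff a i m) * (poly (legendre m) x * poly (legendre j) x)) has_integral
      (\<Sum>m<n. ((2 * real m + 1) * kcoeff a i m) * (if m = j then 1 / (2 * real j + 1) else 0))) {0..1}"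
    by (intro has_integral_sum has_integral_mult_right legendre_orthonormal) simp
  also have "(\<Sum>m<n. ((2 * real m + 1) * kcoeff a i m) * (if m = j then 1 / (2 * real j + 1) else 0))
     = (\<Sum>m<n. if m = j then kcoeff a i j else 0)"
  proof (rule sum.cong[OF refl])
    fix m :: nat
    have "2 * real m + 1 \<noteq> 0" by linarith
    then show "((2 * real m + 1) * kcoeff a i m) * (if m = j then 1 / (2 * real j + 1) else 0) =
      (if m = j then kcoeff a i j else 0)" by simp
  qed
  also have "\<dots> = kcoeff a i j" using \<open>j < n\<close> by simp
  also have "(\<lambda>x. \<Sum>m<n. ((2 * real m + 1) * kcoeff a i m) * (poly (legendre m) x * poly (legendre j) x))
     = (\<lambda>x. poly (kproj n a i) x * poly (legendre j) x)"
    by (simp add: kproj_def poly_sum sum_distrib_right sum_distrib_left mult_ac)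
  finally have "((\<lambda>x. kern a i x * poly (legendre j) x - poly (kproj n a i) x * poly (legendre j) x)
      has_integral kcoeff a i j - kcoeff a i j) {0..1}"
    by (intro has_integral_diff kern_legendre)
  then show "((\<lambda>x. kresid n a i x * poly (legendre j) x) has_integral 0) {0..1}"
    by (simp add: kresid_def left_diff_distrib)
next
  fix p q
  assume "((\<lambda>x. kresid n a i x * poly p x) has_integral 0) {0..1}"
    "((\<lambda>x. kresid n a i x * poly q x) has_integral 0) {0..1}"
  from has_integral_add[OF this] show "((\<lambda>x. kresid n a i x * poly (p + q) x) has_integral 0) {0..1}"
    by (simp add: distrib_left)
next
  fix c p
  assume "((\<lambda>x. kresid n a i x * poly p x) has_integral 0) {0..1}"
  from has_integral_mult_right[OF this, of c] show "((\<lambda>x. kresid n a i x * poly (smult c p) x) has_integral 0) {0..1}"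
    by (simp add: mult_ac)
qed simp

lemma degree_kproj: "degree (kproj n a i) < n"
proof -
  have "degree (kproj n a i) \<le> n - 1"
    unfolding kproj_def by (intro degree_sum_le) (auto intro!: order_trans[OF degree_smult_le])
  then show ?thesis using i by simp
qed

text \<open>The residual is orthogonal to the projection, so its square integrates to the square
  norm of the kernel minus the inner product of kernel and projection. The signs in
  \<open>kcoeff\<close> square away.\<close>

lemma kresid_square: "((\<lambda>x. kresid n a i x * kresid n a i x) has_integral kdist2 n i a) {0..1}"
proof -
  have "((\<lambda>x. \<Sum>m<n. ((2 * real m + 1) * kcoeff a i m) * (kern a i x * poly (legendre m) x)) has_integral
      (\<Sum>m<n. ((2 * real m + 1) * kcoeff a i m) * kcoeff a i m)) {0..1}"
    by (intro has_integral_sum has_integral_mult_right kern_legendre) simp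
  also have "(\<lambda>x. \<Sum>m<n. ((2 * real m + 1) * kcoeff a i m) * (kern a i x * poly (legendre m) x))
     = (\<lambda>x. kern a i x * poly (kproj n a i) x)"
    by (simp add: kproj_def poly_sum sum_distrib_left mult_ac)
  finally have "((\<lambda>x. kern a i x * kern a i x - kern a i x * poly (kproj n a i) x - kresid n a i x * poly (kproj n a i) x)
    has_integral a ^ (2 * i + 1) / ((2 * real i + 1) * (fact i)\<^sup>2) -
      (\<Sum>m<n. ((2 * real m + 1) * kcoeff a i m) * kcoeff a i m) - 0) {0..1}"
    by (intro has_integral_diff kern_square kresid_orthogonal degree_kproj)
  moreover have "kern a i x * kern a i x - kern a i x * poly (kproj n a i) x - kresid n a i x * poly (kproj n a i) x
     = kresid n a i x * kresid n a i x" for x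
    by (simp add: kresid_def algebra_simps)
  moreover have "((2 * real m + 1) * kcoeff a i m) * kcoeff a i m =
     (2 * real m + 1) * (poly ((pint ^^ Suc i) (legendre m)) a)\<^sup>2" for m
  proof -
    have "(- 1 :: real) ^ i * (- 1) ^ i = 1" by (simp flip: power_mult_distrib)
    then have "kcoeff a i m * kcoeff a i m = (poly ((pint ^^ Suc i) (legendre m)) a)\<^sup>2"
      by (simp add: kcoeff_def power2_eq_square mult_ac del: funpow.simps)
    then show ?thesis by (simp add: mult.assoc)
  qed
  ultimately show ?thesis by (simp add: kdist2_def)
qed

lemma kdist2_nonneg: "kdist2 n i a \<ge> 0"
  using kresid_square by (rule has_integral_nonneg) simp

end

text \<open>The first summand differentiates to the square of the \<open>i\<close>-fold primitive of
  1, which cancels the square left by \<open>legendre_telescope\<close>.\<close>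

lemma kdist2_has_derivative:
  assumes "n \<ge> 1"
  shows "(kdist2 n i has_real_derivative
    - (poly ((pint ^^ i) (legendre n)) a * poly ((pint ^^ i) (legendre (n - 1))) a)) (at a)"
proof -
  obtain k where n: "n = Suc k" using assms by (metis Suc_le_D One_nat_def)
  have p1: "poly ((pint ^^ i) 1) x = x ^ i / fact i" for x
  proof -
    have "(pint ^^ i) 1 = tpoly 0 i"
    proof (induction i)
      case (Suc i)
      have "pint (pderiv (tpoly 0 (Suc i))) = tpoly 0 (Suc i)"
        by (rule pint_pderiv) (simp add: poly_tpoly)
      then show ?case by (simp add: Suc pderiv_tpoly)
    qed (simp add: tpoly_def)
    then show ?thesis by (simp add: poly_tpoly)
  qed
  have d: "((\<lambda>x. (poly ((pint ^^ Suc i) (legendre m)) x)\<^sup>2) has_real_derivative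
      2 * (poly ((pint ^^ Suc i) (legendre m)) a * poly ((pint ^^ i) (legendre m)) a)) (at a)" for m
    using poly_DERIV[of "(pint ^^ Suc i) (legendre m)" a] by (auto intro!: derivative_eq_intros)
  have "(kdist2 n i has_real_derivative real (2 * i + 1) * a ^ (2 * i) / ((2 * real i + 1) * (fact i)\<^sup>2)
     - (\<Sum>m<n. (2 * real m + 1) * (2 * (poly ((pint ^^ Suc i) (legendre m)) a * poly ((pint ^^ i) (legendre m)) a)))) (at a)"
    unfolding kdist2_def[abs_def]
    using DERIV_shift_power[of 0 "2 * i" "(2 * real i + 1) * (fact i)\<^sup>2" a]
    by (intro DERIV_diff DERIV_sum DERIV_cmult d) simp
  also have "(\<Sum>m<n. (2 * real m + 1) * (2 * (poly ((pint ^^ Suc i) (legendre m)) a * poly ((pint ^^ i) (legendre m)) a)))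
     = (\<Sum>m\<le>k. (4 * real m + 2) * (poly ((pint ^^ Suc i) (legendre m)) a * poly ((pint ^^ i) (legendre m)) a))"
    unfolding n lessThan_Suc_atMost by (intro sum.cong) (simp_all add: algebra_simps del: funpow.simps)
  also have "\<dots> = (a ^ i / fact i)\<^sup>2 + poly ((pint ^^ i) (legendre (Suc k))) a * poly ((pint ^^ i) (legendre k)) a"
    unfolding legendre_telescope p1 ..
  also have "real (2 * i + 1) * a ^ (2 * i) / ((2 * real i + 1) * (fact i)\<^sup>2) = (a ^ i / fact i)\<^sup>2"
  proof -
    have "a ^ (2 * i) = (a ^ i)\<^sup>2" by (simp add: mult.commute flip: power_mult)
    moreover have "real (2 * i + 1) = 2 * real i + 1" by simp
    moreover have "2 * real i + 1 \<noteq> 0" by linarith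
    ultimately show ?thesis by (simp only: power_divide mult_divide_mult_cancel_left_if if_False)
  qed
  finally show ?thesis by (simp add: n)
qed

section \<open>The class \<open>W20\<close>, extremal functions and the value of the
  supremum\<close>

lemma W20_representation:
  assumes f: "f \<in> W20 n" and "n \<ge> 1"
  obtains S where "negligible S" "\<And>x. x \<in> {0<..<1} - S \<Longrightarrow>
      (nth_deriv (n - 1) f has_real_derivative nth_deriv n f x) (at x)"
    "\<And>j x. Suc j < n \<Longrightarrow> x \<in> {0<..<1} \<Longrightarrow> (nth_deriv j f has_real_derivative nth_deriv (Suc j) f x) (at x)"
    "\<And>j. j < n \<Longrightarrow> absolutely_continuous_on_interval 0 1 (nth_deriv j f)"
    "\<And>j. j < n \<Longrightarrow> nth_deriv j f 0 = 0" "\<And>j. j < n \<Longrightarrow> nth_deriv j f 1 = 0"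
proof -
  have at: "at x within {0..1} = at x" if "x \<in> {0<..<1}" for x :: real
    using that by (simp add: at_within_Icc_at)
  have ac: "absolutely_continuous_on_interval 0 1 (nth_deriv j f)" if "j < n" for j
    using f that by (simp add: W20_def)
  obtain h N where h: "negligible N"
    "\<And>x. x \<in> {0..1} - N \<Longrightarrow> (nth_deriv (n - 1) f has_real_derivative h x) (at x)"
    using absolutely_continuous_fundamental_theorem[OF ac[of "n - 1"]] \<open>n \<ge> 1\<close>
    by (metis diff_less less_one linorder_not_le zero_less_one zero_le_one less_le_trans)
  have Suc: "nth_deriv (Suc j) f x = vector_derivative (nth_deriv j f) (at x within {0..1})" for j x
    by (simp add: nth_deriv_def)
  show thesis
  proof (rule that[OF h(1)])
    fix x assume x: "x \<in> {0<..<1} - N"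
    then have d: "(nth_deriv (n - 1) f has_real_derivative h x) (at x)" by (intro h(2)) auto
    then have "(nth_deriv (n - 1) f has_vector_derivative h x) (at x)"
      by (simp add: has_real_derivative_iff_has_vector_derivative)
    then have "vector_derivative (nth_deriv (n - 1) f) (at x) = h x" by (rule vector_derivative_at)
    \<comment> \<open>\<open>nth_deriv\<close> differentiates within \<open>{0..1}\<close>, which at
      interior points is the two-sided derivative; hence the almost everywhere derivative really is
      the \<open>n\<close>-th one.\<close>
    then have "nth_deriv n f x = h x"
      using Suc[of "n - 1" x] x at[of x] \<open>n \<ge> 1\<close> by simp
    then show "(nth_deriv (n - 1) f has_real_derivative nth_deriv n f x) (at x)" using d by simp
  next
    fix j x assume j: "Suc j < n" and x: "x \<in> {0<..<1::real}"
    have "nth_deriv j f differentiable at x within {0..1}"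
      using f j x by (auto simp: W20_def differentiable_on_def)
    then have "(nth_deriv j f has_vector_derivative nth_deriv (Suc j) f x) (at x within {0..1})"
      unfolding Suc by (simp add: vector_derivative_works)
    then show "(nth_deriv j f has_real_derivative nth_deriv (Suc j) f x) (at x)"
      unfolding at[OF x] by (simp add: has_real_derivative_iff_has_vector_derivative)
  qed (use f ac in \<open>auto simp: W20_def\<close>)
qed

lemma L2_has_integral:
  assumes "L2 g"
  shows "((\<lambda>x. g x * g x) has_integral (LINT x|lebesgue_on {0..1}. \<bar>g x\<bar>\<^sup>2)) {0..1}"
proof -
  have "((\<lambda>x. \<bar>g x\<bar>\<^sup>2) has_integral (LINT x|lebesgue_on {0..1}. \<bar>g x\<bar>\<^sup>2)) {0..1}"
    using assms by (intro has_integral_integral_lebesgue_on) (auto simp: L2_def)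
  then show ?thesis by (simp add: power2_eq_square)
qed

text \<open>For the nonnegative square, gauge integrability already means Lebesgue integrability.
  Integrability of \<open>g\<close> itself supplies the measurability.\<close>

lemma L2_I:
  assumes "((\<lambda>x. g x * g x) has_integral I) {0..1}" "g integrable_on {0..1}"
  shows "L2 g" "(LINT x|lebesgue_on {0..1}. \<bar>g x\<bar>\<^sup>2) = I"
proof -
  have sq: "((\<lambda>x. \<bar>g x\<bar>\<^sup>2) has_integral I) {0..1}" using assms(1) by (simp add: power2_eq_square)
  then have "(\<lambda>x. \<bar>g x\<bar>\<^sup>2) absolutely_integrable_on {0..1}"
    by (intro nonnegative_absolutely_integrable_1) auto
  then have int: "integrable (lebesgue_on {0..1}) (\<lambda>x. \<bar>g x\<bar>\<^sup>2)"
    by (rule absolutely_integrable_imp_integrable) simp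
  then show "L2 g" using assms(2) by (simp add: L2_def integrable_imp_measurable)
  show "(LINT x|lebesgue_on {0..1}. \<bar>g x\<bar>\<^sup>2) = I"
    using lebesgue_integral_eq_integral[OF int] sq by (simp add: integral_unique)
qed

text \<open>The truncated power with its knot at \<open>a\<close>. On \<open>[0, 1]\<close> it is a
  Taylor polynomial minus \<open>kern\<close>, so iterated primitives of the kernel are explicit.
  The strict inequality matches the closed right end of \<open>kern\<close> when the exponent is
  0.\<close>

definition tpow_trunc :: "real \<Rightarrow> nat \<Rightarrow> real \<Rightarrow> real" where
  "tpow_trunc a m x = (if x > a then (x - a) ^ m / fact m else 0)"

lemma tpow_trunc_Suc: "tpow_trunc a (Suc m) x = max 0 (x - a) ^ Suc m / fact (Suc m)"
  by (simp add: tpow_trunc_def max_def)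

lemma absolutely_continuous_tpow_trunc: "absolutely_continuous_on_interval u v (tpow_trunc a (Suc m))"
proof -
  have "absolutely_continuous_on_interval u v (\<lambda>x. 1 / fact (Suc m) * max 0 (x + - a) ^ Suc m)"
    by (intro absolutely_continuous_mult absolutely_continuous_const absolutely_continuous_power
        absolutely_continuous_max_0 absolutely_continuous_add absolutely_continuous_id)
  then show ?thesis
    by (rule absolutely_continuous_cong) (simp add: tpow_trunc_Suc del: fact_Suc power_Suc)
qed

lemma tpow_trunc_has_derivative:
  assumes "m \<ge> 1 \<or> x \<noteq> a"
  shows "(tpow_trunc a (Suc m) has_real_derivative tpow_trunc a m x) (at x)"
proof -
  consider "x > a" | "x < a" | "x = a" by linarith
  then show ?thesis
  proof cases
    case 1
    have "((\<lambda>x. (x - a) ^ (m + 1) / fact (Suc m)) has_real_derivative real (m + 1) * (x - a) ^ m / fact (Suc m)) (at x)"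
      by (rule DERIV_shift_power)
    moreover have "real (m + 1) * (x - a) ^ m / fact (Suc m) = tpow_trunc a m x"
      using 1 by (simp add: tpow_trunc_def del: of_nat_Suc)
    ultimately have "((\<lambda>x. (x - a) ^ (m + 1) / fact (Suc m)) has_real_derivative tpow_trunc a m x) (at x)" by simp
    then show ?thesis
      by (rule has_field_derivative_transform_within_open[of _ _ _ "{a<..}"])
         (use 1 in \<open>auto simp: tpow_trunc_def\<close>)
  next
    case 2
    have "((\<lambda>_. 0) has_real_derivative tpow_trunc a m x) (at x)" using 2 by (simp add: tpow_trunc_def)
    then show ?thesis
      by (rule has_field_derivative_transform_within_open[of _ _ _ "{..<a}"])
         (use 2 in \<open>auto simp: tpow_trunc_def\<close>)
  next
    case 3
    then obtain k where m: "m = Suc k" using assms by (cases m) auto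
    \<comment> \<open>At the knot this is the difference quotient itself, continuous because
      \<open>m\<close> is positive.\<close>
    define g where "g z = max 0 (z - a) ^ Suc k / fact (Suc m)" for z
    have "tpow_trunc a (Suc m) z - tpow_trunc a (Suc m) x = g z * (z - x)" for z
      by (auto simp: tpow_trunc_def g_def m 3 max_def)
    moreover have "isCont g x" unfolding g_def[abs_def] by (intro continuous_intros) simp
    moreover have "g x = tpow_trunc a m x" by (simp add: g_def tpow_trunc_def 3)
    ultimately show ?thesis unfolding CARAT_DERIV by blast
  qed
qed

lemma kern_eq_tpow_trunc:
  assumes "x \<in> {0..1}"
  shows "kern a i x = poly (tpoly a i) x - tpow_trunc a i x"
  using assms by (auto simp: kern_def tpow_trunc_def poly_tpoly)

context
  fixes a :: real and i n :: nat
  assumes a: "a \<in> {0<..<1}" and i: "i < n"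
begin

text \<open>Taylor's formula at \<open>a\<close> treats the kernel. The polynomial projection
  integrates to zero against the \<open>n\<close>-th derivative because all boundary data of
  \<open>f\<close> vanish.\<close>

lemma W20_recover:
  assumes f: "f \<in> W20 n"
  shows "((\<lambda>x. kresid n a i x * nth_deriv n f x) has_integral (- 1) ^ i * nth_deriv (n - 1 - i) f a) {0..1}"
proof -
  obtain S where S: "negligible S" "\<And>x. x \<in> {0<..<1} - S \<Longrightarrow>
      (nth_deriv (n - 1) f has_real_derivative nth_deriv n f x) (at x)"
    "\<And>j x. Suc j < n \<Longrightarrow> x \<in> {0<..<1} \<Longrightarrow> (nth_deriv j f has_real_derivative nth_deriv (Suc j) f x) (at x)"
    "\<And>j. j < n \<Longrightarrow> absolutely_continuous_on_interval 0 1 (nth_deriv j f)"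
    "\<And>j. j < n \<Longrightarrow> nth_deriv j f 0 = 0" "\<And>j. j < n \<Longrightarrow> nth_deriv j f 1 = 0"
    using W20_representation[OF f] i by (metis One_nat_def Suc_leI gr_zeroI not_less_zero)
  have "((\<lambda>x. poly (tpoly a i) x * nth_deriv n f x) has_integral (- 1) ^ i * nth_deriv (n - 1 - i) f a) {0..a}"
    using a i by (intro taylor_remainder[where S = S and \<phi> = "\<lambda>j. nth_deriv j f"] S) auto
  then have 1: "((\<lambda>x. kern a i x * nth_deriv n f x) has_integral (- 1) ^ i * nth_deriv (n - 1 - i) f a) {0..1}"
    unfolding kern_has_integral[OF a i] .
  have "((\<lambda>x. poly (kproj n a i) x * nth_deriv n f x) has_integral
      (\<Sum>j<n. (- 1) ^ j * (poly ((pderiv ^^ j) (kproj n a i)) 1 * nth_deriv (n - 1 - j) f 1))) {0..1}"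
    using degree_kproj[OF a i] by (intro iterated_parts[where S = S and \<phi> = "\<lambda>j. nth_deriv j f"] S) auto
  also have "(\<Sum>j<n. (- 1) ^ j * (poly ((pderiv ^^ j) (kproj n a i)) 1 * nth_deriv (n - 1 - j) f 1)) = 0"
    using S(6) by (intro sum.neutral) auto
  finally have 2: "((\<lambda>x. poly (kproj n a i) x * nth_deriv n f x) has_integral 0) {0..1}" .
  show ?thesis
    using has_integral_diff[OF 1 2] by (simp add: kresid_def left_diff_distrib)
qed

text \<open>Cauchy-Schwarz, obtained from the nonnegative quadratic in \<open>s\<close> given by the
  integral of \<open>(f^(n) - s * kresid)^2\<close>.\<close>

lemma W20_bound:
  assumes f: "f \<in> W20 n" and le: "(LINT x|lebesgue_on {0..1}. \<bar>nth_deriv n f x\<bar>\<^sup>2) \<le> 1"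
  shows "\<bar>nth_deriv (n - 1 - i) f a\<bar> \<le> sqrt (kdist2 n i a)"
proof -
  define F where "F = kdist2 n i a"
  define J where "J = (LINT x|lebesgue_on {0..1}. \<bar>nth_deriv n f x\<bar>\<^sup>2)"
  define c where "c = (- 1) ^ i * nth_deriv (n - 1 - i) f a"
  have F: "F \<ge> 0" using kdist2_nonneg[OF a i] by (simp add: F_def)
  have J: "((\<lambda>x. nth_deriv n f x * nth_deriv n f x) has_integral J) {0..1}"
    unfolding J_def using f by (intro L2_has_integral) (simp add: W20_def)
  have quad: "J - s * (2 * c) + s\<^sup>2 * F \<ge> 0" for s
  proof -
    have "((\<lambda>x. nth_deriv n f x * nth_deriv n f x - s * (2 * (kresid n a i x * nth_deriv n f x))
        + s\<^sup>2 * (kresid n a i x * kresid n a i x)) has_integral J - s * (2 * c) + s\<^sup>2 * F) {0..1}"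
      unfolding c_def F_def
      by (intro has_integral_add has_integral_diff has_integral_mult_right J kresid_square a i W20_recover f)
    moreover have "nth_deriv n f x * nth_deriv n f x - s * (2 * (kresid n a i x * nth_deriv n f x))
        + s\<^sup>2 * (kresid n a i x * kresid n a i x) = (nth_deriv n f x - s * kresid n a i x)\<^sup>2" for x
      by (simp add: power2_eq_square algebra_simps)
    ultimately have "((\<lambda>x. (nth_deriv n f x - s * kresid n a i x)\<^sup>2) has_integral J - s * (2 * c) + s\<^sup>2 * F) {0..1}"
      by (simp only:)
    then show ?thesis by (rule has_integral_nonneg) simp
  qed
  have "c\<^sup>2 \<le> F"
  proof (cases "F = 0")
    case True
    have "c = 0"
    proof (rule ccontr)
      assume "c \<noteq> 0"
      \<comment> \<open>Without its quadratic term the expression is linear in \<open>s\<close>, and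
        this choice makes it \<open>-1\<close>.\<close>
      have "J - (J + 1) / (2 * c) * (2 * c) \<ge> 0" using quad[of "(J + 1) / (2 * c)"] True by simp
      then show False using \<open>c \<noteq> 0\<close> by simp
    qed
    then show ?thesis using True by simp
  next
    case False
    then have "F > 0" using F by simp
    \<comment> \<open>The parabola in \<open>s\<close> has its vertex at
      \<open>c / F\<close>.\<close>
    have "J - c / F * (2 * c) + (c / F)\<^sup>2 * F = J - c\<^sup>2 / F"
      using False by (simp add: power2_eq_square field_simps)
    then have "c\<^sup>2 / F \<le> 1" using quad[of "c / F"] le by (simp add: J_def)
    then show ?thesis using \<open>F > 0\<close> by simp
  qed
  moreover have "\<bar>nth_deriv (n - 1 - i) f a\<bar> = \<bar>c\<bar>" by (simp add: c_def abs_mult power_abs)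
  ultimately show ?thesis unfolding F_def by (metis real_sqrt_abs real_sqrt_le_mono)
qed

text \<open>\<open>extr 0\<close> is the extremal function up to a factor: the \<open>n\<close>-fold primitive of \<open>kresid\<close>. It
  vanishes to order \<open>n\<close> at 1 because \<open>kresid\<close> is orthogonal to the polynomials of degree less than \<open>n\<close>.\<close>

definition extr :: "nat \<Rightarrow> real \<Rightarrow> real" where
  "extr j x = poly ((pint ^^ (n - j)) (tpoly a i - kproj n a i)) x - tpow_trunc a (i + (n - j)) x"

lemma extr_n: "x \<in> {0..1} \<Longrightarrow> extr n x = kresid n a i x"
  by (simp add: extr_def kresid_def kern_eq_tpow_trunc)

lemma extr_has_derivative:
  assumes "j < n" "Suc j < n \<or> x \<noteq> a"
  shows "(extr j has_real_derivative extr (Suc j) x) (at x)"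
proof -
  obtain m where m: "n - j = Suc m" "n - Suc j = m" using assms(1) by (metis Suc_diff_Suc)
  have "(poly ((pint ^^ Suc m) (tpoly a i - kproj n a i)) has_real_derivative
      poly ((pint ^^ m) (tpoly a i - kproj n a i)) x) (at x)"
    using poly_DERIV[of "(pint ^^ Suc m) (tpoly a i - kproj n a i)" x] by simp
  moreover have "(tpow_trunc a (Suc (i + m)) has_real_derivative tpow_trunc a (i + m) x) (at x)"
    using assms m by (intro tpow_trunc_has_derivative) auto
  ultimately show ?thesis
    unfolding extr_def[abs_def] m add_Suc_right by (rule DERIV_diff)
qed

lemma extr_ac:
  assumes "j < n"
  shows "absolutely_continuous_on_interval 0 1 (extr j)"
proof -
  obtain m where m: "n - j = Suc m" using assms by (metis Suc_diff_Suc)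
  show ?thesis
    unfolding extr_def[abs_def] m add_Suc_right
    by (intro absolutely_continuous_diff absolutely_continuous_poly absolutely_continuous_tpow_trunc)
qed

lemma extr_0:
  assumes "j < n"
  shows "extr j 0 = 0"
proof -
  obtain m where m: "n - j = Suc m" using assms by (metis Suc_diff_Suc)
  show ?thesis using a by (simp add: extr_def m tpow_trunc_def)
qed

text \<open>Taylor's formula at the endpoint 1 expresses this value, up to sign, as an inner product
  of \<open>kresid\<close> with a polynomial of degree below \<open>n\<close>.\<close>

lemma extr_1:
  assumes "j < n"
  shows "extr j 1 = 0"
proof -
  define k where "k = n - 1 - j"
  have k: "k < n" "n - 1 - k = j" using assms by (auto simp: k_def)
  have "((\<lambda>x. poly (tpoly 1 k) x * kresid n a i x) has_integral (- 1) ^ k * extr (n - 1 - k) 1) {0..1}"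
  proof (rule taylor_remainder[where S = "{a}"])
    show "(extr j has_real_derivative extr (Suc j) x) (at x)" if "Suc j < n" for j x
      using that by (intro extr_has_derivative) auto
    show "(extr (n - 1) has_real_derivative kresid n a i x) (at x)" if "x \<in> {0<..<1} - {a}" for x
      using extr_has_derivative[of "n - 1" x] that extr_n[of x] i by simp
  qed (use extr_ac extr_0 k in auto)
  moreover have "((\<lambda>x. poly (tpoly 1 k) x * kresid n a i x) has_integral 0) {0..1}"
    using kresid_orthogonal[OF a i, of "tpoly 1 k"] k by (simp add: mult.commute)
  ultimately have "(- 1) ^ k * extr (n - 1 - k) 1 = 0" by (rule has_integral_unique)
  then show ?thesis using k by simp
qed

lemma nth_deriv_extr:
  assumes "j \<le> n" "x \<in> {0..1}" "j < n \<or> x \<noteq> a"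
  shows "nth_deriv j (\<lambda>x. s * extr 0 x) x = s * extr j x"
  using assms
proof (induction j arbitrary: x)
  case 0
  show ?case by (simp add: nth_deriv_def)
next
  case (Suc j)
  have "((\<lambda>x. s * extr j x) has_vector_derivative s * extr (Suc j) x) (at x within {0..1})"
    unfolding has_real_derivative_iff_has_vector_derivative[symmetric]
    using Suc.prems by (intro has_field_derivative_at_within[OF DERIV_cmult[OF extr_has_derivative]]) auto
  then have "(nth_deriv j (\<lambda>x. s * extr 0 x) has_vector_derivative s * extr (Suc j) x) (at x within {0..1})"
  proof (rule has_vector_derivative_transform[rotated 2])
    show "nth_deriv j (\<lambda>x. s * extr 0 x) y = s * extr j y" if "y \<in> {0..1}" for y
      using Suc.prems(1) that by (intro Suc.IH) simp_all
  qed (rule Suc.prems(2))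
  then have "vector_derivative (nth_deriv j (\<lambda>x. s * extr 0 x)) (at x within {0..1}) = s * extr (Suc j) x"
    using Suc.prems(2) by (intro vector_derivative_within_closed_interval) auto
  then show ?case by (simp add: nth_deriv_def)
qed

lemma extr_W20:
  fixes s :: real
  defines "f \<equiv> \<lambda>x. s * extr 0 x"
  shows "f \<in> W20 n" "(LINT x|lebesgue_on {0..1}. \<bar>nth_deriv n f x\<bar>\<^sup>2) = s\<^sup>2 * kdist2 n i a"
proof -
  have lt: "nth_deriv j f x = s * extr j x" if "j < n" "x \<in> {0..1}" for j x
    unfolding f_def using that by (intro nth_deriv_extr) auto
  \<comment> \<open>For \<open>i = 0\<close> the kernel jumps at \<open>a\<close>, so the
    \<open>n\<close>-th derivative is not controlled there; a single point does not affect the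
    integrals.\<close>
  have eq: "nth_deriv n f x = s * kresid n a i x" if "x \<in> {0..1} - {a}" for x
    unfolding f_def using that extr_n[of x] nth_deriv_extr[of n x s] by simp
  have "((\<lambda>x. s\<^sup>2 * (kresid n a i x * kresid n a i x)) has_integral s\<^sup>2 * kdist2 n i a) {0..1}"
    by (intro has_integral_mult_right kresid_square a i)
  then have 1: "((\<lambda>x. nth_deriv n f x * nth_deriv n f x) has_integral s\<^sup>2 * kdist2 n i a) {0..1}"
    by (rule has_integral_spike[OF negligible_sing[of a], rotated]) (simp add: eq power2_eq_square)
  \<comment> \<open>Testing against the constant 1 yields integrability of the \<open>n\<close>-th
    derivative, from which \<open>L2_I\<close> takes measurability.\<close>
  have "((\<lambda>x. s * (kresid n a i x * poly 1 x)) has_integral s * 0) {0..1}"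
    using i by (intro has_integral_mult_right kresid_orthogonal a i) auto
  then have "(nth_deriv n f has_integral s * 0) {0..1}"
    by (rule has_integral_spike[OF negligible_sing[of a], rotated]) (simp add: eq)
  then have 2: "nth_deriv n f integrable_on {0..1}" by (rule has_integral_integrable)
  show "(LINT x|lebesgue_on {0..1}. \<bar>nth_deriv n f x\<bar>\<^sup>2) = s\<^sup>2 * kdist2 n i a"
    by (rule L2_I(2)[OF 1 2])
  show "f \<in> W20 n"
    unfolding W20_def
  proof (intro CollectI conjI allI impI)
    show "L2 (nth_deriv n f)" by (rule L2_I(1)[OF 1 2])
    show "nth_deriv j f 0 = 0" "nth_deriv j f 1 = 0" if "j < n" for j
      using that by (simp_all add: lt extr_0 extr_1)
    show "absolutely_continuous_on_interval 0 1 (nth_deriv j f)" if "j < n" for j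
    proof (rule absolutely_continuous_cong)
      show "absolutely_continuous_on_interval 0 1 (\<lambda>x. s * extr j x)"
        by (intro absolutely_continuous_mult absolutely_continuous_const extr_ac that)
    qed (simp add: lt that)
    show "nth_deriv j f differentiable_on {0..1}" if "Suc j < n" for j
      unfolding differentiable_on_def
    proof
      fix x :: real assume x: "x \<in> {0..1}"
      have "((\<lambda>x. s * extr j x) has_real_derivative s * extr (Suc j) x) (at x within {0..1})"
        using that by (intro has_field_derivative_at_within[OF DERIV_cmult[OF extr_has_derivative]]) auto
      then have "(nth_deriv j f has_vector_derivative s * extr (Suc j) x) (at x within {0..1})"
        unfolding has_real_derivative_iff_has_vector_derivative
      proof (rule has_vector_derivative_transform[rotated 2])
        show "nth_deriv j f y = s * extr j y" if "y \<in> {0..1}" for y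
          using \<open>Suc j < n\<close> that by (intro lt) simp_all
      qed (rule x)
      then show "nth_deriv j f differentiable at x within {0..1}"
        by (rule differentiableI_vector)
    qed
  qed
qed

text \<open>\<open>W20_recover\<close> is applied to the extremal function itself: its
  \<open>n\<close>-th derivative is the residual almost everywhere, so the recovered value is the
  square norm of the residual.\<close>

lemma extr_value: "extr (n - 1 - i) a = (- 1) ^ i * kdist2 n i a"
proof -
  have "((\<lambda>x. kresid n a i x * nth_deriv n (\<lambda>x. 1 * extr 0 x) x) has_integral
      (- 1) ^ i * nth_deriv (n - 1 - i) (\<lambda>x. 1 * extr 0 x) a) {0..1}"
    by (intro W20_recover extr_W20)
  moreover have "((\<lambda>x. kresid n a i x * nth_deriv n (\<lambda>x. 1 * extr 0 x) x) has_integral kdist2 n i a) {0..1}"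
    by (rule has_integral_spike[OF negligible_sing[of a] _ kresid_square[OF a i]])
       (use nth_deriv_extr[of n _ 1] extr_n in auto)
  ultimately have "(- 1) ^ i * nth_deriv (n - 1 - i) (\<lambda>x. 1 * extr 0 x) a = kdist2 n i a"
    by (rule has_integral_unique)
  moreover have "nth_deriv (n - 1 - i) (\<lambda>x. 1 * extr 0 x) a = 1 * extr (n - 1 - i) a"
    using a i by (intro nth_deriv_extr) auto
  ultimately have eq: "(- 1) ^ i * extr (n - 1 - i) a = kdist2 n i a" by simp
  have "(- 1 :: real) ^ i * (- 1) ^ i = 1" by (simp flip: power_mult_distrib)
  then show ?thesis unfolding eq[symmetric] by (simp add: mult.assoc[symmetric])
qed

text \<open>Equality in the Cauchy-Schwarz bound holds when the \<open>n\<close>-th derivative is a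
  multiple of \<open>kresid\<close>; the multiple is chosen to normalise its square norm.\<close>

theorem A_eq_sqrt_kdist2: "A n (n - 1 - i) a = sqrt (kdist2 n i a)"
  unfolding A_def
proof (rule cSup_eq_maximum)
  define F where "F = kdist2 n i a"
  define s where "s = 1 / sqrt F" \<comment> \<open>for \<open>F = 0\<close> this is 0, and the zero function is extremal\<close>
  define f where "f = (\<lambda>x. s * extr 0 x)"
  have F: "F \<ge> 0" using kdist2_nonneg[OF a i] by (simp add: F_def)
  have "f \<in> W20 n" unfolding f_def by (rule extr_W20)
  moreover have "(LINT x|lebesgue_on {0..1}. \<bar>nth_deriv n f x\<bar>\<^sup>2) \<le> 1"
    unfolding f_def extr_W20 using F by (simp add: s_def F_def[symmetric] power_divide)
  moreover have "\<bar>nth_deriv (n - 1 - i) f a\<bar> = sqrt F"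
  proof -
    have eq: "nth_deriv (n - 1 - i) f a = s * extr (n - 1 - i) a"
      unfolding f_def using a i by (intro nth_deriv_extr) auto
    show ?thesis
      unfolding eq extr_value F_def[symmetric]
      using F by (simp add: abs_mult power_abs s_def real_div_sqrt)
  qed
  ultimately show "sqrt (kdist2 n i a) \<in> {\<bar>nth_deriv (n - 1 - i) f a\<bar> |f.
      f \<in> W20 n \<and> (LINT x|lebesgue_on {0..1}. \<bar>nth_deriv n f x\<bar>\<^sup>2) \<le> 1}"
    unfolding F_def by (auto intro!: exI[of _ f])
qed (use W20_bound in auto)

end

section \<open>The case \<open>k = 5\<close> and the extremum points\<close>

lemma A5_square:
  assumes "n \<ge> 6" "a \<in> {0<..<1}"
  shows "(A n 5 a)\<^sup>2 = kdist2 n (n - 6) a"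
proof -
  have i: "n - 6 < n" "n - 1 - (n - 6) = 5" using assms(1) by auto
  show ?thesis
    using A_eq_sqrt_kdist2[OF assms(2) i(1)] kdist2_nonneg[OF assms(2) i(1)] unfolding i(2) by simp
qed

lemma kdist2_has_derivative_5:
  assumes "n \<ge> 6"
  shows "(kdist2 n (n - 6) has_real_derivative
    - ((2 * a - 1) * ((a\<^sup>2 - a) ^ (n - 6))\<^sup>2 / (fact (n - 3) * fact (n - 4))
       * (cubicC (real n) (a\<^sup>2 - a) * quadB (real n) (a\<^sup>2 - a)))) (at a)"
proof -
  have "(pint ^^ (n - 6)) (legendre n) = (pderiv ^^ 6) (tpow n)"
    using pint_funpow_legendre[of "n - 6" n] assms by simp
  moreover have "(pint ^^ (n - 6)) (legendre (n - 1)) = (pderiv ^^ 5) (tpow (n - 1))"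
  proof -
    have "n - 1 - (n - 6) = 5" using assms by simp
    then show ?thesis using pint_funpow_legendre[of "n - 6" "n - 1"] assms by simp
  qed
  ultimately have "(kdist2 n (n - 6) has_real_derivative
     - (poly ((pderiv ^^ 6) (tpow n)) a * poly ((pderiv ^^ 5) (tpow (n - 1))) a)) (at a)"
    using kdist2_has_derivative[of n "n - 6" a] assms by simp
  then show ?thesis
    unfolding poly_pderiv6_tpow[OF assms] poly_pderiv5_tpow[OF assms] cubicC_def[symmetric] quadB_def[symmetric]
    by (simp add: power2_eq_square mult_ac)
qed

theorem mainTheorem7:
  fixes n :: nat
  assumes "n \<ge> 6"
  shows "(\<exists>!\<phi>. is_angle n \<phi>) \<and>
    (\<forall>\<phi>. is_angle n \<phi> \<longrightarrow>
      - 1 / 4 < t1 n \<phi> \<and> t1 n \<phi> < t_hat1 n \<and> t_hat1 n < t2 n \<phi> \<and>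
      t2 n \<phi> < t_hat2 n \<and> t_hat2 n < t3 n \<phi> \<and> t3 n \<phi> < 0 \<and>
      local_min_points {0<..<1} (\<lambda>a. (A n 5 a)\<^sup>2) =
        {1 / 2} \<union>
        (\<Union>t\<in>{t_hat1 n, t_hat2 n}.
           {1 / 2 - 1 / 2 * sqrt (1 + 4 * t), 1 / 2 + 1 / 2 * sqrt (1 + 4 * t)}) \<and>
      local_max_points {0<..<1} (\<lambda>a. (A n 5 a)\<^sup>2) =
        (\<Union>t\<in>{t1 n \<phi>, t2 n \<phi>, t3 n \<phi>}.
           {1 / 2 - 1 / 2 * sqrt (1 + 4 * t), 1 / 2 + 1 / 2 * sqrt (1 + 4 * t)}))"
proof (intro conjI allI impI is_angle_ex1[OF assms])
  fix \<phi> assume \<phi>: "is_angle n \<phi>"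
  define r1 where "r1 = t1 n \<phi>"
  define h1 where "h1 = t_hat1 n"
  define r2 where "r2 = t2 n \<phi>"
  define h2 where "h2 = t_hat2 n"
  define r3 where "r3 = t3 n \<phi>"
  have ord: "- 1 / 4 < r1" "r1 < h1" "h1 < r2" "r2 < h2" "h2 < r3" "r3 < 0"
    using root_interlacing[OF assms \<phi>] by (simp_all add: r1_def r2_def r3_def h1_def h2_def)
  define T where "T = {r1, h1, r2, h2, r3}"
  define P where "P = (\<lambda>\<tau>. \<Prod>\<sigma>\<in>T - {\<tau>}. \<tau> - \<sigma>)"
  \<comment> \<open>The leading coefficients of the cubic and the quadratic, over the two factorials
    in the derivative formula.\<close>
  define \<kappa> where "\<kappa> = (4 * real n - 2) * (4 * real n - 6) * (4 * real n - 10) *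
     ((4 * real n - 6) * (4 * real n - 10)) / (fact (n - 3) * fact (n - 4))"
  have "\<kappa> > 0" using assms unfolding \<kappa>_def by (intro divide_pos_pos mult_pos_pos) auto
  have fin: "finite T" "T \<subseteq> {- 1 / 4<..<0}" "card T = 5" using ord by (auto simp: T_def)
  \<comment> \<open>The sign of \<open>P\<close> at a root is the parity of the number of larger
    roots: 4, 3, 2, 1, 0 in increasing order.\<close>
  have P: "P r1 > 0" "P h1 < 0" "P r2 > 0" "P h2 < 0" "P r3 > 0"
  proof -
    have "T - {r1} = {h1, r2, h2, r3}" "T - {h1} = {r1, r2, h2, r3}" "T - {r2} = {r1, h1, h2, r3}"
      "T - {h2} = {r1, h1, r2, r3}" "T - {r3} = {r1, h1, r2, h2}"
      using ord by (auto simp: T_def)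
    then have "P r1 = (r1 - h1) * (r1 - r2) * (r1 - h2) * (r1 - r3)"
      "P h1 = (h1 - r1) * (h1 - r2) * (h1 - h2) * (h1 - r3)"
      "P r2 = (r2 - r1) * (r2 - h1) * (r2 - h2) * (r2 - r3)"
      "P h2 = (h2 - r1) * (h2 - h1) * (h2 - r2) * (h2 - r3)"
      "P r3 = (r3 - r1) * (r3 - h1) * (r3 - r2) * (r3 - h2)"
      using ord unfolding P_def by (simp_all add: mult.assoc)
    then show "P r1 > 0" "P h1 < 0" "P r2 > 0" "P h2 < 0" "P r3 > 0"
      using ord by (simp_all add: zero_less_mult_iff mult_less_0_iff)
  qed
  have sets: "{\<tau> \<in> T. P \<tau> < 0} = {h1, h2}" "{\<tau> \<in> T. P \<tau> > 0} = {r1, r2, r3}"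
    using P by (auto simp: T_def)
  have prodT: "(\<Prod>\<tau>\<in>T. t - \<tau>) = (t - r1) * (t - r2) * (t - r3) * ((t - h1) * (t - h2))" for t
    using ord unfolding T_def by simp
  define K where "K a = \<kappa> * ((a\<^sup>2 - a) ^ (n - 6))\<^sup>2" for a :: real
  have der: "(kdist2 n (n - 6) has_real_derivative - ((2 * a - 1) * K a * (\<Prod>\<tau>\<in>T. a\<^sup>2 - a - \<tau>))) (at a)" for a
    using kdist2_has_derivative_5[OF assms, of a]
    unfolding cubicC_factor[OF assms \<phi>] quadB_factor[OF assms] prodT K_def \<kappa>_def
      r1_def[symmetric] r2_def[symmetric] r3_def[symmetric] h1_def[symmetric] h2_def[symmetric]
    by (simp add: mult_ac)
  have K: "K a > 0" if "a \<in> {0<..<1}" for a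
  proof -
    have "a\<^sup>2 - a = a * (a - 1)" by (simp add: power2_eq_square algebra_simps)
    then have "a\<^sup>2 - a \<noteq> 0" using that by auto
    then show ?thesis using \<open>\<kappa> > 0\<close> by (simp add: K_def)
  qed
  have contK: "continuous_on {0<..<1} K" unfolding K_def[abs_def] by (intro continuous_intros)
  have ext: "local_min_points {0<..<1} (kdist2 n (n - 6)) =
      (if odd (card T) then {1 / 2} else {}) \<union> (\<Union>\<tau>\<in>{\<tau>\<in>T. P \<tau> < 0}.
        {1 / 2 - 1 / 2 * sqrt (1 + 4 * \<tau>), 1 / 2 + 1 / 2 * sqrt (1 + 4 * \<tau>)})"
    "local_max_points {0<..<1} (kdist2 n (n - 6)) =
      (if even (card T) then {1 / 2} else {}) \<union> (\<Union>\<tau>\<in>{\<tau>\<in>T. P \<tau> > 0}.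
        {1 / 2 - 1 / 2 * sqrt (1 + 4 * \<tau>), 1 / 2 + 1 / 2 * sqrt (1 + 4 * \<tau>)})"
    unfolding P_def by (rule local_extremum_symmetric[OF fin(1,2) der K contK]; assumption)+
  have cong: "local_min_points {0<..<1} (\<lambda>a. (A n 5 a)\<^sup>2) = local_min_points {0<..<1} (kdist2 n (n - 6))"
    "local_max_points {0<..<1} (\<lambda>a. (A n 5 a)\<^sup>2) = local_max_points {0<..<1} (kdist2 n (n - 6))"
    using A5_square[OF assms] by (intro local_extremum_cong; simp)+
  show "- 1 / 4 < t1 n \<phi>" "t1 n \<phi> < t_hat1 n" "t_hat1 n < t2 n \<phi>" "t2 n \<phi> < t_hat2 n"
    "t_hat2 n < t3 n \<phi>" "t3 n \<phi> < 0"
    using ord by (simp_all add: r1_def r2_def r3_def h1_def h2_def)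
  show "local_min_points {0<..<1} (\<lambda>a. (A n 5 a)\<^sup>2) = {1 / 2} \<union>
        (\<Union>t\<in>{t_hat1 n, t_hat2 n}.
           {1 / 2 - 1 / 2 * sqrt (1 + 4 * t), 1 / 2 + 1 / 2 * sqrt (1 + 4 * t)})"
    unfolding cong(1) ext(1) sets fin(3) h1_def h2_def by simp
  show "local_max_points {0<..<1} (\<lambda>a. (A n 5 a)\<^sup>2) =
        (\<Union>t\<in>{t1 n \<phi>, t2 n \<phi>, t3 n \<phi>}.
           {1 / 2 - 1 / 2 * sqrt (1 + 4 * t), 1 / 2 + 1 / 2 * sqrt (1 + 4 * t)})"
    unfolding cong(2) ext(2) sets fin(3) r1_def r2_def r3_def by simp
qed

end
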